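(* Let $X$ be an element of a tracial $W^*$-probability space $(\mathcal A,E)$. If $X$ is bounded and invertible, then $$\det(X)=\exp\left\{-\frac12\int_0^1\log S_{X^*X}(-t)\,dt\right\}.$$
   Context: A tracial $W^*$-probability space $(\mathcal A,E)$ is a finite von Neumann algebra $\mathcal A$ with a normal faithful tracial state $E$, $E(I)=1$. "Invertible" means having a bounded inverse. For $\lambda\in(0,1)$, $\log^{+\lambda}(t)=\log t$ if $t>\lambda$ and $0$ if $t\le\lambda$. The extended Fuglede–Kadison determinant is $\det(X)=\exp\left(\frac12\lim_{\lambda\downarrow0}E\log^{+\lambda}(X^*X)\right)$; for $X$ with bounded inverse it equals the usual Fuglede–Kadison determinant $\exp\frac12E\log(X^*X)$. $S$-transform: for bounded non-negative $A\neq 0$, with spectral probability measure $\mu_A(S)=E(1_S(A))$, $\psi_A(z)=\sum_{k\ge1}E(A^k)z^k$ near $0$, and $S_A(z)=(1+z^{-1})\psi_A^{(-1)}(z)$, with $\psi_A^{(-1)}$ the functional inverse near $0$. With $\psi_A(z)=\int\frac{zx}{1-zx}\,\mu_A(dx)$, $\psi_A$ is a strictly increasing bijection of $(-\infty,0)$ onto $(-(1-\mu_A(\{0\})),0)$ (which is $(-1,0)$ if $A$ is invertible), and $\psi_A^{(-1)}$, $S_A$ are understood on that whole interval through this inverse. *)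

theory Defs
  imports "HOL-Probability.Probability"
begin

text \<open>
  Complex Hilbert spaces. The underlying real Hilbert space, with inner product \<open>Re (cinner x y)\<close>,
  is the one of the library classes, so that norm, limits and bounded operators are the library's.
  The form \<open>cinner\<close> is conjugate linear in its first and linear in its second argument.
\<close>

class complex_hilbert = real_inner + banach +
  fixes scaleC :: "complex \<Rightarrow> 'a \<Rightarrow> 'a" (infixr "*\<^sub>C" 75)
    and cinner :: "'a \<Rightarrow> 'a \<Rightarrow> complex"
  assumes scaleC_add_right: "c *\<^sub>C (x + y) = c *\<^sub>C x + c *\<^sub>C y"
    and scaleC_add_left: "(c + d) *\<^sub>C x = c *\<^sub>C x + d *\<^sub>C x"
    and scaleC_scaleC: "c *\<^sub>C (d *\<^sub>C x) = (c * d) *\<^sub>C x"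
    and scaleC_of_real: "of_real r *\<^sub>C x = r *\<^sub>R x"
    and cinner_commute: "cinner x y = cnj (cinner y x)"
    and cinner_add_right: "cinner x (y + z) = cinner x y + cinner x z"
    and cinner_scaleC_right: "cinner x (c *\<^sub>C y) = c * cinner x y"
    and Re_cinner: "Re (cinner x y) = inner x y"

instantiation complex :: complex_hilbert
begin

definition scaleC_complex :: "complex \<Rightarrow> complex \<Rightarrow> complex"
  where "scaleC_complex c z = c * z"

definition cinner_complex :: "complex \<Rightarrow> complex \<Rightarrow> complex"
  where "cinner_complex w z = cnj w * z"

instance
  by standard
    (auto simp: scaleC_complex_def cinner_complex_def inner_complex_def scaleR_conv_of_real
      algebra_simps)

end


subsection \<open>Bounded operators and von Neumann algebras\<close>

text \<open>
  The type \<open>'h \<Rightarrow>\<^sub>L 'h\<close> consists of the bounded real-linear maps; \<open>B(H)\<close> is the subset of the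
  complex-linear ones.
\<close>

definition bounded_ops :: "('h::complex_hilbert \<Rightarrow>\<^sub>L 'h) set"
  where "bounded_ops = {T. \<forall>c x. blinfun_apply T (c *\<^sub>C x) = c *\<^sub>C blinfun_apply T x}"

definition scaleC_op :: "complex \<Rightarrow> ('h::complex_hilbert \<Rightarrow>\<^sub>L 'h) \<Rightarrow> ('h \<Rightarrow>\<^sub>L 'h)"
  where "scaleC_op c T = Blinfun (\<lambda>x. c *\<^sub>C blinfun_apply T x)"

definition adj :: "('h::complex_hilbert \<Rightarrow>\<^sub>L 'h) \<Rightarrow> ('h \<Rightarrow>\<^sub>L 'h)"
  where "adj T = (THE T'. \<forall>x y. cinner (blinfun_apply T x) y = cinner x (blinfun_apply T' y))"

definition selfadjoint_op :: "('h::complex_hilbert \<Rightarrow>\<^sub>L 'h) \<Rightarrow> bool"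
  where "selfadjoint_op T \<longleftrightarrow> T \<in> bounded_ops \<and> adj T = T"

definition positive_op :: "('h::complex_hilbert \<Rightarrow>\<^sub>L 'h) \<Rightarrow> bool"
  where "positive_op T \<longleftrightarrow>
    T \<in> bounded_ops \<and> (\<forall>x. cinner x (blinfun_apply T x) \<in> \<real>\<^sub>\<ge>\<^sub>0)"

definition op_le :: "('h::complex_hilbert \<Rightarrow>\<^sub>L 'h) \<Rightarrow> ('h \<Rightarrow>\<^sub>L 'h) \<Rightarrow> bool"
  where "op_le S T \<longleftrightarrow> positive_op (T - S)"

definition boundedly_invertible :: "('h::complex_hilbert \<Rightarrow>\<^sub>L 'h) \<Rightarrow> bool"
  where "boundedly_invertible T \<longleftrightarrow>
    (\<exists>Y\<in>bounded_ops. T o\<^sub>L Y = id_blinfun \<and> Y o\<^sub>L T = id_blinfun)"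

definition commutant :: "('h::complex_hilbert \<Rightarrow>\<^sub>L 'h) set \<Rightarrow> ('h \<Rightarrow>\<^sub>L 'h) set"
  where "commutant N = {T \<in> bounded_ops. \<forall>S\<in>N. S o\<^sub>L T = T o\<^sub>L S}"

definition von_neumann_algebra :: "('h::complex_hilbert \<Rightarrow>\<^sub>L 'h) set \<Rightarrow> bool"
  where "von_neumann_algebra M \<longleftrightarrow>
    M \<subseteq> bounded_ops \<and> (\<forall>T\<in>M. adj T \<in> M) \<and> commutant (commutant M) = M"

text \<open>Finiteness: the identity is not Murray--von Neumann equivalent to a proper subprojection.\<close>

definition finite_von_neumann_algebra :: "('h::complex_hilbert \<Rightarrow>\<^sub>L 'h) set \<Rightarrow> bool"
  where "finite_von_neumann_algebra M \<longleftrightarrow>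
    von_neumann_algebra M \<and>
    (\<forall>V\<in>M. adj V o\<^sub>L V = id_blinfun \<longrightarrow> V o\<^sub>L adj V = id_blinfun)"

definition is_op_lub ::
    "('h::complex_hilbert \<Rightarrow>\<^sub>L 'h) set \<Rightarrow> ('h \<Rightarrow>\<^sub>L 'h) set \<Rightarrow> ('h \<Rightarrow>\<^sub>L 'h) \<Rightarrow> bool"
  where "is_op_lub M D T \<longleftrightarrow>
    T \<in> M \<and> selfadjoint_op T \<and> (\<forall>S\<in>D. op_le S T) \<and>
    (\<forall>U\<in>M. selfadjoint_op U \<and> (\<forall>S\<in>D. op_le S U) \<longrightarrow> op_le T U)"

text \<open>
  Normality is preservation of suprema of bounded increasing nets of positive elements; the nets
  are represented by upward directed sets having a least upper bound.
\<close>

definition normal_on ::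
    "('h::complex_hilbert \<Rightarrow>\<^sub>L 'h) set \<Rightarrow> (('h \<Rightarrow>\<^sub>L 'h) \<Rightarrow> complex) \<Rightarrow> bool"
  where "normal_on M E \<longleftrightarrow>
    (\<forall>D T. D \<subseteq> {S \<in> M. positive_op S} \<and> D \<noteq> {} \<and>
       (\<forall>S1\<in>D. \<forall>S2\<in>D. \<exists>S\<in>D. op_le S1 S \<and> op_le S2 S) \<and> is_op_lub M D T \<longrightarrow>
       Re (E T) = (SUP S\<in>D. Re (E S)))"

locale tracial_Wstar_probability_space =
  fixes M :: "('h::complex_hilbert \<Rightarrow>\<^sub>L 'h) set"
    and E :: "('h \<Rightarrow>\<^sub>L 'h) \<Rightarrow> complex"
  assumes finite_vN: "finite_von_neumann_algebra M"
    and E_add: "S \<in> M \<Longrightarrow> T \<in> M \<Longrightarrow> E (S + T) = E S + E T"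
    and E_scaleC: "T \<in> M \<Longrightarrow> E (scaleC_op c T) = c * E T"
    and E_positive: "T \<in> M \<Longrightarrow> positive_op T \<Longrightarrow> E T \<in> \<real>\<^sub>\<ge>\<^sub>0"
    and E_id: "E id_blinfun = 1"
    and E_tracial: "S \<in> M \<Longrightarrow> T \<in> M \<Longrightarrow> E (S o\<^sub>L T) = E (T o\<^sub>L S)"
    and E_faithful: "T \<in> M \<Longrightarrow> positive_op T \<Longrightarrow> E T = 0 \<Longrightarrow> T = 0"
    and E_normal: "normal_on M E"


subsection \<open>Spectral resolution and Borel functional calculus\<close>

definition is_projection :: "('h::complex_hilbert \<Rightarrow>\<^sub>L 'h) \<Rightarrow> bool"
  where "is_projection Q \<longleftrightarrow> selfadjoint_op Q \<and> Q o\<^sub>L Q = Q"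

definition projection_valued_measure :: "(real set \<Rightarrow> ('h::complex_hilbert \<Rightarrow>\<^sub>L 'h)) \<Rightarrow> bool"
  where "projection_valued_measure P \<longleftrightarrow>
    (\<forall>S\<in>sets borel. is_projection (P S)) \<and>
    P UNIV = id_blinfun \<and>
    (\<forall>F::nat \<Rightarrow> real set. range F \<subseteq> sets borel \<longrightarrow> disjoint_family F \<longrightarrow>
       (\<forall>x. (\<lambda>n. blinfun_apply (P (F n)) x) sums blinfun_apply (P (\<Union>n. F n)) x))"

definition vector_measure ::
    "(real set \<Rightarrow> ('h::complex_hilbert \<Rightarrow>\<^sub>L 'h)) \<Rightarrow> 'h \<Rightarrow> real measure"
  where "vector_measure P x =
    measure_of UNIV (sets borel) (\<lambda>S. ennreal (Re (cinner x (blinfun_apply (P S) x))))"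

text \<open>
  \<open>A = \<integral> t dP(t)\<close>, expressed by quadratic forms, which determine an operator on a complex Hilbert
  space. By the spectral theorem every bounded self-adjoint \<open>A\<close> has such a resolution, and its
  values on Borel sets are unique.
\<close>

definition is_spectral_resolution ::
    "('h::complex_hilbert \<Rightarrow>\<^sub>L 'h) \<Rightarrow> (real set \<Rightarrow> ('h \<Rightarrow>\<^sub>L 'h)) \<Rightarrow> bool"
  where "is_spectral_resolution A P \<longleftrightarrow>
    projection_valued_measure P \<and>
    (\<exists>K. P {-K..K} = id_blinfun) \<and>
    (\<forall>x. cinner x (blinfun_apply A x) = of_real (\<integral>t. t \<partial>vector_measure P x))"

definition spectral_resolution ::
    "('h::complex_hilbert \<Rightarrow>\<^sub>L 'h) \<Rightarrow> real set \<Rightarrow> ('h \<Rightarrow>\<^sub>L 'h)"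
  where "spectral_resolution A = (SOME P. is_spectral_resolution A P)"

text \<open>\<open>f(A)\<close> for self-adjoint \<open>A\<close> and a real Borel function \<open>f\<close> bounded on the spectrum of \<open>A\<close>.\<close>

definition fun_calc :: "(real \<Rightarrow> real) \<Rightarrow> ('h::complex_hilbert \<Rightarrow>\<^sub>L 'h) \<Rightarrow> ('h \<Rightarrow>\<^sub>L 'h)"
  where "fun_calc f A =
    (THE T. T \<in> bounded_ops \<and>
       (\<forall>x. cinner x (blinfun_apply T x) =
            of_real (\<integral>t. f t \<partial>vector_measure (spectral_resolution A) x)))"

definition spectral_distribution ::
    "(('h::complex_hilbert \<Rightarrow>\<^sub>L 'h) \<Rightarrow> complex) \<Rightarrow> ('h \<Rightarrow>\<^sub>L 'h) \<Rightarrow> real measure"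
  where "spectral_distribution E A =
    measure_of UNIV (sets borel) (\<lambda>S. ennreal (Re (E (fun_calc (indicator S) A))))"


subsection \<open>The determinant and the S-transform\<close>

definition log_plus :: "real \<Rightarrow> real \<Rightarrow> real"
  where "log_plus l t = (if t > l then ln t else 0)"

text \<open>The limit is taken in the extended reals: it may be \<open>-\<infinity>\<close>, and then the determinant is 0.\<close>

definition fk_log_limit ::
    "(('h::complex_hilbert \<Rightarrow>\<^sub>L 'h) \<Rightarrow> complex) \<Rightarrow> ('h \<Rightarrow>\<^sub>L 'h) \<Rightarrow> ereal"
  where "fk_log_limit E X =
    Lim (at_right 0) (\<lambda>l. ereal (Re (E (fun_calc (log_plus l) (adj X o\<^sub>L X)))))"

definition fk_det :: "(('h::complex_hilbert \<Rightarrow>\<^sub>L 'h) \<Rightarrow> complex) \<Rightarrow> ('h \<Rightarrow>\<^sub>L 'h) \<Rightarrow> real"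
  where "fk_det E X =
    (if fk_log_limit E X = -\<infinity> then 0 else exp (1/2 * real_of_ereal (fk_log_limit E X)))"

text \<open>
  Near 0 the function \<open>psi_fun E A\<close> is the moment series \<open>\<Sum>k\<ge>1. E(A^k) z^k\<close>. Its inverse, and with
  it the S-transform, is taken on the image of the negative half-line, which for invertible
  \<open>A \<ge> 0\<close> is the interval from \<open>-1\<close> to \<open>0\<close>.
\<close>

definition psi_fun ::
    "(('h::complex_hilbert \<Rightarrow>\<^sub>L 'h) \<Rightarrow> complex) \<Rightarrow> ('h \<Rightarrow>\<^sub>L 'h) \<Rightarrow> real \<Rightarrow> real"
  where "psi_fun E A z = (\<integral>x. z * x / (1 - z * x) \<partial>spectral_distribution E A)"

definition psi_inv ::
    "(('h::complex_hilbert \<Rightarrow>\<^sub>L 'h) \<Rightarrow> complex) \<Rightarrow> ('h \<Rightarrow>\<^sub>L 'h) \<Rightarrow> real \<Rightarrow> real"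
  where "psi_inv E A = the_inv_into {..<0} (psi_fun E A)"

definition S_transform ::
    "(('h::complex_hilbert \<Rightarrow>\<^sub>L 'h) \<Rightarrow> complex) \<Rightarrow> ('h \<Rightarrow>\<^sub>L 'h) \<Rightarrow> real \<Rightarrow> real"
  where "S_transform E A z = (1 + inverse z) * psi_inv E A z"

end

(* The spectral distribution \<nu> of A = X*X lives on a compact subset of (0, \<infinity>), and det X = exp (1/2 \<integral> ln x d\<nu>).
   Write \<psi>(-s) = - g(s), so that S(-t) = \<sigma>(t) (1 - t) / t with g(\<sigma>(t)) = t. With L(s) = \<integral> ln (1 + s x) d\<nu>,
   the function t ln \<sigma>(t) - L(\<sigma>(t)) - (1 - t) ln (1 - t) - t ln t is a primitive of ln S(-t);
   it tends to 0 at t = 0 and to - \<integral> ln x d\<nu> at t = 1.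

   The spectral theorem behind \<nu> comes from the Hausdorff moment problem: for 0 \<le> A \<le> 1 the operators
   A^k (1 - A)^m are positive, so <x, A^n x> are the moments of a measure. Bilinearity, multiplicativity
   and commutation of the resulting functional calculus hold for polynomials and pass to bounded Borel
   functions by a monotone class argument. *)

theory Submission
  imports Defs
begin

text \<open>The obstacle is that \<open>spectral_resolution A\<close> is an arbitrary choice, and
  that a resolution is only asked to reproduce the first moment \<open><x, A x>\<close>.
  Constructing one good resolution therefore says little about the chosen one. Hence the functional
  calculus is developed for any family of measures with moments \<open><x, A^n x>\<close> and used
  twice: for the measures supplied by the moment problem, which yields existence, and for the vector
  measures of the chosen resolution, whose higher moments are recovered from the orthogonality of
  its projections. The calculus lives on the underlying real Hilbert space: complex linearity is
  commutation with multiplication by \<i>, membership in \<open>M\<close> is commutation with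
  \<open>commutant M\<close>, and one commutation lemma covers both. Normality of \<open>E\<close>
  turns increasing limits of projections into countable additivity of \<nu>. In the scalar part the
  primitive comes from substituting t = g(s) and integrating by parts: \<integral> ln \<sigma>(t) dt
  = t ln \<sigma>(t) - \<integral> g(s)/s ds, where g(s)/s is the derivative of L.\<close>

section \<open>Borel functions bounded on an interval, and a monotone class argument\<close>

text \<open>Measurability is global, but boundedness is asked only on the interval that carries all
  measures below, so that monomials and \<open>log_plus l\<close> with \<open>0 < l\<close>
  qualify.\<close>

definition bdd_borel :: "real \<Rightarrow> (real \<Rightarrow> real) \<Rightarrow> bool"
  where "bdd_borel K f \<longleftrightarrow> f \<in> borel_measurable borel \<and> (\<exists>C. \<forall>t\<in>{-K..K}. \<bar>f t\<bar> \<le> C)"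

lemma bdd_borelI: "f \<in> borel_measurable borel \<Longrightarrow> (\<And>t. t \<in> {-K..K} \<Longrightarrow> \<bar>f t\<bar> \<le> C) \<Longrightarrow> bdd_borel K f"
  unfolding bdd_borel_def by blast

lemma bdd_borel_measurable: "bdd_borel K f \<Longrightarrow> f \<in> borel_measurable borel"
  by (auto simp: bdd_borel_def)

lemma bdd_borelE:
  assumes "bdd_borel K f"
  obtains C where "0 \<le> C" "\<And>t. t \<in> {-K..K} \<Longrightarrow> \<bar>f t\<bar> \<le> C"
  using assms unfolding bdd_borel_def
  by (metis abs_ge_zero abs_le_iff abs_of_nonneg dual_order.trans linorder_linear)

lemma bdd_borel_add: "bdd_borel K f \<Longrightarrow> bdd_borel K g \<Longrightarrow> bdd_borel K (\<lambda>t. f t + g t)"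
proof -
  assume f: "bdd_borel K f" and g: "bdd_borel K g"
  obtain C D where "\<And>t. t \<in> {-K..K} \<Longrightarrow> \<bar>f t\<bar> \<le> C" "\<And>t. t \<in> {-K..K} \<Longrightarrow> \<bar>g t\<bar> \<le> D"
    using bdd_borelE[OF f] bdd_borelE[OF g] by metis
  then have "\<And>t. t \<in> {-K..K} \<Longrightarrow> \<bar>f t + g t\<bar> \<le> C + D"
    by (smt (verit))
  then show ?thesis
    using f g by (intro bdd_borelI[where C="C + D"]) (auto intro!: borel_measurable_add borel_measurable_times dest: bdd_borel_measurable)
qed

lemma bdd_borel_mult: "bdd_borel K f \<Longrightarrow> bdd_borel K g \<Longrightarrow> bdd_borel K (\<lambda>t. f t * g t)"
proof -
  assume f: "bdd_borel K f" and g: "bdd_borel K g"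
  obtain C where C: "0 \<le> C" "\<And>t. t \<in> {-K..K} \<Longrightarrow> \<bar>f t\<bar> \<le> C"
    using bdd_borelE[OF f] by metis
  obtain D where D: "0 \<le> D" "\<And>t. t \<in> {-K..K} \<Longrightarrow> \<bar>g t\<bar> \<le> D"
    using bdd_borelE[OF g] by metis
  have "\<bar>f t * g t\<bar> \<le> C * D" if "t \<in> {-K..K}" for t
    using C D that by (simp add: abs_mult mult_mono)
  then show ?thesis
    using f g by (intro bdd_borelI[where C="C * D"]) (auto intro!: borel_measurable_add borel_measurable_times dest: bdd_borel_measurable)
qed

lemma bdd_borel_continuous: "continuous_on UNIV f \<Longrightarrow> bdd_borel K f"
proof -
  assume f: "continuous_on UNIV f"
  have "compact (f ` {-K..K})"
    using f by (intro compact_continuous_image) (auto intro: continuous_on_subset)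
  then obtain C where "\<forall>t\<in>{-K..K}. \<bar>f t\<bar> \<le> C"
    by (metis bounded_iff compact_imp_bounded image_eqI real_norm_def)
  then show ?thesis
    using f by (intro bdd_borelI[where C=C]) (auto intro: borel_measurable_continuous_onI)
qed

lemma bdd_borel_const: "bdd_borel K (\<lambda>_. c)"
  by (intro bdd_borel_continuous continuous_intros)

lemma bdd_borel_power: "bdd_borel K (\<lambda>t. t ^ n)"
  by (intro bdd_borel_continuous continuous_intros)

lemma bdd_borel_id: "bdd_borel K (\<lambda>t. t)"
  by (intro bdd_borel_continuous continuous_intros)

lemma bdd_borel_indicator: "S \<in> sets borel \<Longrightarrow> bdd_borel K (indicator S)"
  by (intro bdd_borelI[where C=1]) (auto simp: indicator_def)

lemma bdd_borel_cmult: "bdd_borel K f \<Longrightarrow> bdd_borel K (\<lambda>t. c * f t)"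
  by (intro bdd_borel_mult bdd_borel_const)

lemma bdd_borel_sum: "(\<And>i. i \<in> I \<Longrightarrow> bdd_borel K (f i)) \<Longrightarrow> bdd_borel K (\<lambda>t. \<Sum>i\<in>I. f i t)"
  by (induction I rule: infinite_finite_induct) (auto intro: bdd_borel_const bdd_borel_add)

text \<open>A functional monotone class theorem: monomials span the polynomials, which approximate
  continuous functions uniformly on the interval; ramps lead to half-lines, a Dynkin system to Borel
  sets, simple functions to all of \<open>bdd_borel K\<close>. The rule \<open>lim\<close> looks at
  the interval only, which is what dominated convergence offers for measures carried by it.\<close>

lemma bdd_borel_induct_monomial [consumes 1, case_names monomial add scale lim]:
  fixes H :: "(real \<Rightarrow> real) \<Rightarrow> bool"
  assumes f: "bdd_borel K f"
    and monomial: "\<And>n. H (\<lambda>t. t ^ n)"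
    and add: "\<And>f g. bdd_borel K f \<Longrightarrow> bdd_borel K g \<Longrightarrow> H f \<Longrightarrow> H g \<Longrightarrow> H (\<lambda>t. f t + g t)"
    and scale: "\<And>f c. bdd_borel K f \<Longrightarrow> H f \<Longrightarrow> H (\<lambda>t. c * f t)"
    and lim: "\<And>F f C. (\<And>n. bdd_borel K (F n)) \<Longrightarrow> (\<And>n. H (F n)) \<Longrightarrow>
      (\<And>n t. t \<in> {-K..K} \<Longrightarrow> \<bar>F n t\<bar> \<le> C) \<Longrightarrow> bdd_borel K f \<Longrightarrow>
      (\<And>t. t \<in> {-K..K} \<Longrightarrow> (\<lambda>n. F n t) \<longlonglongrightarrow> f t) \<Longrightarrow> H f"
  shows "H f"
proof -
  have one: "H (\<lambda>t. 1)"
    using monomial[of 0] by simp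
  have zero: "H (\<lambda>t. 0)"
    using scale[OF bdd_borel_const one, of 0] by simp
  have sum: "H (\<lambda>t. \<Sum>i\<in>I. g i t)" if "\<And>i. i \<in> I \<Longrightarrow> bdd_borel K (g i) \<and> H (g i)"
    for I :: "nat set" and g
    using that
    by (induction I rule: infinite_finite_induct) (auto intro!: zero add bdd_borel_sum)
  have poly: "H p" if p: "real_polynomial_function p" for p
  proof -
    obtain a n where "p = (\<lambda>x. \<Sum>i\<le>n. a i * x ^ i)"
      using real_polynomial_function_imp_sum[OF p] by blast
    then show ?thesis
      by (auto intro!: sum bdd_borel_cmult bdd_borel_power scale monomial)
  qed
  have cont: "H g" if g: "continuous_on UNIV g" for g
  proof -
    have "\<exists>p. real_polynomial_function p \<and> (\<forall>t\<in>{-K..K}. \<bar>g t - p t\<bar> < 1 / Suc n)" for n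
      using Stone_Weierstrass_real_polynomial_function[of "{-K..K}" g "1 / Suc n"]
        continuous_on_subset[OF g] by (metis compact_Icc of_nat_0_less_iff subset_UNIV zero_less_Suc
          zero_less_divide_1_iff)
    then obtain p where p: "\<And>n. real_polynomial_function (p n)"
      "\<And>n t. t \<in> {-K..K} \<Longrightarrow> \<bar>g t - p n t\<bar> < 1 / Suc n"
      by metis
    obtain C where C: "\<And>t. t \<in> {-K..K} \<Longrightarrow> \<bar>g t\<bar> \<le> C"
      using bdd_borelE[OF bdd_borel_continuous[OF g]] by metis
    show ?thesis
    proof (rule lim[where F=p and C="C + 1"])
      show "bdd_borel K (p n)" for n
        using p(1)[of n] by (intro bdd_borel_continuous)
          (meson continuous_on_polymonial_function real_polynomial_function_eq)
      show "\<bar>p n t\<bar> \<le> C + 1" if "t \<in> {-K..K}" for n t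
      proof -
        have "1 / Suc n \<le> (1::real)" by simp
        then show ?thesis using p(2)[OF that, of n] C[OF that] by linarith
      qed
      show "(\<lambda>n. p n t) \<longlonglongrightarrow> g t" if "t \<in> {-K..K}" for t
      proof (rule LIM_zero_cancel, rule tendsto_rabs_zero_cancel,
          rule tendsto_sandwich[where f="\<lambda>_. 0"])
        show "(\<lambda>n. 1 / real (Suc n)) \<longlonglongrightarrow> 0"
          by (rule LIMSEQ_Suc[OF lim_1_over_n])
        show "\<forall>\<^sub>F n in sequentially. \<bar>p n t - g t\<bar> \<le> 1 / real (Suc n)"
          using p(2)[OF that] by (intro always_eventually allI) (smt (verit))
      qed auto
    qed (auto intro: poly p bdd_borel_continuous g)
  qed
  \<comment> \<open>The ramps equal 1 on \<open>{..a}\<close> and decrease with slope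
    \<open>- n\<close> beyond it, so they vanish from \<open>a + 1 / n\<close> on.\<close>
  have atMost: "H (indicator {..a})" for a
  proof (rule lim[where F="\<lambda>n t. max 0 (min 1 (1 - real n * (t - a)))" and C=1])
    show "bdd_borel K (\<lambda>t. max 0 (min 1 (1 - real n * (t - a))))" for n
      by (intro bdd_borel_continuous continuous_intros)
    show "H (\<lambda>t. max 0 (min 1 (1 - real n * (t - a))))" for n
      by (intro cont continuous_intros)
    show "(\<lambda>n. max 0 (min 1 (1 - real n * (t - a)))) \<longlonglongrightarrow> indicator {..a} t" for t
    proof (cases "t \<le> a")
      case True
      then have "max 0 (min 1 (1 - real n * (t - a))) = 1" for n
        by (simp add: mult_nonneg_nonpos)
      then show ?thesis using True by simp
    next
      case False
      then obtain N where N: "1 < real N * (t - a)"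
        using reals_Archimedean3[of "t - a"] by (auto simp: mult.commute)
      have "max 0 (min 1 (1 - real n * (t - a))) = 0" if "n \<ge> N" for n
      proof -
        have "real N * (t - a) \<le> real n * (t - a)"
          using that False by (intro mult_right_mono) auto
        then show ?thesis using N by simp
      qed
      then show ?thesis using False
        by (intro tendsto_eventually) (auto simp: eventually_sequentially)
    qed
  qed (auto intro: bdd_borel_indicator)
  have ind: "H (indicator S)" if S: "S \<in> sets borel" for S
  proof -
    have sets_eq: "sets borel = sigma_sets UNIV (range (\<lambda>a::real. {..a}))"
      by (subst borel_eq_atMost) (simp add: sets_measure_of)
    have "Int_stable (range (\<lambda>a::real. {..a}))" "range (\<lambda>a::real. {..a}) \<subseteq> Pow UNIV"
      "S \<in> sigma_sets UNIV (range (\<lambda>a::real. {..a}))"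
      using S by (auto simp: Int_stable_def sets_eq)
    then show ?thesis
    proof (induction rule: sigma_sets_induct_disjoint)
      case (basic A) then show ?case by (auto intro: atMost)
    next
      case empty
      then show ?case using zero by (simp add: indicator_def[abs_def])
    next
      case (compl A)
      then have A: "A \<in> sets borel" by (simp add: sets_eq)
      have "H (\<lambda>t. 1 + (-1) * indicator A t)"
        by (intro add bdd_borel_const bdd_borel_cmult scale one compl bdd_borel_indicator A)
      moreover have "(\<lambda>t. 1 + (-1) * indicator A t) = (indicator (UNIV - A) :: real \<Rightarrow> real)"
        by (auto simp: indicator_def)
      ultimately show ?case by simp
    next
      case (union A)
      then have A: "A i \<in> sets borel" for i by (auto simp: sets_eq)
      have eq: "(\<Sum>i<n. indicator (A i) t) = (indicator (\<Union>i<n. A i) t :: real)" for n t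
        using union(1) by (subst indicator_UN_disjoint)
          (auto simp: disjoint_family_on_def)
      show ?case
      proof (rule lim[where F="\<lambda>n t. \<Sum>i<n. indicator (A i) t" and C=1])
        show "\<bar>\<Sum>i<n. indicator (A i) t\<bar> \<le> (1::real)" for n t
          unfolding eq by (simp add: indicator_def)
        show "(\<lambda>n. \<Sum>i<n. indicator (A i) t) \<longlonglongrightarrow> (indicator (\<Union>i. A i) t :: real)" for t
          unfolding eq by (rule LIMSEQ_indicator_UN)
      qed (auto intro!: sum bdd_borel_sum bdd_borel_indicator union A)
    qed
  qed
  \<comment> \<open>The existential bound is chained into the induction, so that it becomes part of
    the induction predicate: nonnegativity and monotonicity pass it from a compound function down to
    its constituents.\<close>
  have nonneg: "H u" if "u \<in> borel_measurable borel" "\<And>x. 0 \<le> u x" "\<exists>C. \<forall>x. u x \<le> C" for u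
    using that
  proof (induction rule: borel_measurable_induct_real)
    case (set A) then show ?case by (simp add: ind)
  next
    case (mult u c)
    show ?case
    proof (cases "c = 0")
      case True then show ?thesis by (simp add: zero)
    next
      case False
      from mult obtain C where "\<And>x. c * u x \<le> C" by auto
      with False mult have le: "u x \<le> C / c" for x
        by (simp add: field_simps)
      then show ?thesis using mult False
        by (intro scale bdd_borelI[where C="C / c"]) auto
    qed
  next
    case (add u v)
    then obtain C where C: "\<And>x. v x + u x \<le> C" by auto
    have "u x \<le> C" "v x \<le> C" for x
      using C[of x] add.hyps(2)[of x] add.hyps(4)[of x] by linarith+
    then show ?case using add
      by (intro assms(3) bdd_borelI[where C=C]) auto
  next
    case (seq U)
    then obtain C where C: "\<And>x. u x \<le> C" by auto
    have "U i x \<le> u x" for i x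
      using seq by (intro incseq_le) (auto simp: incseq_def le_fun_def)
    then have le: "U i x \<le> C" for i x using C order_trans by blast
    show ?case
    proof (rule lim[where F=U and C=C])
      show "bdd_borel K (U n)" for n
        using seq le by (intro bdd_borelI[where C=C]) auto
      show "bdd_borel K u"
        using that(1,2) C seq by (intro bdd_borelI[where C=C]) auto
      show "H (U n)" for n
        using seq.IH[of n] le by blast
    qed (use seq le in auto)
  qed
  obtain C where C: "0 \<le> C" "\<And>t. t \<in> {-K..K} \<Longrightarrow> \<bar>f t\<bar> \<le> C"
    using bdd_borelE[OF f] by metis
  have [measurable]: "f \<in> borel_measurable borel"
    using f by (rule bdd_borel_measurable)
  \<comment> \<open>Cutting off outside the interval makes the function globally bounded. The
    constant sequence \<open>g\<close> converges to \<open>f\<close> on the interval, so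
    \<open>lim\<close> removes the cut at the end.\<close>
  define g where "g t = f t * indicator {-K..K} t" for t
  have [measurable]: "g \<in> borel_measurable borel"
    unfolding g_def by measurable
  have g: "\<bar>g t\<bar> \<le> C" for t
    using C by (auto simp: g_def indicator_def)
  have "H (\<lambda>t. max 0 (g t))" "H (\<lambda>t. max 0 (- g t))"
    using g C by (auto intro!: nonneg exI[of _ C]) (smt (verit))+
  moreover have b: "bdd_borel K (\<lambda>t. max 0 (g t))" "bdd_borel K (\<lambda>t. max 0 (- g t))"
    using g C by (auto intro!: bdd_borelI[where C=C]) (smt (verit))+
  ultimately have "H (\<lambda>t. max 0 (g t) + (-1) * max 0 (- g t))"
    by (intro assms(3) scale bdd_borel_cmult)
  moreover have "(\<lambda>t. max 0 (g t) + (-1) * max 0 (- g t)) = g"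
    by (auto simp: max_def)
  ultimately have "H g" by simp
  moreover have "bdd_borel K g"
    using g by (intro bdd_borelI[where C=C]) auto
  ultimately show ?thesis
    using C f by (intro lim[where F="\<lambda>_. g" and C=C and f=f]) (auto simp: g_def)
qed

section \<open>Riesz representation and symmetric operators\<close>

lemma vector_eq_inner_left:
  fixes z w :: "'a::real_inner"
  assumes "\<And>x. x \<bullet> z = x \<bullet> w"
  shows "z = w"
proof -
  have "(z - w) \<bullet> (z - w) = 0"
    using assms[of "z - w"] by (simp add: inner_diff_right)
  then show ?thesis by simp
qed

text \<open>The representing vector minimises \<open>\<parallel>x\<parallel>\<^sup>2 / 2 - f x\<close>; by the parallelogram law every minimising
  sequence is Cauchy.\<close>

theorem riesz_representation:
  fixes f :: "'a::{real_inner, banach} \<Rightarrow> real"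
  assumes f: "bounded_linear f"
  shows "\<exists>z. \<forall>x. f x = x \<bullet> z"
proof -
  interpret f: bounded_linear f by (rule f)
  define J where "J x = x \<bullet> x / 2 - f x" for x
  obtain B where B: "\<And>x. \<bar>f x\<bar> \<le> B * norm x"
    using f.bounded by (auto simp: mult.commute)
  have J_below: "- (B\<^sup>2 / 2) \<le> J x" for x
  proof -
    have "0 \<le> (norm x - B)\<^sup>2" by simp
    then show ?thesis
      using B[of x] by (simp add: J_def power2_eq_square algebra_simps flip: power2_norm_eq_inner)
  qed
  then have bdd: "bdd_below (range J)" by (intro bdd_belowI2)
  define m where "m = (INF x. J x)"
  have m_le: "m \<le> J x" for x
    unfolding m_def by (rule cINF_lower[OF bdd]) simp
  have "\<exists>x. J x < m + 1 / Suc n" for n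
  proof -
    have "m < m + 1 / Suc n" by simp
    then show ?thesis
      using cINF_less_iff[OF _ bdd, of "m + 1 / Suc n"] unfolding m_def by auto
  qed
  then obtain u where u: "\<And>n. J (u n) < m + 1 / Suc n" by metis
  have par: "(norm (x - y))\<^sup>2 = 4 * (J x + J y - 2 * J ((1/2) *\<^sub>R (x + y)))" for x y
    by (simp add: J_def power2_norm_eq_inner f.scaleR f.add inner_simps inner_commute field_simps)
  have dist: "(norm (u i - u j))\<^sup>2 \<le> 4 * (1 / Suc i + 1 / Suc j)" for i j
    unfolding par using u[of i] u[of j] m_le[of "(1/2) *\<^sub>R (u i + u j)"] by simp
  have "Cauchy u"
  proof (rule metric_CauchyI)
    fix e :: real assume e: "0 < e"
    obtain N where N: "8 / e\<^sup>2 < real N" using reals_Archimedean2 by blast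
    have "dist (u i) (u j) < e" if "i \<ge> N" "j \<ge> N" for i j
    proof -
      have "8 < e\<^sup>2 * real (Suc N)"
        using N e by (simp add: field_simps) (smt (verit) zero_le_power2)
      then have "8 * (1 / real (Suc N)) < e\<^sup>2"
        by (simp add: field_simps)
      moreover have "4 * (1 / real (Suc i) + 1 / real (Suc j)) \<le> 4 * (1 / real (Suc N) + 1 / real (Suc N))"
        using that by (intro mult_left_mono add_mono divide_left_mono) auto
      moreover have "4 * (1 / real (Suc N) + 1 / real (Suc N)) = 8 * (1 / real (Suc N))"
        by (simp only: mult_2[symmetric] mult.assoc[symmetric])
      ultimately have "4 * (1 / real (Suc i) + 1 / real (Suc j)) < e\<^sup>2"
        by (metis le_less_trans)
      then have "(norm (u i - u j))\<^sup>2 < e\<^sup>2"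
        by (rule le_less_trans[OF dist])
      then show ?thesis using e by (simp add: dist_norm power2_less_imp_less)
    qed
    then show "\<exists>M. \<forall>m\<ge>M. \<forall>n\<ge>M. dist (u m) (u n) < e" by blast
  qed
  then obtain z where z: "u \<longlonglongrightarrow> z"
    using Cauchy_convergent convergent_def by blast
  have "(\<lambda>n. J (u n)) \<longlonglongrightarrow> J z"
    unfolding J_def by (intro tendsto_intros z f.tendsto) simp
  moreover have "(\<lambda>n. J (u n)) \<longlonglongrightarrow> m"
  proof (rule tendsto_sandwich)
    show "\<forall>\<^sub>F n in sequentially. m \<le> J (u n)" by (simp add: m_le)
    show "\<forall>\<^sub>F n in sequentially. J (u n) \<le> m + 1 / Suc n"
      using u by (intro always_eventually allI less_imp_le)
    have "(\<lambda>n. m + 1 / real (Suc n)) \<longlonglongrightarrow> m + 0"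
      by (intro tendsto_intros LIMSEQ_Suc[OF lim_1_over_n])
    then show "(\<lambda>n. m + 1 / real (Suc n)) \<longlonglongrightarrow> m" by simp
  qed simp
  ultimately have Jz: "J z = m" by (rule LIMSEQ_unique)
  have "f h = h \<bullet> z" for h
  proof (cases "h = 0")
    case False
    define c where "c = h \<bullet> z - f h"
    \<comment> \<open>Along \<open>h\<close> the functional \<open>J\<close> changes by the
      quadratic polynomial \<open>t * c + t^2 * (h \<bullet> h) / 2\<close>; this \<open>t\<close>
      is its minimiser, and the minimum is negative unless \<open>c = 0\<close>.\<close>
    define t where "t = - c / (h \<bullet> h)"
    have hh: "h \<bullet> h > 0" using False by simp
    have "J (z + t *\<^sub>R h) - J z = t * c + t\<^sup>2 * (h \<bullet> h) / 2"
      by (simp add: J_def c_def f.add f.scaleR inner_simps inner_commute power2_eq_square algebra_simps)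
    also have "\<dots> = - (c\<^sup>2 / (2 * (h \<bullet> h)))"
      using hh by (simp add: t_def power2_eq_square field_simps)
    finally have "c\<^sup>2 / (2 * (h \<bullet> h)) \<le> 0"
      using m_le[of "z + t *\<^sub>R h"] Jz by simp
    then have "c = 0" using hh by (simp add: divide_le_0_iff)
    then show ?thesis by (simp add: c_def)
  qed (simp add: f.zero)
  then show ?thesis by blast
qed

text \<open>Riesz representation in the first slot; the norm bound for \<open>T\<close> comes from
  inserting \<open>T x\<close> there. It supplies both adjoints and the operators of the functional
  calculus.\<close>

lemma bounded_bilinear_blinfun_ex:
  fixes B :: "'a::{real_inner, banach} \<Rightarrow> 'a \<Rightarrow> real"
  assumes B: "bounded_bilinear B"
  shows "\<exists>T::'a \<Rightarrow>\<^sub>L 'a. \<forall>x y. B x y = x \<bullet> blinfun_apply T y"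
proof -
  interpret B: bounded_bilinear B by (rule B)
  have "\<exists>z. \<forall>x. B x y = x \<bullet> z" for y
    by (rule riesz_representation) (rule B.bounded_linear_left)
  then obtain T where T: "\<And>x y. B x y = x \<bullet> T y" by metis
  obtain C where C: "\<And>x y. norm (B x y) \<le> norm x * norm y * C"
    using B.bounded by blast
  have "bounded_linear T"
  proof (rule bounded_linear_intro[where K=C])
    show "T (x + y) = T x + T y" for x y
      by (rule vector_eq_inner_left) (simp add: inner_add_right B.add_right flip: T)
    show "T (r *\<^sub>R x) = r *\<^sub>R T x" for r x
      by (rule vector_eq_inner_left) (simp add: B.scaleR_right flip: T)
    show "norm (T x) \<le> norm x * C" for x
    proof (cases "T x = 0")
      case True
      have "0 \<le> norm x * norm x * C" using C[of x x] norm_ge_zero order_trans by blast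
      then show ?thesis using True
        by (cases "x = 0") (auto simp: zero_le_mult_iff mult_le_0_iff)
    next
      case False
      have "norm (T x) * norm (T x) \<le> norm (T x) * norm x * C"
        using C[of "T x" x] by (simp add: T flip: power2_norm_eq_inner power2_eq_square)
      then show ?thesis using False by simp
    qed
  qed
  then show ?thesis
    using T by (intro exI[of _ "Blinfun T"]) (simp add: bounded_linear_Blinfun_apply)
qed

text \<open>Symmetry for the real inner product, which for complex-linear operators is the same as
  self-adjointness (\<open>selfadjoint_op_iff\<close>) and keeps complex scalars out of the
  calculus.\<close>

definition sym_op :: "('a::real_inner \<Rightarrow>\<^sub>L 'a) \<Rightarrow> bool"
  where "sym_op T \<longleftrightarrow> (\<forall>x y. blinfun_apply T x \<bullet> y = x \<bullet> blinfun_apply T y)"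

lemma sym_opD: "sym_op T \<Longrightarrow> blinfun_apply T x \<bullet> y = x \<bullet> blinfun_apply T y"
  by (simp add: sym_op_def)

lemma sym_op_diff: "sym_op S \<Longrightarrow> sym_op T \<Longrightarrow> sym_op (S - T)"
  by (simp add: sym_op_def blinfun.diff_left inner_diff_left inner_diff_right)

text \<open>For a symmetric operator the numerical radius controls the norm: polarisation expresses
  \<open>x \<bullet> T y\<close> by quadratic values at \<open>x + y\<close> and
  \<open>x - y\<close>, and the parallelogram law adds up the bounds.\<close>

lemma sym_op_norm_le:
  assumes T: "sym_op T" and bound: "\<And>x. \<bar>x \<bullet> blinfun_apply T x\<bar> \<le> e * (x \<bullet> x)" and "0 \<le> e"
  shows "norm T \<le> e"
proof (rule norm_blinfun_bound)
  fix y
  show "norm (blinfun_apply T y) \<le> e * norm y"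
  proof (cases "blinfun_apply T y = 0 \<or> y = 0")
    case False
    \<comment> \<open>The scaling gives \<open>x\<close> the direction of \<open>T y\<close> and the
      length of \<open>y\<close>, so that \<open>x \<bullet> T y\<close> is the product of the norms
      of \<open>T y\<close> and \<open>y\<close>.\<close>
    define s where "s = norm y / norm (blinfun_apply T y)"
    define x where "x = s *\<^sub>R blinfun_apply T y"
    have nx: "norm x = norm y" using False by (simp add: x_def s_def)
    have "4 * (x \<bullet> blinfun_apply T y)
        = (x + y) \<bullet> blinfun_apply T (x + y) - (x - y) \<bullet> blinfun_apply T (x - y)"
      using sym_opD[OF T, of x y]
      by (simp add: blinfun.add_right blinfun.diff_right inner_simps inner_commute)
    also have "\<dots> \<le> e * ((x + y) \<bullet> (x + y)) + e * ((x - y) \<bullet> (x - y))"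
      using bound[of "x + y"] bound[of "x - y"] by linarith
    also have "\<dots> = e * (2 * (norm x)\<^sup>2 + 2 * (norm y)\<^sup>2)"
      by (simp add: inner_simps power2_norm_eq_inner algebra_simps)
    also have "\<dots> = 4 * (e * norm y * norm y)"
      by (simp add: nx power2_eq_square)
    finally have "x \<bullet> blinfun_apply T y \<le> e * norm y * norm y" by simp
    moreover have "x \<bullet> blinfun_apply T y = norm (blinfun_apply T y) * norm y"
      using False by (simp add: x_def s_def power2_eq_square flip: power2_norm_eq_inner)
    ultimately show ?thesis using False by simp
  qed (use \<open>0 \<le> e\<close> in \<open>auto simp: blinfun.zero_right\<close>)
qed fact

lemma sym_op_eqI:
  assumes "sym_op S" "sym_op T" "\<And>x. x \<bullet> blinfun_apply S x = x \<bullet> blinfun_apply T x"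
  shows "S = T"
proof -
  have "norm (S - T) \<le> 0"
    by (rule sym_op_norm_le) (auto intro: sym_op_diff assms simp: blinfun.diff_left inner_diff_right assms(3))
  then show ?thesis by simp
qed

lemma sym_op_funpow:
  "sym_op A \<Longrightarrow> (blinfun_apply A ^^ n) x \<bullet> y = x \<bullet> (blinfun_apply A ^^ n) y"
  by (induction n arbitrary: x y) (auto simp: sym_opD funpow_swap1)

lemma funpow_blinfun_add:
  fixes A :: "'a::real_normed_vector \<Rightarrow>\<^sub>L 'a"
  shows "(blinfun_apply A ^^ n) (x + y) = (blinfun_apply A ^^ n) x + (blinfun_apply A ^^ n) y"
  by (induction n) (auto simp: blinfun.add_right)

lemma funpow_blinfun_scaleR:
  fixes A :: "'a::real_normed_vector \<Rightarrow>\<^sub>L 'a"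
  shows "(blinfun_apply A ^^ n) (c *\<^sub>R y) = c *\<^sub>R (blinfun_apply A ^^ n) y"
  by (induction n) (auto simp: blinfun.scaleR_right)

lemma funpow_blinfun_diff:
  fixes A :: "'a::real_normed_vector \<Rightarrow>\<^sub>L 'a"
  shows "(blinfun_apply A ^^ n) (x - y) = (blinfun_apply A ^^ n) x - (blinfun_apply A ^^ n) y"
  by (induction n) (auto simp: blinfun.diff_right)

subsection \<open>Polynomials in an operator\<close>

definition opoly :: "('a::real_normed_vector \<Rightarrow>\<^sub>L 'a) \<Rightarrow> real poly \<Rightarrow> 'a \<Rightarrow> 'a"
  where "opoly A p x = (\<Sum>i\<le>degree p. coeff p i *\<^sub>R (blinfun_apply A ^^ i) x)"

lemma opoly_0: "opoly A 0 x = 0"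
  by (simp add: opoly_def)

lemma opoly_pCons: "opoly A (pCons a p) x = a *\<^sub>R x + blinfun_apply A (opoly A p x)"
proof (cases "p = 0")
  case False
  then show ?thesis
    by (simp add: opoly_def sum.atMost_Suc_shift del: sum.atMost_Suc add: blinfun.sum_right blinfun.scaleR_right)
qed (simp add: opoly_def blinfun.zero_right)

lemma opoly_add: "opoly A (p + q) x = opoly A p x + opoly A q x"
  by (induction p q rule: poly_induct2)
    (simp_all add: opoly_pCons opoly_0 blinfun.add_right scaleR_add_left)

lemma opoly_smult: "opoly A (smult c p) x = c *\<^sub>R opoly A p x"
  by (induction p) (simp_all add: opoly_pCons opoly_0 blinfun.scaleR_right scaleR_add_right)

lemma opoly_mult: "opoly A (p * q) x = opoly A p (opoly A q x)"
  by (induction p) (simp_all add: opoly_pCons opoly_0 opoly_add opoly_smult)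

lemma opoly_1: "opoly A 1 x = x"
  by (simp add: one_pCons opoly_pCons opoly_0 blinfun.zero_right)

lemma opoly_monom: "opoly A (monom 1 n) x = (blinfun_apply A ^^ n) x"
  by (induction n) (simp_all add: monom_0 monom_Suc opoly_pCons opoly_0 blinfun.zero_right)

lemma opoly_sym: "sym_op A \<Longrightarrow> opoly A p x \<bullet> y = x \<bullet> opoly A p y"
  by (simp add: opoly_def inner_sum_left inner_sum_right sym_op_funpow)

text \<open>Writing the polynomial as P R P with P = p^(k div 2) q^(m div 2) moves P to both sides
  of the inner product. This leaves R among 1, p, q and p q, so no square root of an operator has to
  be constructed.\<close>

lemma opoly_bernstein_nonneg:
  assumes A: "sym_op A" and A0: "\<And>x. 0 \<le> x \<bullet> blinfun_apply A x"
    and A1: "\<And>x. x \<bullet> blinfun_apply A x \<le> x \<bullet> x"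
  shows "0 \<le> x \<bullet> opoly A ([:0, 1:] ^ k * [:1, -1:] ^ m) x"
proof -
  let ?p = "[:0, 1:] :: real poly" and ?q = "[:1, -1:] :: real poly"
  have p: "opoly A ?p x = blinfun_apply A x" and q: "opoly A ?q x = x - blinfun_apply A x" for x
    by (simp_all add: opoly_pCons opoly_0 blinfun.zero_right blinfun.minus_right)
  have q_nonneg: "0 \<le> y \<bullet> (y - blinfun_apply A y)" for y
    using A1[of y] by (simp add: inner_diff_right)
  have base: "0 \<le> y \<bullet> opoly A (?p ^ r * ?q ^ s) y" if "r < 2" "s < 2" for r s y
  proof -
    consider "r = 0" "s = 0" | "r = 1" "s = 0" | "r = 0" "s = 1" | "r = 1" "s = 1"
      using \<open>r < 2\<close> \<open>s < 2\<close> by linarith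
    then show ?thesis
    proof cases
      case 1 then show ?thesis by (simp add: opoly_1)
    next
      case 2 then show ?thesis using A0[of y] by (simp add: p)
    next
      case 3 then show ?thesis using q_nonneg[of y] by (simp add: q)
    next
      case 4
      \<comment> \<open>Since p + q = 1, the product p q equals p q p + q p q, a sum of a conjugate
        of 1 - A by A and a conjugate of A by 1 - A.\<close>
      have "?p * ?q = ?p * (?q * ?p) + ?q * (?p * ?q)" by simp
      then have "y \<bullet> opoly A (?p * ?q) y = y \<bullet> opoly A (?p * (?q * ?p)) y + y \<bullet> opoly A (?q * (?p * ?q)) y"
        by (metis inner_add_right opoly_add)
      also have "y \<bullet> opoly A (?p * (?q * ?p)) y = blinfun_apply A y \<bullet> opoly A ?q (blinfun_apply A y)"
        using opoly_sym[OF A, of ?p y] by (simp only: opoly_mult p)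
      also have "y \<bullet> opoly A (?q * (?p * ?q)) y
          = (y - blinfun_apply A y) \<bullet> blinfun_apply A (y - blinfun_apply A y)"
        using opoly_sym[OF A, of ?q y] by (simp only: opoly_mult p q)
      finally show ?thesis
        using 4 q_nonneg[of "blinfun_apply A y"] A0[of "y - blinfun_apply A y"] by (simp add: q)
    qed
  qed
  define P where "P = ?p ^ (k div 2) * ?q ^ (m div 2)"
  have "?p ^ k * ?q ^ m = P * (?p ^ (k mod 2) * ?q ^ (m mod 2) * P)"
  proof -
    have half: "n div 2 + n mod 2 + n div 2 = n" for n :: nat by presburger
    have "?p ^ k = ?p ^ (k div 2) * ?p ^ (k mod 2) * ?p ^ (k div 2)"
         "?q ^ m = ?q ^ (m div 2) * ?q ^ (m mod 2) * ?q ^ (m div 2)"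
      using half[of k] half[of m] by (metis power_add)+
    then show ?thesis by (simp add: P_def mult_ac)
  qed
  then have "x \<bullet> opoly A (?p ^ k * ?q ^ m) x
      = opoly A P x \<bullet> opoly A (?p ^ (k mod 2) * ?q ^ (m mod 2)) (opoly A P x)"
    by (simp only: opoly_mult opoly_sym[OF A])
  then show ?thesis by (simp add: base)
qed

subsection \<open>The Hausdorff moment problem\<close>

text \<open>The factorial moments of a binomial distribution, as an identity of polynomials: (n
  choose k)(k choose m) = (n choose m)(n - m choose k - m) reduces it to the binomial theorem for
  exponent n - m.\<close>

lemma bernstein_choose_sum:
  fixes p q :: "real poly"
  assumes pq: "p + q = 1" and "m \<le> n"
  shows "(\<Sum>k\<le>n. smult (real (k choose m) * real (n choose k)) (p ^ k * q ^ (n - k)))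
    = smult (real (n choose m)) (p ^ m)"
proof -
  have "(\<Sum>k\<le>n. smult (real (k choose m) * real (n choose k)) (p ^ k * q ^ (n - k)))
      = (\<Sum>k\<in>{m..n}. smult (real (k choose m) * real (n choose k)) (p ^ k * q ^ (n - k)))"
    by (rule sum.mono_neutral_right) (auto simp: binomial_eq_0)
  also have "\<dots> = (\<Sum>j\<le>n - m. smult (real ((m + j) choose m) * real (n choose (m + j)))
      (p ^ (m + j) * q ^ (n - (m + j))))"
    by (rule sum.reindex_bij_witness[of _ "\<lambda>j. m + j" "\<lambda>k. k - m"]) (use \<open>m \<le> n\<close> in auto)
  also have "\<dots> = (\<Sum>j\<le>n - m. smult (real (n choose m)) (p ^ m) *
      (of_nat ((n - m) choose j) * p ^ j * q ^ (n - m - j)))"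
  proof (rule sum.cong)
    fix j assume "j \<in> {..n - m}"
    then have "(n choose (m + j)) * ((m + j) choose m) = (n choose m) * ((n - m) choose j)"
      using choose_mult[of m "m + j" n] \<open>m \<le> n\<close> by simp
    then have "real ((m + j) choose m) * real (n choose (m + j)) = real (n choose m) * real ((n - m) choose j)"
      by (metis mult.commute of_nat_mult)
    then show "smult (real ((m + j) choose m) * real (n choose (m + j))) (p ^ (m + j) * q ^ (n - (m + j)))
      = smult (real (n choose m)) (p ^ m) * (of_nat ((n - m) choose j) * p ^ j * q ^ (n - m - j))"
      by (simp add: power_add mult_ac of_nat_poly)
  qed simp
  also have "\<dots> = smult (real (n choose m)) (p ^ m) * (p + q) ^ (n - m)"
    by (simp only: binomial_ring sum_distrib_left)
  finally show ?thesis by (simp add: pq)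
qed

text \<open>Both terms are products of \<open>m\<close> factors, (k - i)/(n - i) against k/n, of
  modulus at most 1. Products of such factors differ by at most the sum of the differences of the
  factors.\<close>

lemma choose_ratio_bound:
  assumes "k \<le> n" "2 * m < n"
  shows "\<bar>real (k choose m) / real (n choose m) - (real k / real n) ^ m\<bar> \<le> m * (m / (real n - m))"
proof -
  have gb: "real (a choose m) = (\<Prod>i<m. real a - real i) / fact m" for a
    by (simp add: binomial_gbinomial gbinomial_prod_rev atLeast0LessThan)
  have "(\<Prod>i<m. real n - real i) \<noteq> 0"
    using assms by auto
  then have "real (k choose m) / real (n choose m) = (\<Prod>i<m. (real k - i) / (real n - i))"
    by (simp add: gb prod_dividef)
  moreover have "norm ((\<Prod>i<m. (real k - i) / (real n - i)) - (\<Prod>i<m. real k / real n))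
      \<le> (\<Sum>i<m. norm ((real k - i) / (real n - i) - real k / real n))"
  proof (rule norm_prod_diff)
    fix i assume "i \<in> {..<m}"
    \<comment> \<open>For \<open>k < i\<close> the numerator is negative; \<open>2 * m < n\<close>
      is what keeps its modulus below \<open>n - i\<close> in that case.\<close>
    then have "\<bar>real k - i\<bar> \<le> real n - i" using assms by auto
    moreover have "0 < real n - i" using \<open>i \<in> {..<m}\<close> assms by auto
    ultimately show "norm ((real k - i) / (real n - i)) \<le> 1" by (simp add: abs_divide)
    show "norm (real k / real n) \<le> 1" using assms by simp
  qed
  moreover have "(\<Sum>i<m. norm ((real k - i) / (real n - i) - real k / real n)) \<le> (\<Sum>i<m. m / (real n - m))"
  proof (rule sum_mono)
    fix i assume i: "i \<in> {..<m}"
    then have pos: "0 < real n - i" "0 < real n" "0 < real n - m" using assms by auto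
    have "(real k - i) / (real n - i) - real k / real n = - (i / (real n - i)) * ((real n - k) / n)"
      using pos by (simp add: field_simps)
    then have "norm ((real k - i) / (real n - i) - real k / real n) = (i / (real n - i)) * ((real n - k) / n)"
      using pos assms by (simp add: abs_mult)
    also have "\<dots> \<le> (i / (real n - i)) * 1"
      using pos assms by (intro mult_left_mono) auto
    also have "\<dots> \<le> m / (real n - m)"
      using i pos by (simp, intro frac_le) auto
    finally show "norm ((real k - i) / (real n - i) - real k / real n) \<le> m / (real n - m)" .
  qed
  ultimately show ?thesis by simp
qed

text \<open>The Bernstein weights \<open>w n k\<close> form a probability distribution on the points
  k/n. Its factorial moments are given exactly by \<open>L\<close>, power moments differ from them
  by O(1/n), and by tightness a subsequence converges weakly.\<close>

theorem hausdorff_moment_problem: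
  fixes L :: "real poly \<Rightarrow> real"
  assumes add: "\<And>p q. L (p + q) = L p + L q"
    and smult: "\<And>c p. L (smult c p) = c * L p"
    and nonneg: "\<And>k m. 0 \<le> L ([:0, 1:] ^ k * [:1, -1:] ^ m)"
    and one: "L 1 = 1"
  shows "\<exists>M. real_distribution M \<and> (AE t in M. t \<in> {0..1}) \<and> (\<forall>n. (\<integral>t. t ^ n \<partial>M) = L (monom 1 n))"
proof -
  let ?p = "[:0, 1:] :: real poly" and ?q = "[:1, -1:] :: real poly"
  have zero: "L 0 = 0" using smult[of 0 0] by simp
  have sum: "L (\<Sum>i\<in>I. f i) = (\<Sum>i\<in>I. L (f i))" for I :: "nat set" and f
    by (induction I rule: infinite_finite_induct) (auto simp: zero add)
  define w where "w n k = real (n choose k) * L (?p ^ k * ?q ^ (n - k))" for n k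
  have w_nonneg: "0 \<le> w n k" for n k
    by (simp add: w_def nonneg)
  have w_choose: "(\<Sum>k\<le>n. real (k choose m) * w n k) = real (n choose m) * L (?p ^ m)" if "m \<le> n" for m n
  proof -
    have "?p + ?q = 1" by (simp add: one_pCons)
    then show ?thesis
      using arg_cong[OF bernstein_choose_sum[of ?p ?q m n], of L] that
      by (simp add: sum smult w_def mult_ac)
  qed
  have w_sum: "(\<Sum>k\<le>n. w n k) = 1" for n
    using w_choose[of 0 n] one by simp
  define D where "D n = point_measure {..n} (\<lambda>k. ennreal (w n k))" for n
  have D: "prob_space (D n)" for n
    unfolding D_def by (rule prob_space_point_measure) (auto simp: w_nonneg w_sum)
  define X :: "nat \<Rightarrow> nat \<Rightarrow> real" where "X n k = real k / real n" for n k
  have X_meas: "X n \<in> measurable (D n) borel" for n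
    by (simp add: D_def)
  define \<mu> where "\<mu> n = distr (D n) borel (X n)" for n
  have \<mu>: "real_distribution (\<mu> n)" for n
    unfolding \<mu>_def by (intro prob_space.real_distribution_distr D X_meas)
  have X01: "X n k \<in> {0..1}" if "k \<in> space (D n)" for n k
    using that by (auto simp: X_def D_def space_point_measure divide_le_eq)
  have "tight \<mu>"
    unfolding tight_def
  proof (intro conjI allI impI \<mu>)
    fix e :: real assume e: "0 < e"
    \<comment> \<open>All the mass lies in [0, 1]; the left end is -1 because the half-open interval
      has to contain 0.\<close>
    have "measure (\<mu> n) {-1<..1} = 1" for n
    proof -
      have "X n -` {-1<..1} \<inter> space (D n) = space (D n)"
        using X01[of _ n] by fastforce
      then show ?thesis
        unfolding \<mu>_def using X_meas[of n] prob_space.prob_space[OF D[of n]]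
        by (simp add: measure_distr)
    qed
    then show "\<exists>a b. a < b \<and> (\<forall>n. 1 - e < measure (\<mu> n) {a<..b})"
      using e by (intro exI[of _ "-1"] exI[of _ 1]) auto
  qed
  from tight_imp_convergent_subsubsequence[OF this strict_mono_id]
  obtain r M where r: "strict_mono r" and M: "real_distribution M" and conv: "weak_conv_m (\<mu> \<circ> id \<circ> r) M"
    by blast
  interpret M: real_distribution M by fact
  \<comment> \<open>Clamping to [0, 1] turns the monomials into bounded continuous functions, as
    weak convergence requires. The measure finally produced is the image of \<open>M\<close> under
    \<open>c\<close>, which lies on [0, 1] by construction.\<close>
  define c :: "real \<Rightarrow> real" where "c t = max 0 (min 1 t)" for t
  have c_meas [measurable]: "c \<in> borel_measurable borel"
    unfolding c_def by measurable
  have c_cont: "isCont (\<lambda>t. c t ^ m) t" for m t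
    unfolding c_def by (intro continuous_intros)
  have c01: "0 \<le> c t" "c t \<le> 1" for t by (auto simp: c_def)
  have lim1: "(\<lambda>n. \<integral>t. c t ^ m \<partial>\<mu> (r n)) \<longlonglongrightarrow> (\<integral>t. c t ^ m \<partial>M)" for m
    using weak_conv_imp_integral_bdd_continuous_conv[of "\<mu> \<circ> id \<circ> r" M "\<lambda>t. c t ^ m" 1]
      conv M \<mu> c_cont c01 by (simp add: comp_def power_le_one)
  have int\<mu>: "(\<integral>t. c t ^ m \<partial>\<mu> n) = (\<Sum>k\<le>n. w n k * (real k / real n) ^ m)" for m n
  proof -
    have "(\<integral>t. c t ^ m \<partial>\<mu> n) = (\<integral>k. c (X n k) ^ m \<partial>D n)"
      unfolding \<mu>_def by (rule integral_distr) (use X_meas in auto)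
    also have "\<dots> = (\<Sum>k\<le>n. w n k * c (X n k) ^ m)"
      unfolding D_def by (subst lebesgue_integral_point_measure_finite) (auto simp: w_nonneg)
    also have "\<dots> = (\<Sum>k\<le>n. w n k * (real k / real n) ^ m)"
    proof (rule sum.cong)
      fix k assume "k \<in> {..n}"
      then have "0 \<le> real k / real n" "real k / real n \<le> 1" by (auto simp: divide_le_eq_1)
      then show "w n k * c (X n k) ^ m = w n k * (real k / real n) ^ m"
        by (simp add: c_def X_def)
    qed simp
    finally show ?thesis .
  qed
  \<comment> \<open>The exact identity \<open>w_choose\<close> has weights (k choose m)/(n choose m)
    in place of (k/n)^m; the error is uniform in k and the weights \<open>w n k\<close> sum to
    1.\<close>
  have lim2: "(\<lambda>n. \<Sum>k\<le>n. w n k * (real k / real n) ^ m) \<longlonglongrightarrow> L (?p ^ m)" for m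
  proof (rule LIM_zero_cancel, rule Lim_null_comparison)
    show "\<forall>\<^sub>F n in sequentially. norm ((\<Sum>k\<le>n. w n k * (real k / real n) ^ m) - L (?p ^ m)) \<le> m * (m / (real n - m))"
      using eventually_gt_at_top[of "2 * m"]
    proof eventually_elim
      case (elim n)
      have "real (n choose m) \<noteq> 0" using elim by simp
      then have "L (?p ^ m) = (\<Sum>k\<le>n. w n k * (real (k choose m) / real (n choose m)))"
        using w_choose[of m n] elim by (simp add: sum_divide_distrib[symmetric] mult.commute field_simps)
      then have "norm ((\<Sum>k\<le>n. w n k * (real k / real n) ^ m) - L (?p ^ m))
          = \<bar>\<Sum>k\<le>n. w n k * ((real k / real n) ^ m - real (k choose m) / real (n choose m))\<bar>"
        by (simp add: sum_subtractf algebra_simps)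
      also have "\<dots> \<le> (\<Sum>k\<le>n. w n k * (m * (m / (real n - m))))"
      proof (rule order_trans[OF sum_abs], rule sum_mono)
        fix k assume "k \<in> {..n}"
        then show "\<bar>w n k * ((real k / real n) ^ m - real (k choose m) / real (n choose m))\<bar>
          \<le> w n k * (m * (m / (real n - m)))"
          using choose_ratio_bound[of k n m] elim w_nonneg[of n k]
          unfolding abs_mult by (intro mult_mono) (auto simp: abs_minus_commute)
      qed
      also have "\<dots> = m * (m / (real n - m))"
        by (simp only: sum_distrib_right[symmetric] w_sum mult_1)
      finally show ?case .
    qed
    show "(\<lambda>n. m * (m / (real n - m))) \<longlonglongrightarrow> 0"
      by (intro tendsto_mult_right_zero tendsto_divide_0[OF tendsto_const] filterlim_at_top_imp_at_infinity
          filterlim_tendsto_add_at_top[OF tendsto_const[of "- real m"] filterlim_real_sequentially, simplified])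
  qed
  have "(\<integral>t. c t ^ m \<partial>M) = L (?p ^ m)" for m
    using LIMSEQ_subseq_LIMSEQ[OF lim2 r, of m] lim1[of m]
    unfolding int\<mu> by (auto simp: comp_def intro: LIMSEQ_unique)
  moreover have "monom 1 m = ?p ^ m" for m
    by (simp add: monom_altdef)
  ultimately have moments: "(\<integral>t. t ^ m \<partial>distr M borel c) = L (monom 1 m)" for m
    by (subst integral_distr) auto
  show ?thesis
  proof (intro exI conjI allI)
    show "real_distribution (distr M borel c)" by (rule M.real_distribution_distr) simp
    show "AE t in distr M borel c. t \<in> {0..1}"
      by (subst AE_distr_iff) (auto simp: c01)
  qed (rule moments)
qed

text \<open>Normalising \<open>x\<close> and dividing \<open>A\<close> by \<open>K\<close> reaches
  the hypotheses of the moment problem. Afterwards the measure is stretched by \<open>K\<close> and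
  its mass is restored to \<open>norm x\<close> squared; \<open>x = 0\<close> cannot be normalised
  and takes the null measure.\<close>

theorem ex_moment_measure:
  fixes A :: "'a::real_inner \<Rightarrow>\<^sub>L 'a"
  assumes A: "sym_op A" and A0: "\<And>x. 0 \<le> x \<bullet> blinfun_apply A x"
    and A1: "\<And>x. x \<bullet> blinfun_apply A x \<le> K * (x \<bullet> x)" and K: "0 < K"
  shows "\<exists>M. finite_measure M \<and> sets M = sets borel \<and> (AE t in M. t \<in> {-K..K}) \<and>
    (\<forall>n. (\<integral>t. t ^ n \<partial>M) = x \<bullet> (blinfun_apply A ^^ n) x)"
proof (cases "x = 0")
  case True
  have "(blinfun_apply A ^^ n) 0 = 0" for n
    by (induction n) (auto simp: blinfun.zero_right)
  moreover have "finite_measure (null_measure borel)"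
    by (rule finite_measureI) simp
  moreover have "AE t in null_measure borel. t \<in> {-K..K}"
    by (rule AE_I[where N=UNIV]) auto
  moreover have "(\<integral>t. t ^ n \<partial>null_measure borel) = (0::real)" for n
    by simp
  ultimately show ?thesis
    by (intro exI[of _ "null_measure borel"]) (simp add: True)
next
  case False
  define u where "u = (1 / norm x) *\<^sub>R x"
  have u: "u \<bullet> u = 1"
    using False by (simp add: u_def power2_norm_eq_inner[symmetric])
  define B where "B = (1 / K) *\<^sub>R A"
  have "sym_op B"
    using A by (simp add: B_def sym_op_def blinfun.scaleR_left)
  define L where "L p = u \<bullet> opoly B p u" for p
  have "\<exists>M. real_distribution M \<and> (AE t in M. t \<in> {0..1}) \<and> (\<forall>n. (\<integral>t. t ^ n \<partial>M) = L (monom 1 n))"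
  proof (rule hausdorff_moment_problem)
    show "0 \<le> L ([:0, 1:] ^ k * [:1, -1:] ^ m)" for k m
      unfolding L_def
      using A0 A1 K by (intro opoly_bernstein_nonneg \<open>sym_op B\<close>)
        (auto simp: B_def blinfun.scaleR_left field_simps)
  qed (simp_all add: L_def opoly_add opoly_smult opoly_1 inner_add_right u)
  then obtain N where N: "real_distribution N" and N01: "AE t in N. t \<in> {0..1}"
    and Nm: "\<And>n. (\<integral>t. t ^ n \<partial>N) = u \<bullet> (blinfun_apply B ^^ n) u"
    by (auto simp: L_def opoly_monom)
  interpret N: real_distribution N by fact
  let ?D = "distr N borel (\<lambda>t. K * t)"
  interpret D: prob_space ?D by (rule N.prob_space_distr) simp
  define M where "M = density ?D (\<lambda>_. ennreal ((norm x)\<^sup>2))"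
  have Bn: "(blinfun_apply B ^^ n) v = (1 / K) ^ n *\<^sub>R (blinfun_apply A ^^ n) v" for n v
    by (induction n) (auto simp: B_def blinfun.scaleR_left blinfun.scaleR_right)
  have "(\<integral>t. t ^ n \<partial>M) = x \<bullet> (blinfun_apply A ^^ n) x" for n
  proof -
    have "(\<integral>t. t ^ n \<partial>M) = (norm x)\<^sup>2 * (\<integral>t. (K * t) ^ n \<partial>N)"
      unfolding M_def by (subst integral_density) (auto simp: integral_distr)
    also have "\<dots> = (norm x)\<^sup>2 * K ^ n * (u \<bullet> (blinfun_apply B ^^ n) u)"
      by (simp add: power_mult_distrib Nm)
    also have "\<dots> = x \<bullet> (blinfun_apply A ^^ n) x"
      using K False
      by (simp add: Bn u_def funpow_blinfun_scaleR power_divide power2_eq_square)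
    finally show ?thesis .
  qed
  moreover have "finite_measure M"
    unfolding M_def by (intro finite_measureI) (auto simp: emeasure_density D.emeasure_space_1 ennreal_mult_eq_top_iff)
  moreover have "AE t in M. t \<in> {-K..K}"
  proof -
    have "AE t in N. K * t \<in> {-K..K}"
      using N01
    proof eventually_elim
      case (elim t)
      have "0 \<le> K * t" "K * t \<le> K" using elim K by auto
      then show ?case using K by auto
    qed
    then show ?thesis
      unfolding M_def by (subst AE_density) (auto simp: AE_distr_iff)
  qed
  ultimately show ?thesis
    by (intro exI[of _ M]) (auto simp: M_def)
qed

subsection \<open>Functional calculus from moment measures\<close>

text \<open>The measures are left abstract because the locale is instantiated twice: with solutions
  of the moment problem, before any spectral resolution is available, and with the vector measures
  of a given resolution.\<close>

locale moment_family =
  fixes A :: "'a::{real_inner, banach} \<Rightarrow>\<^sub>L 'a" and \<mu> :: "'a \<Rightarrow> real measure" and K :: real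
  assumes sym: "sym_op A"
    and finite_mu: "finite_measure (\<mu> x)"
    and sets_mu: "sets (\<mu> x) = sets borel"
    and AE_mu: "AE t in \<mu> x. t \<in> {-K..K}"
    and moment: "(\<integral>t. t ^ n \<partial>\<mu> x) = x \<bullet> (blinfun_apply A ^^ n) x"
begin

lemma measurable_mu: "bdd_borel K f \<Longrightarrow> f \<in> borel_measurable (\<mu> x)"
  using bdd_borel_measurable measurable_cong_sets[OF sets_mu refl] by blast

lemma integrable_mu: "bdd_borel K f \<Longrightarrow> integrable (\<mu> x) f"
proof -
  assume f: "bdd_borel K f"
  interpret finite_measure "\<mu> x" by (rule finite_mu)
  obtain C where "\<And>t. t \<in> {-K..K} \<Longrightarrow> \<bar>f t\<bar> \<le> C" using bdd_borelE[OF f] by metis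
  then show ?thesis
    by (intro integrable_const_bound[where B=C] measurable_mu f) (auto intro!: eventually_mono[OF AE_mu])
qed

lemma mass_mu: "measure (\<mu> x) UNIV = x \<bullet> x"
  using moment[where n=0 and x=x] sets_eq_imp_space_eq[OF sets_mu[of x]] by simp

lemma integral_mu_bound:
  assumes f: "bdd_borel K f" and C: "\<And>t. t \<in> {-K..K} \<Longrightarrow> \<bar>f t\<bar> \<le> C"
  shows "\<bar>\<integral>t. f t \<partial>\<mu> x\<bar> \<le> C * (x \<bullet> x)"
proof -
  interpret finite_measure "\<mu> x" by (rule finite_mu)
  have "\<bar>\<integral>t. f t \<partial>\<mu> x\<bar> \<le> (\<integral>t. \<bar>f t\<bar> \<partial>\<mu> x)" by (rule integral_abs_bound)
  also have "\<dots> \<le> (\<integral>t. C \<partial>\<mu> x)"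
    by (intro integral_mono_AE integrable_abs integrable_mu f bdd_borel_const eventually_mono[OF AE_mu] C)
  finally show ?thesis
    using mass_mu[of x] sets_eq_imp_space_eq[OF sets_mu[of x]] by (simp add: mult.commute)
qed

lemma integral_mu_lim:
  assumes "\<And>n. bdd_borel K (F n)" "\<And>n t. t \<in> {-K..K} \<Longrightarrow> \<bar>F n t\<bar> \<le> C" "bdd_borel K f"
    "\<And>t. t \<in> {-K..K} \<Longrightarrow> (\<lambda>n. F n t) \<longlonglongrightarrow> f t"
  shows "(\<lambda>n. \<integral>t. F n t \<partial>\<mu> x) \<longlonglongrightarrow> (\<integral>t. f t \<partial>\<mu> x)"
proof (rule integral_dominated_convergence[where w="\<lambda>_. C"])
  interpret finite_measure "\<mu> x" by (rule finite_mu)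
  show "integrable (\<mu> x) (\<lambda>_. C)" by simp
  show "AE t in \<mu> x. norm (F n t) \<le> C" for n
    using assms(2) by (auto intro!: eventually_mono[OF AE_mu])
  show "AE t in \<mu> x. (\<lambda>n. F n t) \<longlonglongrightarrow> f t"
    by (intro eventually_mono[OF AE_mu] assms(4))
qed (use assms in \<open>auto intro: measurable_mu\<close>)

text \<open>Polarisation of the map sending \<open>x\<close> to the integral of \<open>f\<close>
  over \<open>\<mu> x\<close>. Only for polynomials do the moments show directly that this map is a
  quadratic form.\<close>

definition form :: "(real \<Rightarrow> real) \<Rightarrow> 'a \<Rightarrow> 'a \<Rightarrow> real"
  where "form f x y = ((\<integral>t. f t \<partial>\<mu> (x + y)) - (\<integral>t. f t \<partial>\<mu> (x - y))) / 4"

lemma form_add: "bdd_borel K f \<Longrightarrow> bdd_borel K g \<Longrightarrow> form (\<lambda>t. f t + g t) x y = form f x y + form g x y"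
  by (simp add: form_def integrable_mu add_divide_distrib diff_divide_distrib)

lemma form_cmult: "form (\<lambda>t. c * f t) x y = c * form f x y"
  by (simp add: form_def algebra_simps)

lemma form_lim:
  assumes "\<And>n. bdd_borel K (F n)" "\<And>n t. t \<in> {-K..K} \<Longrightarrow> \<bar>F n t\<bar> \<le> C" "bdd_borel K f"
    "\<And>t. t \<in> {-K..K} \<Longrightarrow> (\<lambda>n. F n t) \<longlonglongrightarrow> f t"
  shows "(\<lambda>n. form (F n) x y) \<longlonglongrightarrow> form f x y"
  unfolding form_def by (intro tendsto_intros integral_mu_lim[OF assms]) auto

lemma form_monomial: "form (\<lambda>t. t ^ n) x y = x \<bullet> (blinfun_apply A ^^ n) y"
  using sym_op_funpow[OF sym, of n x y]
  by (simp add: form_def moment funpow_blinfun_add funpow_blinfun_diff inner_simps inner_commute)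

text \<open>The shape with a factor \<open>g\<close> and two terms on the right covers bilinearity, symmetry,
  multiplicativity and commutation with other operators at once.\<close>

lemma form_identity:
  assumes f: "bdd_borel K f" and g: "bdd_borel K g"
    and monomial: "\<And>n. form (\<lambda>t. g t * t ^ n) a b = c * form (\<lambda>t. t ^ n) x y + d * form (\<lambda>t. t ^ n) z w"
  shows "form (\<lambda>t. g t * f t) a b = c * form f x y + d * form f z w"
  using f
proof (induction f rule: bdd_borel_induct_monomial)
  case (add f h)
  have "(\<lambda>t. g t * (f t + h t)) = (\<lambda>t. g t * f t + g t * h t)" by (simp add: algebra_simps)
  then show ?case using add by (simp add: form_add bdd_borel_mult g algebra_simps)
next
  case (scale f k)
  have "(\<lambda>t. g t * (k * f t)) = (\<lambda>t. k * (g t * f t))" by (simp add: algebra_simps)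
  then show ?case using scale by (simp add: form_cmult algebra_simps)
next
  case (lim F f C)
  obtain D where D: "0 \<le> D" "\<And>t. t \<in> {-K..K} \<Longrightarrow> \<bar>g t\<bar> \<le> D"
    using bdd_borelE[OF g] by metis
  have "(\<lambda>n. form (\<lambda>t. g t * F n t) a b) \<longlonglongrightarrow> form (\<lambda>t. g t * f t) a b"
    using lim D by (intro form_lim[where C="D * C"] bdd_borel_mult g)
      (auto simp: abs_mult intro!: mult_mono tendsto_intros)
  moreover have "(\<lambda>n. c * form (F n) x y + d * form (F n) z w) \<longlonglongrightarrow> c * form f x y + d * form f z w"
    using lim by (intro tendsto_intros form_lim[where C=C]) auto
  ultimately show ?case
    using lim.IH by (auto intro: LIMSEQ_unique)
qed (rule monomial)

lemmas form_identity1 = form_identity[where g="\<lambda>_. 1", OF _ bdd_borel_const, simplified]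

lemma form_add_left: "bdd_borel K f \<Longrightarrow> form f (x + x') y = form f x y + form f x' y"
  using form_identity1[of f "x + x'" y 1 x y 1 x' y]
  by (simp add: form_monomial inner_simps)

lemma form_scaleR_left: "bdd_borel K f \<Longrightarrow> form f (c *\<^sub>R x) y = c * form f x y"
  using form_identity1[of f "c *\<^sub>R x" y c x y 0 x y]
  by (simp add: form_monomial)

lemma form_commute: "bdd_borel K f \<Longrightarrow> form f x y = form f y x"
  using form_identity1[of f x y 1 y x 0 x y] sym_op_funpow[OF sym, of _ x y]
  by (simp add: form_monomial inner_commute)

text \<open>Unfolding gives integrals over \<open>\<mu> (x + x)\<close> and
  \<open>\<mu> (x - x)\<close>, whose relation to \<open>\<mu> x\<close> is visible only on moments;
  the monotone class induction carries it to all \<open>f\<close>.\<close>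

lemma form_self: "bdd_borel K f \<Longrightarrow> form f x x = (\<integral>t. f t \<partial>\<mu> x)"
proof (induction f rule: bdd_borel_induct_monomial)
  case (monomial n)
  then show ?case by (simp add: form_monomial moment)
next
  case (add f g)
  then show ?case by (simp add: form_add integrable_mu)
next
  case (scale f c)
  then show ?case by (simp add: form_cmult)
next
  case (lim F f C)
  have "(\<lambda>n. form (F n) x x) \<longlonglongrightarrow> form f x x" "(\<lambda>n. \<integral>t. F n t \<partial>\<mu> x) \<longlonglongrightarrow> (\<integral>t. f t \<partial>\<mu> x)"
    by (rule form_lim[where C=C] integral_mu_lim[where C=C]; use lim in blast)+
  then show ?case using lim.IH by (auto intro: LIMSEQ_unique)
qed

lemma bounded_bilinear_form:
  assumes f: "bdd_borel K f"
  shows "bounded_bilinear (form f)"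
proof -
  have l: "form f (x + x') y = form f x y + form f x' y" "form f (c *\<^sub>R x) y = c * form f x y" for x x' y c
    using f by (simp_all add: form_add_left form_scaleR_left)
  have r: "form f y (x + x') = form f y x + form f y x'" "form f y (c *\<^sub>R x) = c * form f y x" for x x' y c
    using form_commute[OF f, of y] l by simp_all
  have z: "form f 0 y = 0" "form f y 0 = 0" for y
    using l(2)[of 0 0 y] r(2)[of y 0 0] by simp_all
  obtain C where C: "0 \<le> C" "\<And>t. t \<in> {-K..K} \<Longrightarrow> \<bar>f t\<bar> \<le> C" using bdd_borelE[OF f] by metis
  \<comment> \<open>The masses of \<open>\<mu> (x + y)\<close> and \<open>\<mu> (x - y)\<close> add
    up to 4 for unit vectors, by the parallelogram law, which cancels the 4 of the
    polarisation.\<close>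
  have unit: "\<bar>form f x y\<bar> \<le> C" if "norm x = 1" "norm y = 1" for x y
  proof -
    have "\<bar>form f x y\<bar> \<le> (C * ((x + y) \<bullet> (x + y)) + C * ((x - y) \<bullet> (x - y))) / 4"
      using integral_mu_bound[OF f C(2), of "x + y"] integral_mu_bound[OF f C(2), of "x - y"]
      unfolding form_def by (simp add: abs_le_iff)
    also have "\<dots> = C * (2 * (norm x)\<^sup>2 + 2 * (norm y)\<^sup>2) / 4"
      by (simp add: inner_simps power2_norm_eq_inner algebra_simps)
    finally show ?thesis using that by simp
  qed
  have "norm (form f x y) \<le> norm x * norm y * C" for x y
  proof (cases "x = 0 \<or> y = 0")
    case False
    have "\<bar>form f ((1 / norm x) *\<^sub>R x) ((1 / norm y) *\<^sub>R y)\<bar> \<le> C"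
      using False by (intro unit) auto
    then show ?thesis
      using False by (simp add: l r abs_mult field_simps)
  qed (use z C in auto)
  then show ?thesis
    by unfold_locales (auto simp: l r)
qed

definition calc :: "(real \<Rightarrow> real) \<Rightarrow> 'a \<Rightarrow>\<^sub>L 'a"
  where "calc f = (SOME T. \<forall>x y. form f x y = x \<bullet> blinfun_apply T y)"

lemma inner_calc: "bdd_borel K f \<Longrightarrow> x \<bullet> blinfun_apply (calc f) y = form f x y"
  unfolding calc_def by (rule someI2_ex[OF bounded_bilinear_blinfun_ex[OF bounded_bilinear_form]]) auto

lemma calc_quadratic: "bdd_borel K f \<Longrightarrow> x \<bullet> blinfun_apply (calc f) x = (\<integral>t. f t \<partial>\<mu> x)"
  by (simp add: inner_calc form_self)

lemma sym_op_calc: "bdd_borel K f \<Longrightarrow> sym_op (calc f)"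
  unfolding sym_op_def by (metis form_commute inner_calc inner_commute)

text \<open>The monotone class induction runs once in each factor: first \<open>g\<close> varies
  against a monomial, which moves onto the vector as a power of \<open>A\<close>; then
  \<open>f\<close> varies while \<open>g\<close> stays fixed.\<close>

lemma calc_mult:
  assumes f: "bdd_borel K f" and g: "bdd_borel K g"
  shows "calc (\<lambda>t. f t * g t) = calc f o\<^sub>L calc g"
proof -
  have fm: "form (\<lambda>t. t ^ n * g t) x y = form g x ((blinfun_apply A ^^ n) y)" if "bdd_borel K g" for n g x y
  proof -
    have "(blinfun_apply A ^^ n) ((blinfun_apply A ^^ m) y) = (blinfun_apply A ^^ m) ((blinfun_apply A ^^ n) y)" for m
      by (metis add.commute comp_apply funpow_add)
    then show ?thesis
      using form_identity[OF that bdd_borel_power[of K n], of x y 1 x "(blinfun_apply A ^^ n) y" 0 x y]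
      by (simp add: form_monomial power_add[symmetric] funpow_add)
  qed
  have eq: "form (\<lambda>t. g t * f t) x y = form f x (blinfun_apply (calc g) y)" for x y
  proof -
    have "form (\<lambda>t. g t * t ^ n) x y = form (\<lambda>t. t ^ n) x (blinfun_apply (calc g) y)" for n
    proof -
      have "form (\<lambda>t. g t * t ^ n) x y = form (\<lambda>t. t ^ n * g t) y x"
        using form_commute[OF bdd_borel_mult[OF g bdd_borel_power]] by (simp add: mult.commute)
      also have "\<dots> = form g ((blinfun_apply A ^^ n) x) y"
        by (simp add: fm g form_commute[OF g, of y])
      also have "\<dots> = x \<bullet> (blinfun_apply A ^^ n) (blinfun_apply (calc g) y)"
        by (simp add: g sym_op_funpow[OF sym] flip: inner_calc)
      finally show ?thesis by (simp add: form_monomial)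
    qed
    then show ?thesis
      using form_identity[OF f g, of x y 1 x "blinfun_apply (calc g) y" 0 x y] by simp
  qed
  have "x \<bullet> blinfun_apply (calc (\<lambda>t. f t * g t)) y = x \<bullet> blinfun_apply (calc f o\<^sub>L calc g) y" for x y
  proof -
    have "x \<bullet> blinfun_apply (calc (\<lambda>t. f t * g t)) y = form (\<lambda>t. g t * f t) x y"
      by (simp add: inner_calc bdd_borel_mult f g mult.commute)
    also have "\<dots> = x \<bullet> blinfun_apply (calc f o\<^sub>L calc g) y"
      unfolding eq by (simp add: inner_calc f)
    finally show ?thesis .
  qed
  then show ?thesis
    by (intro blinfun_eqI, rule vector_eq_inner_left)
qed

lemma calc_add:
  assumes f: "bdd_borel K f" and g: "bdd_borel K g"
  shows "calc (\<lambda>t. f t + g t) = calc f + calc g"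
  by (intro blinfun_eqI, rule vector_eq_inner_left)
    (simp add: inner_calc f g bdd_borel_add form_add blinfun.add_left inner_add_right)

lemma calc_cmult:
  assumes f: "bdd_borel K f"
  shows "calc (\<lambda>t. c * f t) = c *\<^sub>R calc f"
  by (intro blinfun_eqI, rule vector_eq_inner_left)
    (simp add: inner_calc f bdd_borel_cmult form_cmult blinfun.scaleR_left)

lemma calc_one: "calc (\<lambda>_. 1) = id_blinfun"
  by (intro blinfun_eqI, rule vector_eq_inner_left)
    (use form_monomial[of 0] in \<open>simp add: inner_calc bdd_borel_const\<close>)

lemma calc_id: "calc (\<lambda>t. t) = A"
  by (intro blinfun_eqI, rule vector_eq_inner_left)
    (use form_monomial[of 1] in \<open>simp add: inner_calc bdd_borel_id\<close>)

lemma calc_sum: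
  assumes "\<And>i. i \<in> I \<Longrightarrow> bdd_borel K (f i)"
  shows "calc (\<lambda>t. \<Sum>i\<in>I. f i t) = (\<Sum>i\<in>I. calc (f i))"
proof -
  have zero: "calc (\<lambda>_. 0) = 0"
    using calc_cmult[OF bdd_borel_const, of 0 0] by simp
  show ?thesis
    using assms
    by (induction I rule: infinite_finite_induct) (auto simp: zero calc_add bdd_borel_sum)
qed

text \<open>An adjoint \<open>T'\<close> moves \<open>T\<close> from one slot of the form to the
  other, and on monomials this is the commutation with \<open>A\<close>. Only a real adjoint is
  asked for, so that the lemma applies to multiplication by \<i>, whose adjoint is its negative, as
  well as to the commutant.\<close>

lemma calc_commute:
  assumes f: "bdd_borel K f" and TA: "T o\<^sub>L A = A o\<^sub>L T"
    and adj: "\<And>x y. blinfun_apply T' x \<bullet> y = x \<bullet> blinfun_apply T y"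
  shows "T o\<^sub>L calc f = calc f o\<^sub>L T"
proof -
  have T: "blinfun_apply T (blinfun_apply A y) = blinfun_apply A (blinfun_apply T y)" for y
    using TA by (metis blinfun_apply_blinfun_compose)
  have "(blinfun_apply A ^^ n) (blinfun_apply T y) = blinfun_apply T ((blinfun_apply A ^^ n) y)" for n y
    by (induction n) (simp_all add: T)
  then have "form f x (blinfun_apply T y) = form f (blinfun_apply T' x) y" for x y
    using form_identity1[OF f, of x "blinfun_apply T y" 1 "blinfun_apply T' x" y 0 x y]
    by (simp add: form_monomial adj)
  then have "x \<bullet> blinfun_apply (T o\<^sub>L calc f) y = x \<bullet> blinfun_apply (calc f o\<^sub>L T) y" for x y
    using f adj[of x "blinfun_apply (calc f) y"] by (simp add: inner_calc)
  then show ?thesis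
    by (intro blinfun_eqI, rule vector_eq_inner_left)
qed

abbreviation proj :: "real set \<Rightarrow> 'a \<Rightarrow>\<^sub>L 'a"
  where "proj S \<equiv> calc (indicator S)"

lemma proj_inter:
  assumes "S \<in> sets borel" "T \<in> sets borel"
  shows "proj S o\<^sub>L proj T = proj (S \<inter> T)"
proof -
  have "(\<lambda>t. indicator S t * indicator T t) = (indicator (S \<inter> T) :: real \<Rightarrow> real)"
    by (auto simp: indicator_def)
  then show ?thesis
    using calc_mult[OF bdd_borel_indicator[OF assms(1)] bdd_borel_indicator[OF assms(2)]] by simp
qed

lemma proj_quadratic:
  assumes "S \<in> sets borel"
  shows "x \<bullet> blinfun_apply (proj S) x = measure (\<mu> x) S"
proof -
  interpret finite_measure "\<mu> x" by (rule finite_mu)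
  show ?thesis
    using assms by (simp add: calc_quadratic bdd_borel_indicator sets_mu less_top[symmetric])
qed

lemma proj_norm_square:
  assumes "S \<in> sets borel"
  shows "(norm (blinfun_apply (proj S) x))\<^sup>2 = measure (\<mu> x) S"
proof -
  have "(norm (blinfun_apply (proj S) x))\<^sup>2 = x \<bullet> blinfun_apply (proj S o\<^sub>L proj S) x"
    using sym_opD[OF sym_op_calc[OF bdd_borel_indicator[OF assms]]]
    by (simp add: power2_norm_eq_inner)
  then show ?thesis by (simp add: proj_inter assms proj_quadratic)
qed

text \<open>The remainder after \<open>n\<close> terms is the projection of the tail set
  \<open>R n\<close>. Its squared norm at \<open>x\<close> is the \<mu>-measure of the tail, which
  tends to 0 by continuity from above.\<close>

lemma proj_sums:
  fixes F :: "nat \<Rightarrow> real set"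
  assumes F: "range F \<subseteq> sets borel" and disj: "disjoint_family F"
  shows "(\<lambda>n. blinfun_apply (proj (F n)) x) sums blinfun_apply (proj (\<Union>n. F n)) x"
proof -
  interpret finite_measure "\<mu> x" by (rule finite_mu)
  define R where "R n = (\<Union>n. F n) - (\<Union>i<n. F i)" for n
  have F': "F i \<in> sets borel" for i using F by auto
  have R: "R n \<in> sets borel" for n
    using F' by (auto simp: R_def)
  have ind: "indicator (\<Union>n. F n) t = (\<Sum>i<n. indicator (F i) t) + (indicator (R n) t :: real)" for n t
  proof -
    have "(\<Sum>i<n. indicator (F i) t) = (indicator (\<Union>i<n. F i) t :: real)"
      using disj by (subst indicator_UN_disjoint) (auto simp: disjoint_family_on_def)
    then show ?thesis by (auto simp: R_def indicator_def)
  qed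
  have eqn: "proj (\<Union>n. F n) = (\<Sum>i<n. proj (F i)) + proj (R n)" for n
  proof -
    have "proj (\<Union>n. F n) = calc (\<lambda>t. (\<Sum>i<n. indicator (F i) t) + indicator (R n) t)"
      by (rule arg_cong[where f=calc], rule ext, rule ind)
    also have "\<dots> = calc (\<lambda>t. \<Sum>i<n. indicator (F i) t) + proj (R n)"
      by (intro calc_add bdd_borel_sum bdd_borel_indicator F' R)
    also have "calc (\<lambda>t. \<Sum>i<n. indicator (F i) t) = (\<Sum>i<n. proj (F i))"
      by (intro calc_sum bdd_borel_indicator F')
    finally show ?thesis .
  qed
  have split: "(\<Sum>i<n. blinfun_apply (proj (F i)) x) - blinfun_apply (proj (\<Union>n. F n)) x
      = - blinfun_apply (proj (R n)) x" for n
    using arg_cong[OF eqn[of n], of "\<lambda>T. blinfun_apply T x"]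
    by (simp add: blinfun.add_left blinfun.sum_left)
  have "(\<lambda>n. measure (\<mu> x) (R n)) \<longlonglongrightarrow> measure (\<mu> x) (\<Inter>n. R n)"
    using R by (intro finite_Lim_measure_decseq) (auto simp: R_def decseq_def sets_mu)
  moreover have "(\<Inter>n. R n) = {}"
    by (auto simp: R_def)
  ultimately have "(\<lambda>n. (norm (blinfun_apply (proj (R n)) x))\<^sup>2) \<longlonglongrightarrow> 0"
    by (simp add: proj_norm_square R)
  then have "(\<lambda>n. sqrt ((norm (blinfun_apply (proj (R n)) x))\<^sup>2)) \<longlonglongrightarrow> sqrt 0"
    by (rule tendsto_real_sqrt)
  then have "(\<lambda>n. norm (- blinfun_apply (proj (R n)) x)) \<longlonglongrightarrow> 0"
    by simp
  then show ?thesis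
    unfolding sums_def split[symmetric] by (rule LIM_zero_cancel[OF tendsto_norm_zero_cancel])
qed

end

subsection \<open>Complex Hilbert spaces\<close>

lemma cinner_scaleC_left: "cinner (c *\<^sub>C x) y = cnj c * cinner x y"
  by (metis cinner_commute cinner_scaleC_right complex_cnj_mult)

lemma cinner_add_left: "cinner (x + y) z = cinner x z + cinner y z"
  by (metis cinner_commute cinner_add_right complex_cnj_add)

lemma norm_scaleC: "norm (c *\<^sub>C x) = cmod c * norm (x :: 'a::complex_hilbert)"
proof -
  have "cinner (c *\<^sub>C x) (c *\<^sub>C x) = of_real ((cmod c)\<^sup>2) * cinner x x"
    unfolding complex_norm_square by (simp add: cinner_scaleC_left cinner_scaleC_right)
  then have "(norm (c *\<^sub>C x))\<^sup>2 = (cmod c * norm x)\<^sup>2"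
    by (simp add: power2_norm_eq_inner power_mult_distrib flip: Re_cinner)
  then show ?thesis by simp
qed

lemma scaleC_scaleR: "c *\<^sub>C (r *\<^sub>R x) = r *\<^sub>R (c *\<^sub>C (x :: 'a::complex_hilbert))"
  by (simp add: scaleC_scaleC mult.commute flip: scaleC_of_real)

lemma bounded_linear_scaleC: "bounded_linear (\<lambda>x :: 'a::complex_hilbert. c *\<^sub>C x)"
  by (rule bounded_linear_intro[where K="cmod c"])
    (simp_all add: scaleC_add_right scaleC_scaleR norm_scaleC)

text \<open>As a real operator, multiplication by \<i> turns complex linearity into one more
  commutation relation (\<open>bounded_ops_iff\<close>).\<close>

definition imul :: "'a::complex_hilbert \<Rightarrow>\<^sub>L 'a"
  where "imul = Blinfun (\<lambda>x. \<i> *\<^sub>C x)"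

lemma imul_apply: "blinfun_apply imul x = \<i> *\<^sub>C x"
  by (simp add: imul_def bounded_linear_Blinfun_apply bounded_linear_scaleC)

lemma inner_imul: "(\<i> *\<^sub>C x) \<bullet> y = - (x \<bullet> (\<i> *\<^sub>C (y :: 'a::complex_hilbert)))"
  by (simp add: cinner_scaleC_left cinner_scaleC_right flip: Re_cinner)

lemma scaleC_eq: "c *\<^sub>C x = Re c *\<^sub>R x + Im c *\<^sub>R (\<i> *\<^sub>C (x :: 'a::complex_hilbert))"
proof -
  have "c *\<^sub>C x = (of_real (Re c) + of_real (Im c) * \<i>) *\<^sub>C x"
    by (metis complex_eq mult.commute)
  then show ?thesis
    by (simp only: scaleC_add_left scaleC_of_real flip: scaleC_scaleC)
qed

lemma Im_cinner: "Im (cinner x y) = - (x \<bullet> (\<i> *\<^sub>C (y :: 'a::complex_hilbert)))"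
  by (simp add: cinner_scaleC_right flip: Re_cinner)

lemma bounded_ops_iff: "T \<in> bounded_ops \<longleftrightarrow> imul o\<^sub>L T = T o\<^sub>L imul"
proof
  assume "imul o\<^sub>L T = T o\<^sub>L imul"
  then have "blinfun_apply (T o\<^sub>L imul) x = blinfun_apply (imul o\<^sub>L T) x" for x
    by simp
  then have "blinfun_apply T (\<i> *\<^sub>C x) = \<i> *\<^sub>C blinfun_apply T x" for x
    by (simp add: imul_apply)
  then have "blinfun_apply T (c *\<^sub>C x) = c *\<^sub>C blinfun_apply T x" for c x
    unfolding scaleC_eq[of c] by (simp add: blinfun.add_right blinfun.scaleR_right)
  then show "T \<in> bounded_ops"
    by (simp add: bounded_ops_def)
qed (intro blinfun_eqI, simp add: bounded_ops_def imul_apply)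

lemma bounded_ops_imul: "T \<in> bounded_ops \<Longrightarrow> blinfun_apply T (\<i> *\<^sub>C x) = \<i> *\<^sub>C blinfun_apply T x"
  by (simp add: bounded_ops_def)

lemma real_adjoint_bounded_ops:
  assumes T: "T \<in> bounded_ops" and T': "\<And>x y. blinfun_apply T x \<bullet> y = x \<bullet> blinfun_apply T' y"
  shows "T' \<in> bounded_ops"
proof -
  have "x \<bullet> blinfun_apply (imul o\<^sub>L T') y = x \<bullet> blinfun_apply (T' o\<^sub>L imul) y" for x y
    using T'[of x "\<i> *\<^sub>C y"] T'[of "\<i> *\<^sub>C x" y]
    by (simp add: imul_apply bounded_ops_imul[OF T] inner_imul)
  then show ?thesis
    unfolding bounded_ops_iff by (intro blinfun_eqI, rule vector_eq_inner_left)
qed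

lemma cinner_adjoint:
  assumes T: "T \<in> bounded_ops" and T': "\<And>x y. blinfun_apply T x \<bullet> y = x \<bullet> blinfun_apply T' y"
  shows "cinner (blinfun_apply T x) y = cinner x (blinfun_apply T' y)"
  using T'[of x y] T'[of x "\<i> *\<^sub>C y"] bounded_ops_imul[OF real_adjoint_bounded_ops[OF T T'], of y]
  by (simp add: complex_eq_iff Re_cinner Im_cinner)

lemma adj_eqI:
  assumes T: "T \<in> bounded_ops" and T': "\<And>x y. blinfun_apply T x \<bullet> y = x \<bullet> blinfun_apply T' y"
  shows "adj T = T'"
  unfolding adj_def
proof (rule the_equality)
  show "\<forall>x y. cinner (blinfun_apply T x) y = cinner x (blinfun_apply T' y)"
    using cinner_adjoint[OF T T'] by blast
  fix S assume S: "\<forall>x y. cinner (blinfun_apply T x) y = cinner x (blinfun_apply S y)"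
  have "x \<bullet> blinfun_apply S y = x \<bullet> blinfun_apply T' y" for x y
    using S T'[of x y] by (metis Re_cinner)
  then show "S = T'"
    by (intro blinfun_eqI, rule vector_eq_inner_left)
qed

lemma adj_inner:
  assumes T: "T \<in> bounded_ops"
  shows "blinfun_apply T x \<bullet> y = x \<bullet> blinfun_apply (adj T) y"
proof -
  have "bounded_bilinear (\<lambda>x y. blinfun_apply T x \<bullet> y)"
    by (rule bounded_bilinear.comp[OF bounded_bilinear_inner blinfun.bounded_linear_right bounded_linear_ident])
  then obtain T' :: "'a \<Rightarrow>\<^sub>L 'a" where "\<And>x y. blinfun_apply T x \<bullet> y = x \<bullet> blinfun_apply T' y"
    using bounded_bilinear_blinfun_ex by blast
  then show ?thesis using adj_eqI[OF T] by metis
qed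

lemma selfadjoint_op_iff: "selfadjoint_op T \<longleftrightarrow> T \<in> bounded_ops \<and> sym_op T"
  unfolding selfadjoint_op_def sym_op_def by (metis adj_eqI adj_inner)

text \<open>Composing a symmetric complex-linear operator with the skew operator \<i> gives a skew
  one, whose quadratic form, up to sign the imaginary part here, vanishes.\<close>

lemma cinner_sym:
  assumes "T \<in> bounded_ops" "sym_op T"
  shows "cinner x (blinfun_apply T x) = of_real (x \<bullet> blinfun_apply T x)"
proof -
  have "x \<bullet> (\<i> *\<^sub>C blinfun_apply T x) = 0"
    using sym_opD[OF assms(2), of x "\<i> *\<^sub>C x"] bounded_ops_imul[OF assms(1), of x]
      inner_imul[of "blinfun_apply T x" x]
    by (simp add: inner_commute)
  then show ?thesis by (simp add: complex_eq_iff Re_cinner Im_cinner)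
qed

lemma positive_opI:
  assumes "T \<in> bounded_ops" "sym_op T" "\<And>x. 0 \<le> x \<bullet> blinfun_apply T x"
  shows "positive_op T"
  using assms by (simp add: positive_op_def cinner_sym nonneg_Reals_of_real_iff)

lemma positive_opD: "positive_op T \<Longrightarrow> 0 \<le> x \<bullet> blinfun_apply T x"
  unfolding positive_op_def by (metis Re_cinner complex_nonneg_Reals_iff)

text \<open>Polarisation in \<open>x + y\<close> and \<open>x + \<i> y\<close>; this is where complex scalars are essential.\<close>

lemma quadratic_form_unique:
  assumes "S \<in> bounded_ops" "T \<in> bounded_ops"
    and eq: "\<And>x. cinner x (blinfun_apply S x) = cinner x (blinfun_apply T x)"
  shows "S = T"
proof -
  have pol: "cinner x (blinfun_apply S y) + cinner y (blinfun_apply S x)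
      = cinner x (blinfun_apply T y) + cinner y (blinfun_apply T x)" for x y
    using eq[of "x + y"] eq[of x] eq[of y]
    by (simp add: blinfun.add_right cinner_add_left cinner_add_right add.commute)
  have "cinner x (blinfun_apply S y) = cinner x (blinfun_apply T y)" for x y
  proof -
    have lin: "blinfun_apply S (\<i> *\<^sub>C y) = \<i> *\<^sub>C blinfun_apply S y"
      "blinfun_apply T (\<i> *\<^sub>C y) = \<i> *\<^sub>C blinfun_apply T y"
      using assms by (simp_all add: bounded_ops_imul)
    have "\<i> * (cinner x (blinfun_apply S y) - cinner y (blinfun_apply S x))
      = \<i> * (cinner x (blinfun_apply T y) - cinner y (blinfun_apply T x))"
      using pol[of x "\<i> *\<^sub>C y"] by (simp add: lin cinner_scaleC_left cinner_scaleC_right algebra_simps)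
    then have "cinner x (blinfun_apply S y) - cinner y (blinfun_apply S x)
      = cinner x (blinfun_apply T y) - cinner y (blinfun_apply T x)"
      by simp
    with pol[of x y] show ?thesis by (simp add: algebra_simps complex_eq_iff)
  qed
  then have "x \<bullet> blinfun_apply S y = x \<bullet> blinfun_apply T y" for x y
    by (metis Re_cinner)
  then show ?thesis
    by (intro blinfun_eqI, rule vector_eq_inner_left)
qed

subsection \<open>Projection-valued measures\<close>

lemma is_projectionD:
  assumes "is_projection Q"
  shows "Q \<in> bounded_ops" "sym_op Q" "Q o\<^sub>L Q = Q"
    "x \<bullet> blinfun_apply Q x = (norm (blinfun_apply Q x))\<^sup>2"
proof -
  show Q: "Q \<in> bounded_ops" "sym_op Q" "Q o\<^sub>L Q = Q"
    using assms by (auto simp: is_projection_def selfadjoint_op_iff)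
  have "blinfun_apply Q x \<bullet> blinfun_apply Q x = x \<bullet> blinfun_apply (Q o\<^sub>L Q) x"
    by (simp add: sym_opD[OF Q(2)])
  then show "x \<bullet> blinfun_apply Q x = (norm (blinfun_apply Q x))\<^sup>2"
    by (simp add: Q(3) power2_norm_eq_inner)
qed

locale pvm =
  fixes P :: "real set \<Rightarrow> ('h::complex_hilbert \<Rightarrow>\<^sub>L 'h)"
  assumes pvm: "projection_valued_measure P"
begin

lemma projection: "S \<in> sets borel \<Longrightarrow> is_projection (P S)"
  using pvm by (simp add: projection_valued_measure_def)

lemma P_UNIV: "P UNIV = id_blinfun"
  using pvm by (simp add: projection_valued_measure_def)

lemma P_sums: "range F \<subseteq> sets borel \<Longrightarrow> disjoint_family F \<Longrightarrow>
    (\<lambda>n. blinfun_apply (P (F n)) x) sums blinfun_apply (P (\<Union>n. F n)) x" for F :: "nat \<Rightarrow> real set"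
  using pvm by (simp add: projection_valued_measure_def)

text \<open>Countable additivity for the constant family of empty sets gives a convergent series
  with equal terms, and terms of a convergent series tend to 0.\<close>

lemma P_empty: "blinfun_apply (P {}) x = 0"
proof -
  have "(\<lambda>n::nat. blinfun_apply (P {}) x) \<longlonglongrightarrow> 0"
    using P_sums[of "\<lambda>_. {}" x] by (intro summable_LIMSEQ_zero sums_summable) (auto simp: disjoint_family_on_def)
  then show ?thesis by (simp add: LIMSEQ_const_iff)
qed

lemma sets_vm: "sets (vector_measure P x) = sets borel"
  by (simp add: vector_measure_def sets_measure_of_conv) (metis sets.sigma_sets_eq space_borel)

lemma emeasure_vm:
  assumes S: "S \<in> sets borel"
  shows "emeasure (vector_measure P x) S = ennreal (x \<bullet> blinfun_apply (P S) x)"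
proof -
  have "emeasure (vector_measure P x) S = ennreal (Re (cinner x (blinfun_apply (P S) x)))"
    unfolding vector_measure_def
  proof (rule emeasure_measure_of_sigma)
    show "sigma_algebra UNIV (sets (borel :: real measure))"
      using sets.sigma_algebra_axioms[of "borel :: real measure"] by simp
    show "positive (sets borel) (\<lambda>S. ennreal (Re (cinner x (blinfun_apply (P S) x))))"
      by (simp add: positive_def P_empty Re_cinner)
    show "countably_additive (sets borel) (\<lambda>S. ennreal (Re (cinner x (blinfun_apply (P S) x))))"
    proof (rule countably_additiveI)
      fix F :: "nat \<Rightarrow> real set"
      assume F: "range F \<subseteq> sets borel" "disjoint_family F"
      then have "F i \<in> sets borel" for i by auto
      then have "0 \<le> x \<bullet> blinfun_apply (P (F i)) x" for i
        by (simp add: is_projectionD(4)[OF projection])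
      moreover have "(\<lambda>n. x \<bullet> blinfun_apply (P (F n)) x) sums (x \<bullet> blinfun_apply (P (\<Union>n. F n)) x)"
        by (rule bounded_linear.sums[OF bounded_linear_inner_right P_sums[OF F]])
      ultimately show "(\<Sum>i. ennreal (Re (cinner x (blinfun_apply (P (F i)) x))))
          = ennreal (Re (cinner x (blinfun_apply (P (\<Union> (range F))) x)))"
        unfolding Re_cinner by (intro suminf_ennreal_eq)
    qed
  qed fact
  then show ?thesis by (simp add: Re_cinner)
qed

lemma measure_vm:
  assumes S: "S \<in> sets borel"
  shows "measure (vector_measure P x) S = (norm (blinfun_apply (P S) x))\<^sup>2"
  using emeasure_vm[OF S, of x] is_projectionD(4)[OF projection[OF S], of x] by (simp add: measure_def)

lemma space_vm: "space (vector_measure P x) = UNIV"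
  using sets_eq_imp_space_eq[OF sets_vm] by simp

lemma finite_vm: "finite_measure (vector_measure P x)"
  by (rule finite_measureI) (simp add: space_vm emeasure_vm)

text \<open>Multiplicativity is not part of the definition of a projection-valued measure. For v in
  the range of \<open>P T\<close> the set \<open>T\<close> already carries the full mass of the
  vector measure at v, so a disjoint \<open>S\<close> has mass 0 there.\<close>

lemma vm_orthogonal:
  assumes S: "S \<in> sets borel" and T: "T \<in> sets borel" and disj: "S \<inter> T = {}"
  shows "P S o\<^sub>L P T = 0"
proof (rule blinfun_eqI)
  fix y
  define v where "v = blinfun_apply (P T) y"
  interpret finite_measure "vector_measure P v" by (rule finite_vm)
  have Tv: "blinfun_apply (P T) v = v"
    using is_projectionD(3)[OF projection[OF T]] unfolding v_def by (metis blinfun_apply_blinfun_compose)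
  have "measure (vector_measure P v) S + measure (vector_measure P v) T = measure (vector_measure P v) (S \<union> T)"
    using S T disj by (intro finite_measure_Union[symmetric]) (auto simp: sets_vm)
  also have "\<dots> \<le> measure (vector_measure P v) UNIV"
    using finite_measure_mono[of "S \<union> T" UNIV] by (simp add: sets_vm)
  also have "\<dots> = (norm v)\<^sup>2"
    by (simp add: measure_vm P_UNIV)
  finally have "(norm (blinfun_apply (P S) v))\<^sup>2 \<le> 0"
    by (simp add: measure_vm S T Tv)
  then show "blinfun_apply (P S o\<^sub>L P T) y = blinfun_apply 0 y"
    by (simp add: v_def)
qed

end

section \<open>Step approximation and the moments of a given spectral resolution\<close>

text \<open>The sets are the level sets of the floor of \<open>f / e\<close>; boundedness on the
  interval leaves only finitely many levels.\<close>

lemma bdd_borel_step: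
  assumes f: "bdd_borel K f" and e: "0 < e"
  obtains I :: "int set" and S c where "finite I" "disjoint_family_on S I" "\<And>i. S i \<in> sets borel"
    "\<And>t. t \<in> {-K..K} \<Longrightarrow> \<bar>f t - (\<Sum>i\<in>I. c i * indicator (S i) t)\<bar> \<le> e"
proof -
  obtain C where C: "0 \<le> C" "\<And>t. t \<in> {-K..K} \<Longrightarrow> \<bar>f t\<bar> \<le> C" using bdd_borelE[OF f] by metis
  have [measurable]: "f \<in> borel_measurable borel" using f by (rule bdd_borel_measurable)
  define N where "N = \<lceil>C / e\<rceil> + 1"
  define S where "S i = {t. \<lfloor>f t / e\<rfloor> = i}" for i
  have S: "S i \<in> sets borel" for i
    unfolding S_def by measurable
  have "\<bar>f t - (\<Sum>i\<in>{-N..N}. e * of_int i * indicator (S i) t)\<bar> \<le> e" if t: "t \<in> {-K..K}" for t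
  proof -
    have "\<bar>f t / e\<bar> \<le> C / e"
      using C(2)[OF t] e by (simp add: abs_divide divide_right_mono)
    moreover have "- (\<lceil>y\<rceil> + 1) \<le> \<lfloor>x\<rfloor> \<and> \<lfloor>x\<rfloor> \<le> \<lceil>y\<rceil> + 1" if "\<bar>x\<bar> \<le> y" for x y :: real
      using that le_of_int_ceiling[of y] by (simp only: le_floor_iff floor_le_iff of_int_minus of_int_add) linarith
    ultimately have "\<lfloor>f t / e\<rfloor> \<in> {-N..N}"
      unfolding N_def by (simp only: atLeastAtMost_iff)
    then have "(\<Sum>i\<in>{-N..N}. e * of_int i * indicator (S i) t) = e * of_int \<lfloor>f t / e\<rfloor>"
      by (subst sum.remove[of _ "\<lfloor>f t / e\<rfloor>"]) (auto simp: S_def intro!: sum.neutral)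
    moreover have "f t - e * of_int \<lfloor>f t / e\<rfloor> = e * (f t / e - of_int \<lfloor>f t / e\<rfloor>)"
      using e by (simp add: algebra_simps)
    moreover have "\<bar>f t / e - of_int \<lfloor>f t / e\<rfloor>\<bar> \<le> 1"
      by linarith
    ultimately show ?thesis
      using e by (simp add: abs_mult mult_left_le)
  qed
  then show thesis
    using S by (intro that[of "{-N..N}" S "\<lambda>i. e * of_int i"]) (auto simp: disjoint_family_on_def S_def)
qed

context pvm
begin

text \<open>Orthogonality of the projections makes powers act on the coefficients alone, as
  disjointness does for the step function. Exponents start at \<open>Suc k\<close> because the
  expansion with coefficients \<open>c i ^ n\<close> fails for n = 0 unless the sets cover the
  line.\<close>

lemma step_operator:
  fixes I :: "int set" and c :: "int \<Rightarrow> real"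
  assumes "finite I" "disjoint_family_on S I" "\<And>i. S i \<in> sets borel"
  defines "G \<equiv> \<Sum>i\<in>I. c i *\<^sub>R P (S i)"
  shows "x \<bullet> (blinfun_apply G ^^ Suc k) x = (\<integral>t. (\<Sum>i\<in>I. c i * indicator (S i) t) ^ Suc k \<partial>vector_measure P x)"
    and "sym_op G"
proof -
  interpret finite_measure "vector_measure P x" by (rule finite_vm)
  have PP: "blinfun_apply (P (S i)) (blinfun_apply (P (S j)) y) = (if i = j then blinfun_apply (P (S i)) y else 0)"
    if "i \<in> I" "j \<in> I" for i j y
  proof (cases "i = j")
    case True
    then show ?thesis
      using is_projectionD(3)[OF projection[OF assms(3)[of i]]] by (metis blinfun_apply_blinfun_compose)
  next
    case False
    then have "S i \<inter> S j = {}" using assms(2) that by (auto simp: disjoint_family_on_def)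
    from vm_orthogonal[OF assms(3) assms(3) this] show ?thesis
      using False by (metis blinfun.zero_left blinfun_apply_blinfun_compose)
  qed
  have G: "blinfun_apply G y = (\<Sum>i\<in>I. c i *\<^sub>R blinfun_apply (P (S i)) y)" for y
    by (simp add: G_def blinfun.sum_left blinfun.scaleR_left)
  have "(blinfun_apply G ^^ Suc k) y = (\<Sum>i\<in>I. c i ^ Suc k *\<^sub>R blinfun_apply (P (S i)) y)" for y k
  proof (induction k)
    case (Suc k)
    have "(blinfun_apply G ^^ Suc (Suc k)) y = blinfun_apply G ((blinfun_apply G ^^ Suc k) y)"
      by simp
    also have "\<dots> = blinfun_apply G (\<Sum>j\<in>I. c j ^ Suc k *\<^sub>R blinfun_apply (P (S j)) y)"
      by (simp only: Suc)
    also have "\<dots> = (\<Sum>j\<in>I. c j ^ Suc k *\<^sub>R (\<Sum>i\<in>I. c i *\<^sub>R (if i = j then blinfun_apply (P (S i)) y else 0)))"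
      by (simp only: G blinfun.sum_right blinfun.scaleR_right PP cong: sum.cong)
    also have "\<dots> = (\<Sum>i\<in>I. c i ^ Suc (Suc k) *\<^sub>R blinfun_apply (P (S i)) y)"
      using assms(1) by (simp add: if_distrib[of "scaleR _"] sum.delta mult_ac cong: if_cong)
    finally show ?case .
  qed (simp add: G)
  then have "x \<bullet> (blinfun_apply G ^^ Suc k) x = (\<Sum>i\<in>I. c i ^ Suc k * measure (vector_measure P x) (S i))"
    by (simp add: inner_sum_right measure_vm assms is_projectionD(4)[OF projection])
  also have "\<dots> = (\<integral>t. (\<Sum>i\<in>I. c i ^ Suc k * indicator (S i) t) \<partial>vector_measure P x)"
    by (subst Bochner_Integration.integral_sum) (auto simp: sets_vm assms less_top[symmetric])
  also have "(\<lambda>t. \<Sum>i\<in>I. c i ^ Suc k * indicator (S i) t) = (\<lambda>t. (\<Sum>i\<in>I. c i * indicator (S i) t) ^ Suc k)"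
  proof
    fix t
    show "(\<Sum>i\<in>I. c i ^ Suc k * indicator (S i) t) = (\<Sum>i\<in>I. c i * indicator (S i) t) ^ Suc k"
    proof (cases "\<exists>j\<in>I. t \<in> S j")
      case True
      then obtain j where j: "j \<in> I" "t \<in> S j" by blast
      have z: "t \<notin> S i" if "i \<in> I - {j}" for i
        using assms(2) j that by (auto simp: disjoint_family_on_def)
      have "(\<Sum>i\<in>I. d i * indicator (S i) t) = d j" for d :: "int \<Rightarrow> real"
        using assms(1) j z by (subst sum.remove[of _ j]) (auto intro!: sum.neutral)
      then show ?thesis by simp
    next
      case False
      then have "(\<Sum>i\<in>I. d i * indicator (S i) t) = 0" for d :: "int \<Rightarrow> real"
        by (intro sum.neutral) auto
      then show ?thesis by simp
    qed
  qed
  finally show "x \<bullet> (blinfun_apply G ^^ Suc k) x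
      = (\<integral>t. (\<Sum>i\<in>I. c i * indicator (S i) t) ^ Suc k \<partial>vector_measure P x)" .
  show "sym_op G"
    using is_projectionD(2)[OF projection[OF assms(3)]]
    by (simp add: sym_op_def G inner_sum_left inner_sum_right)
qed

end

text \<open>The moments are computed by norm approximation of the operator with step operators,
  on which the projections act orthogonally.\<close>

lemma spectral_resolution_moment_family:
  assumes A: "sym_op A" and P: "is_spectral_resolution A P"
  shows "\<exists>K>0. moment_family A (vector_measure P) K"
proof -
  interpret pvm P
    using P by unfold_locales (simp add: is_spectral_resolution_def)
  obtain K0 where K0: "P {-K0..K0} = id_blinfun"
    using P by (auto simp: is_spectral_resolution_def)
  define K where "K = \<bar>K0\<bar> + 1"
  have AE: "AE t in vector_measure P x. t \<in> {-K..K}" for x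
  proof (rule AE_I)
    interpret finite_measure "vector_measure P x" by (rule finite_vm)
    have "measure (vector_measure P x) (UNIV - {-K0..K0}) = 0"
      using finite_measure_compl[of "{-K0..K0}"] by (simp add: space_vm sets_vm measure_vm K0 P_UNIV)
    then show "emeasure (vector_measure P x) (UNIV - {-K0..K0}) = 0"
      by (simp add: emeasure_eq_measure)
    show "{t \<in> space (vector_measure P x). t \<notin> {-K..K}} \<subseteq> UNIV - {-K0..K0}"
      by (auto simp: K_def)
  qed (simp add: sets_vm)
  have quad: "x \<bullet> blinfun_apply A x = (\<integral>t. t \<partial>vector_measure P x)" for x
    using P by (metis Re_cinner Re_complex_of_real is_spectral_resolution_def)
  have vm: "measure (vector_measure P x) UNIV = x \<bullet> x" for x
    by (simp add: measure_vm P_UNIV power2_norm_eq_inner)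
  have moment: "(\<integral>t. t ^ Suc k \<partial>vector_measure P x) = x \<bullet> (blinfun_apply A ^^ Suc k) x" for k x
  proof -
    interpret finite_measure "vector_measure P x" by (rule finite_vm)
    define Q where "Q n I S c \<longleftrightarrow> finite (I :: int set) \<and> disjoint_family_on S I \<and>
      (\<forall>i. S i \<in> sets (borel :: real measure)) \<and>
      (\<forall>t\<in>{-K..K}. \<bar>t - (\<Sum>i\<in>I. c i * indicator (S i) t)\<bar> \<le> 1 / Suc n)" for n :: nat and I S c
    have "\<exists>I S c. Q n I S c" for n
    proof -
      have "0 < 1 / real (Suc n)" by simp
      then show ?thesis
        by (rule bdd_borel_step[OF bdd_borel_id[of K]]) (unfold Q_def, blast)
    qed
    then obtain I S c where Q: "\<And>n. Q n (I n) (S n) (c n)"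
      by metis
    have I: "\<And>n. finite (I n)" "\<And>n. disjoint_family_on (S n) (I n)"
      and S: "\<And>n i. S n i \<in> sets (borel :: real measure)"
      and close: "\<And>n t. t \<in> {-K..K} \<Longrightarrow> \<bar>t - (\<Sum>i\<in>I n. c n i * indicator (S n i) t)\<bar> \<le> 1 / Suc n"
      using Q unfolding Q_def by blast+
    define g where "g n t = (\<Sum>i\<in>I n. c n i * indicator (S n i) t)" for n t
    define G where "G n = (\<Sum>i\<in>I n. c n i *\<^sub>R P (S n i))" for n
    have g_meas [measurable]: "g n \<in> borel_measurable borel" for n
      unfolding g_def using S by (intro borel_measurable_sum borel_measurable_times) auto
    have meas: "f \<in> borel_measurable borel \<Longrightarrow> f \<in> borel_measurable (vector_measure P y)" for f :: "real \<Rightarrow> real" and y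
      using measurable_cong_sets[OF sets_vm refl] by blast
    have G: "y \<bullet> (blinfun_apply (G n) ^^ Suc k) y = (\<integral>t. g n t ^ Suc k \<partial>vector_measure P y)" and sym: "sym_op (G n)" for n k y
      using step_operator[OF I S] unfolding g_def G_def by auto
    have int_id: "integrable (vector_measure P y) (\<lambda>t. t)" for y
      by (rule finite_measure.integrable_const_bound[OF finite_vm eventually_mono[OF AE], where B=K])
        (auto intro: meas)
    have g_bound: "\<bar>g n t\<bar> \<le> K + 1" if "t \<in> {-K..K}" for n t
    proof -
      have "\<bar>t - g n t\<bar> \<le> 1 / real (Suc n)" using close[OF that, of n] by (simp only: g_def)
      also have "\<dots> \<le> 1" by simp
      finally show ?thesis using that by auto
    qed
    have int_g: "integrable (vector_measure P y) (g n)" for y n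
      by (rule finite_measure.integrable_const_bound[OF finite_vm eventually_mono[OF AE], where B="K + 1"])
        (use g_bound in \<open>auto intro: meas\<close>)
    \<comment> \<open>The quadratic form of \<open>G n - A\<close> at \<open>y\<close> is the
      integral of \<open>g n t - t\<close>, at most 1 / (n + 1) times the mass
      \<open>y \<bullet> y\<close>; symmetry upgrades this to the operator norm.\<close>
    have norm_le: "norm (G n - A) \<le> 1 / Suc n" for n
    proof (rule sym_op_norm_le)
      show "sym_op (G n - A)" by (intro sym_op_diff sym A)
      fix y
      interpret y: finite_measure "vector_measure P y" by (rule finite_vm)
      have "y \<bullet> blinfun_apply (G n - A) y = (\<integral>t. g n t - t \<partial>vector_measure P y)"
        using G[where y=y and n=n and k=0] by (simp add: blinfun.diff_left inner_diff_right quad int_id int_g)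
      also have "\<bar>\<dots>\<bar> \<le> (\<integral>t. \<bar>g n t - t\<bar> \<partial>vector_measure P y)"
        by (rule integral_abs_bound)
      also have "\<dots> \<le> (\<integral>t. 1 / Suc n \<partial>vector_measure P y)"
        using close[of _ n] unfolding g_def[symmetric]
        by (intro integral_mono_AE integrable_abs Bochner_Integration.integrable_diff int_id int_g y.integrable_const
            eventually_mono[OF AE]) (simp add: abs_minus_commute)
      also have "\<dots> = 1 / Suc n * (y \<bullet> y)"
        using vm[of y] by (simp add: space_vm)
      finally show "\<bar>y \<bullet> blinfun_apply (G n - A) y\<bar> \<le> 1 / Suc n * (y \<bullet> y)" .
    qed simp
    have "G \<longlonglongrightarrow> A"
      by (rule LIM_zero_cancel, rule Lim_null_comparison[OF _ LIMSEQ_Suc[OF lim_1_over_n]])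
        (simp add: norm_le always_eventually del: of_nat_Suc)
    then have "(\<lambda>n. (blinfun_apply (G n) ^^ k) x) \<longlonglongrightarrow> (blinfun_apply A ^^ k) x" for k
      by (induction k) (auto intro!: blinfun.tendsto)
    then have "(\<lambda>n. x \<bullet> (blinfun_apply (G n) ^^ Suc k) x) \<longlonglongrightarrow> x \<bullet> (blinfun_apply A ^^ Suc k) x"
      by (intro tendsto_intros)
    moreover have "(\<lambda>n. \<integral>t. g n t ^ Suc k \<partial>vector_measure P x) \<longlonglongrightarrow> (\<integral>t. t ^ Suc k \<partial>vector_measure P x)"
    proof (rule integral_dominated_convergence[where w="\<lambda>_. (K + 1) ^ Suc k"])
      show "AE t in vector_measure P x. (\<lambda>n. g n t ^ Suc k) \<longlonglongrightarrow> t ^ Suc k"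
      proof (rule eventually_mono[OF AE])
        fix t assume t: "t \<in> {-K..K}"
        have "(\<lambda>n. g n t) \<longlonglongrightarrow> t"
          by (rule LIM_zero_cancel, rule Lim_null_comparison[OF _ LIMSEQ_Suc[OF lim_1_over_n]])
            (use close[OF t] in \<open>simp add: g_def abs_minus_commute always_eventually del: of_nat_Suc\<close>)
        then show "(\<lambda>n. g n t ^ Suc k) \<longlonglongrightarrow> t ^ Suc k" by (intro tendsto_intros)
      qed
      show "AE t in vector_measure P x. norm (g n t ^ Suc k) \<le> (K + 1) ^ Suc k" for n
        by (rule eventually_mono[OF AE]) (unfold real_norm_def power_abs, intro power_mono g_bound, auto)
      show "(\<lambda>t. t ^ Suc k) \<in> borel_measurable (vector_measure P x)"
        "(\<lambda>t. g n t ^ Suc k) \<in> borel_measurable (vector_measure P x)" for n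
        by (rule meas; measurable)+
    qed simp
    ultimately show ?thesis
      unfolding G using LIMSEQ_unique by blast
  qed
  have "moment_family A (vector_measure P) K"
  proof (rule moment_family.intro)
    show "(\<integral>t. t ^ n \<partial>vector_measure P x) = x \<bullet> (blinfun_apply A ^^ n) x" for n x
    proof (cases n)
      case 0
      then show ?thesis using vm[of x] by (simp add: space_vm)
    next
      case (Suc k)
      then show ?thesis using moment[where k=k and x=x] by (simp only:)
    qed
  qed (rule A finite_vm sets_vm AE)+
  then show ?thesis
    by (intro exI[of _ K]) (simp add: K_def)
qed

theorem spectral_theorem_positive:
  fixes A :: "'h::complex_hilbert \<Rightarrow>\<^sub>L 'h"
  assumes bo: "A \<in> bounded_ops" and A: "sym_op A" and A0: "\<And>x. 0 \<le> x \<bullet> blinfun_apply A x"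
  shows "\<exists>P. is_spectral_resolution A P"
proof -
  \<comment> \<open>The summand 1 keeps \<open>K\<close> positive when \<open>A = 0\<close>.\<close>
  define K where "K = norm A + 1"
  have "0 < K" by (simp add: K_def add_nonneg_pos)
  have A1: "x \<bullet> blinfun_apply A x \<le> K * (x \<bullet> x)" for x
  proof -
    have "x \<bullet> blinfun_apply A x \<le> norm x * (norm A * norm x)"
      by (rule order_trans[OF norm_cauchy_schwarz mult_left_mono[OF norm_blinfun]]) simp
    also have "\<dots> \<le> K * (x \<bullet> x)"
      by (simp add: K_def algebra_simps power2_eq_square flip: power2_norm_eq_inner)
    finally show ?thesis .
  qed
  obtain \<mu> where \<mu>: "\<And>x. finite_measure (\<mu> x)" "\<And>x. sets (\<mu> x) = sets borel"
    "\<And>x. AE t in \<mu> x. t \<in> {-K..K}" "\<And>x n. (\<integral>t. t ^ n \<partial>\<mu> x) = x \<bullet> (blinfun_apply A ^^ n) x"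
    using ex_moment_measure[OF A A0 A1 \<open>0 < K\<close>] by metis
  interpret moment_family A \<mu> K
    by (rule moment_family.intro) (rule A \<mu>)+
  have bounded_calc: "calc f \<in> bounded_ops" if "bdd_borel K f" for f
    unfolding bounded_ops_iff
    using calc_commute[OF that, of imul "- imul"] bo
    by (simp add: bounded_ops_iff blinfun.minus_left imul_apply inner_imul)
  have "projection_valued_measure (\<lambda>S. proj S)"
    unfolding projection_valued_measure_def
  proof (intro conjI allI impI ballI)
    fix S :: "real set" assume S: "S \<in> sets borel"
    show "is_projection (proj S)"
      by (simp add: is_projection_def selfadjoint_op_iff bounded_calc sym_op_calc bdd_borel_indicator S proj_inter)
  next
    show "proj UNIV = id_blinfun"
      using calc_one by (simp add: indicator_def)
  qed (rule proj_sums)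
  then interpret pvm "\<lambda>S. proj S" by unfold_locales
  \<comment> \<open>The resolution returns the measures it was built from, so its defining integral
    is the moment identity for n = 1.\<close>
  have vm: "vector_measure (\<lambda>S. proj S) x = \<mu> x" for x
  proof (rule measure_eqI)
    interpret finite_measure "\<mu> x" by (rule finite_mu)
    show "emeasure (vector_measure (\<lambda>S. proj S) x) S = emeasure (\<mu> x) S"
      if "S \<in> sets (vector_measure (\<lambda>S. proj S) x)" for S
      using that by (simp add: sets_vm emeasure_vm proj_quadratic emeasure_eq_measure)
  qed (simp add: sets_vm sets_mu)
  have "proj {-K..K} = id_blinfun"
  proof (rule sym_op_eqI)
    fix x
    interpret finite_measure "\<mu> x" by (rule finite_mu)
    have "measure (\<mu> x) {-K..K} = measure (\<mu> x) UNIV"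
      by (rule measure_eq_AE) (use AE_mu[of x] in \<open>auto simp: sets_mu elim: eventually_mono\<close>)
    then show "x \<bullet> blinfun_apply (proj {-K..K}) x = x \<bullet> blinfun_apply id_blinfun x"
      by (simp add: proj_quadratic mass_mu)
  next
    show "sym_op (proj {-K..K})" by (simp add: sym_op_calc bdd_borel_indicator)
    show "sym_op id_blinfun" by (simp add: sym_op_def)
  qed
  moreover have "cinner x (blinfun_apply A x) = of_real (\<integral>t. t \<partial>\<mu> x)" for x
    using moment[where n=1 and x=x] by (simp add: cinner_sym bo A)
  ultimately have "is_spectral_resolution A (\<lambda>S. proj S)"
    unfolding is_spectral_resolution_def vm using pvm by blast
  then show ?thesis by blast
qed

subsection \<open>The spectral distribution in a tracial von Neumann algebra\<close>

context tracial_Wstar_probability_space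
begin

lemma vN: "M \<subseteq> bounded_ops" "\<And>T. T \<in> M \<Longrightarrow> adj T \<in> M" "commutant (commutant M) = M"
  using finite_vN unfolding finite_von_neumann_algebra_def von_neumann_algebra_def by auto

lemma in_M_iff: "T \<in> M \<longleftrightarrow> T \<in> bounded_ops \<and> (\<forall>S\<in>commutant M. S o\<^sub>L T = T o\<^sub>L S)"
  using vN(3) unfolding commutant_def[of "commutant M"] by blast

lemma M_bounded_ops: "T \<in> M \<Longrightarrow> T \<in> bounded_ops"
  using vN(1) by blast

lemma blinfun_compose_commute_iff:
  "S o\<^sub>L T = T o\<^sub>L S \<longleftrightarrow> (\<forall>x. blinfun_apply S (blinfun_apply T x) = blinfun_apply T (blinfun_apply S x))"
  by (metis blinfun_apply_blinfun_compose blinfun_eqI)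

text \<open>Adding \<open>imul\<close> to the commutant absorbs complex linearity. Membership is
  then pointwise commutation with a fixed set of operators, and the algebraic closure properties of
  \<open>M\<close> become simplification.\<close>

lemma in_M_iff_commute:
  "T \<in> M \<longleftrightarrow> (\<forall>S\<in>insert imul (commutant M). \<forall>x. blinfun_apply S (blinfun_apply T x) = blinfun_apply T (blinfun_apply S x))"
  unfolding in_M_iff bounded_ops_iff blinfun_compose_commute_iff by auto

lemma M_add: "S \<in> M \<Longrightarrow> T \<in> M \<Longrightarrow> S + T \<in> M"
  unfolding in_M_iff_commute by (auto simp: blinfun.add_left blinfun.add_right)

lemma M_scaleR: "T \<in> M \<Longrightarrow> c *\<^sub>R T \<in> M"
  unfolding in_M_iff_commute by (auto simp: blinfun.scaleR_left blinfun.scaleR_right)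

lemma M_compose: "S \<in> M \<Longrightarrow> T \<in> M \<Longrightarrow> S o\<^sub>L T \<in> M"
  unfolding in_M_iff_commute by auto

lemma M_id: "id_blinfun \<in> M"
  unfolding in_M_iff_commute by auto

lemma M_diff: "S \<in> M \<Longrightarrow> T \<in> M \<Longrightarrow> S - T \<in> M"
  using M_add[of S "(-1) *\<^sub>R T"] M_scaleR[of T "-1"] by simp

lemma M_sum: "(\<And>i. i \<in> I \<Longrightarrow> T i \<in> M) \<Longrightarrow> (\<Sum>i\<in>I. T i) \<in> M"
proof -
  have "0 \<in> M" using M_scaleR[OF M_id, of 0] by simp
  then show "(\<And>i. i \<in> I \<Longrightarrow> T i \<in> M) \<Longrightarrow> (\<Sum>i\<in>I. T i) \<in> M"
    by (induction I rule: infinite_finite_induct) (auto intro: M_add)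
qed

definition trace :: "('h \<Rightarrow>\<^sub>L 'h) \<Rightarrow> real" where "trace T = Re (E T)"

lemma trace_add: "S \<in> M \<Longrightarrow> T \<in> M \<Longrightarrow> trace (S + T) = trace S + trace T"
  by (simp add: trace_def E_add)

lemma trace_scaleR: "T \<in> M \<Longrightarrow> trace (c *\<^sub>R T) = c * trace T"
proof -
  assume T: "T \<in> M"
  have "scaleC_op (of_real c) T = Blinfun (blinfun_apply (c *\<^sub>R T))"
    unfolding scaleC_op_def by (rule arg_cong[where f=Blinfun]) (auto simp: scaleC_of_real blinfun.scaleR_left)
  then show ?thesis
    using E_scaleC[OF T, of "of_real c"] by (simp add: trace_def blinfun_apply_inverse)
qed

lemma trace_diff: "S \<in> M \<Longrightarrow> T \<in> M \<Longrightarrow> trace (S - T) = trace S - trace T"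
  using trace_add[of S "(-1) *\<^sub>R T"] trace_scaleR[of T "-1"] M_scaleR[of T "-1"] by simp

lemma trace_sum: "(\<And>i. i \<in> I \<Longrightarrow> T i \<in> M) \<Longrightarrow> trace (\<Sum>i\<in>I. T i) = (\<Sum>i\<in>I. trace (T i))"
proof -
  have "trace 0 = 0" using trace_scaleR[OF M_id, of 0] by simp
  then show "(\<And>i. i \<in> I \<Longrightarrow> T i \<in> M) \<Longrightarrow> trace (\<Sum>i\<in>I. T i) = (\<Sum>i\<in>I. trace (T i))"
    by (induction I rule: infinite_finite_induct) (auto simp: trace_add M_sum)
qed

lemma trace_id: "trace id_blinfun = 1"
  by (simp add: trace_def E_id)

lemma trace_nonneg:
  assumes "T \<in> M" "sym_op T" "\<And>x. 0 \<le> x \<bullet> blinfun_apply T x"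
  shows "0 \<le> trace T"
  using E_positive[OF assms(1) positive_opI[OF M_bounded_ops[OF assms(1)] assms(2,3)]]
  by (simp add: trace_def complex_nonneg_Reals_iff)

lemma trace_mono:
  assumes "S \<in> M" "T \<in> M" "sym_op S" "sym_op T" "\<And>x. x \<bullet> blinfun_apply S x \<le> x \<bullet> blinfun_apply T x"
  shows "trace S \<le> trace T"
  using trace_nonneg[OF M_diff[OF assms(2,1)] sym_op_diff[OF assms(4,3)]] assms
  by (simp add: trace_diff blinfun.diff_left inner_diff_right)

text \<open>The operator lies between \<open>- e\<close> and \<open>e\<close> times the identity,
  whose trace is 1.\<close>

lemma trace_bound:
  assumes T: "T \<in> M" "sym_op T" and e: "\<And>x. \<bar>x \<bullet> blinfun_apply T x\<bar> \<le> e * (x \<bullet> x)"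
  shows "\<bar>trace T\<bar> \<le> e"
proof -
  have s: "sym_op (c *\<^sub>R id_blinfun)" for c
    by (simp add: sym_op_def blinfun.scaleR_left)
  have "trace T \<le> trace (e *\<^sub>R id_blinfun)"
    by (rule trace_mono[OF T(1) M_scaleR[OF M_id] T(2) s])
      (use e in \<open>simp add: blinfun.scaleR_left abs_le_iff\<close>)
  moreover have "trace ((- e) *\<^sub>R id_blinfun) \<le> trace T"
  proof (rule trace_mono[OF M_scaleR[OF M_id] T(1) s T(2)])
    show "x \<bullet> blinfun_apply ((- e) *\<^sub>R id_blinfun) x \<le> x \<bullet> blinfun_apply T x" for x
      using e[of x] by (simp add: blinfun.scaleR_left blinfun.minus_left abs_le_iff)
  qed
  ultimately show ?thesis
    using trace_scaleR[OF M_id, of e] trace_scaleR[OF M_id, of "- e"] by (simp add: trace_id)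
qed

end

section \<open>The spectral distribution of a positive element\<close>

locale positive_element = tracial_Wstar_probability_space M E
  for M :: "('h::complex_hilbert \<Rightarrow>\<^sub>L 'h) set" and E :: "('h \<Rightarrow>\<^sub>L 'h) \<Rightarrow> complex" +
  fixes A :: "'h \<Rightarrow>\<^sub>L 'h"
  assumes A_in: "A \<in> M" and A_sym: "sym_op A" and A_nonneg: "0 \<le> x \<bullet> blinfun_apply A x"
begin

text \<open>The resolution picked by Hilbert choice; all that is known of it is
  \<open>is_spectral_resolution A P\<close>, once existence has been shown.\<close>

definition P :: "real set \<Rightarrow> ('h \<Rightarrow>\<^sub>L 'h)" where "P = spectral_resolution A"

lemma P: "is_spectral_resolution A P"
  unfolding P_def spectral_resolution_def
  using spectral_theorem_positive[OF M_bounded_ops[OF A_in] A_sym A_nonneg] by (rule someI_ex)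

definition K :: real where "K = (SOME K. 0 < K \<and> moment_family A (vector_measure P) K)"

lemma K: "0 < K" "moment_family A (vector_measure P) K"
  using someI_ex[OF spectral_resolution_moment_family[OF A_sym P]] unfolding K_def by auto

sublocale pvm P
  using P by unfold_locales (simp add: is_spectral_resolution_def)

sublocale moment_family A "vector_measure P" K
  by (rule K)

lemma calc_in_M:
  assumes f: "bdd_borel K f"
  shows "calc f \<in> M"
proof -
  have "S o\<^sub>L calc f = calc f o\<^sub>L S" if "S \<in> insert imul (commutant M)" for S
  proof -
    obtain S' :: "'h \<Rightarrow>\<^sub>L 'h" where "\<And>x y. blinfun_apply S' x \<bullet> y = x \<bullet> blinfun_apply S y"
    proof (cases "S = imul")
      case True
      then show thesis
        by (intro that[of "- imul"]) (simp add: blinfun.minus_left imul_apply inner_imul)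
    next
      case False
      then have "S \<in> bounded_ops" using \<open>S \<in> insert imul (commutant M)\<close> by (auto simp: commutant_def)
      then show thesis
        by (intro that[of "adj S"]) (metis adj_inner inner_commute)
    qed
    moreover have "S o\<^sub>L A = A o\<^sub>L S"
      using A_in that unfolding in_M_iff bounded_ops_iff by auto
    ultimately show ?thesis by (intro calc_commute f)
  qed
  then show ?thesis unfolding in_M_iff bounded_ops_iff by auto
qed

text \<open>A competitor for the definite description is complex-linear but not known to be
  symmetric, so uniqueness rests on complex polarisation,
  \<open>quadratic_form_unique\<close>.\<close>

lemma fun_calc_eq:
  assumes f: "bdd_borel K f"
  shows "fun_calc f A = calc f"
  unfolding fun_calc_def P_def[symmetric]
proof (rule the_equality)
  have c: "cinner x (blinfun_apply (calc f) x) = of_real (\<integral>t. f t \<partial>vector_measure P x)" for x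
    by (simp add: cinner_sym sym_op_calc f calc_in_M M_bounded_ops calc_quadratic)
  then show "calc f \<in> bounded_ops \<and> (\<forall>x. cinner x (blinfun_apply (calc f) x) = of_real (\<integral>t. f t \<partial>vector_measure P x))"
    by (simp add: f calc_in_M M_bounded_ops)
  fix T assume "T \<in> bounded_ops \<and> (\<forall>x. cinner x (blinfun_apply T x) = of_real (\<integral>t. f t \<partial>vector_measure P x))"
  then show "T = calc f"
    using c by (intro quadratic_form_unique) (auto simp: f calc_in_M M_bounded_ops)
qed

lemma proj_in_M: "S \<in> sets borel \<Longrightarrow> proj S \<in> M"
  by (intro calc_in_M bdd_borel_indicator)

lemma sym_op_proj: "S \<in> sets borel \<Longrightarrow> sym_op (proj S)"
  by (intro sym_op_calc bdd_borel_indicator)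

lemma proj_empty: "proj {} = 0"
proof -
  have "(indicator {} :: real \<Rightarrow> real) = (\<lambda>_. 0)" by auto
  then show ?thesis
    using calc_cmult[OF bdd_borel_const, of 0 0] by simp
qed

lemma trace_proj_nonneg: "S \<in> sets borel \<Longrightarrow> 0 \<le> trace (proj S)"
  by (intro trace_nonneg proj_in_M sym_op_proj) (simp_all add: proj_quadratic)

text \<open>Normality enters here. The projections of the partial unions form a directed set, and
  monotone convergence of their quadratic forms shows that the projection of the whole union is its
  least upper bound.\<close>

lemma trace_proj_sums:
  fixes F :: "nat \<Rightarrow> real set"
  assumes F: "range F \<subseteq> sets borel" and disj: "disjoint_family F"
  shows "(\<lambda>n. trace (proj (F n))) sums trace (proj (\<Union>n. F n))"
proof -
  have F': "F i \<in> sets borel" for i using F by auto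
  define U where "U n = (\<Union>i<n. F i)" for n
  have U: "U n \<in> sets borel" for n using F' by (auto simp: U_def)
  have inc: "U m \<subseteq> U n" if "m \<le> n" for m n using that unfolding U_def by (intro UN_mono) auto
  have UF: "(\<Union>n. U n) = (\<Union>n. F n)" by (auto simp: U_def)
  have V: "(\<Union>n. F n) \<in> sets borel" using F' by auto
  have mono: "x \<bullet> blinfun_apply (proj S) x \<le> x \<bullet> blinfun_apply (proj T) x"
    if "S \<in> sets borel" "T \<in> sets borel" "S \<subseteq> T" for S T x
    using that finite_measure.finite_measure_mono[OF finite_mu, of S T x] by (simp add: proj_quadratic sets_mu)
  have op_le: "op_le (proj S) (proj T)" if "S \<in> sets borel" "T \<in> sets borel" "S \<subseteq> T" for S T
    unfolding op_le_def
    using mono[OF that] that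
    by (intro positive_opI sym_op_diff sym_op_proj M_bounded_ops M_diff proj_in_M)
      (auto simp: blinfun.diff_left inner_diff_right)
  let ?D = "range (\<lambda>n. proj (U n))"
  have "Re (E (proj (\<Union>n. F n))) = (SUP S\<in>?D. Re (E S))"
  proof (rule E_normal[unfolded normal_on_def, rule_format], intro conjI)
    show "?D \<subseteq> {S \<in> M. positive_op S}"
      using U by (auto intro!: proj_in_M positive_opI M_bounded_ops sym_op_proj simp: proj_quadratic)
    show "\<forall>S1\<in>?D. \<forall>S2\<in>?D. \<exists>S\<in>?D. op_le S1 S \<and> op_le S2 S"
    proof clarsimp
      fix m n
      show "\<exists>k. op_le (proj (U m)) (proj (U k)) \<and> op_le (proj (U n)) (proj (U k))"
        by (intro exI[of _ "max m n"] conjI op_le U inc) auto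
    qed
    show "is_op_lub M ?D (proj (\<Union>n. F n))"
      unfolding is_op_lub_def
    proof (intro conjI ballI impI)
      show "proj (\<Union>n. F n) \<in> M" by (intro proj_in_M V)
      then show "selfadjoint_op (proj (\<Union>n. F n))"
        by (simp add: selfadjoint_op_iff M_bounded_ops sym_op_proj V)
      show "op_le S (proj (\<Union>n. F n))" if "S \<in> ?D" for S
        using that U V UF by (auto intro!: op_le)
      fix T assume T: "T \<in> M" "selfadjoint_op T \<and> (\<forall>S\<in>?D. op_le S T)"
      have "x \<bullet> blinfun_apply (proj (\<Union>n. F n)) x \<le> x \<bullet> blinfun_apply T x" for x
      proof (rule LIMSEQ_le_const2)
        interpret finite_measure "vector_measure P x" by (rule finite_mu)
        have "(\<lambda>n. measure (vector_measure P x) (U n)) \<longlonglongrightarrow> measure (vector_measure P x) (\<Union>n. U n)"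
          using U inc by (intro finite_Lim_measure_incseq) (auto simp: sets_mu incseq_def)
        then show "(\<lambda>n. x \<bullet> blinfun_apply (proj (U n)) x) \<longlonglongrightarrow> x \<bullet> blinfun_apply (proj (\<Union>n. F n)) x"
          by (simp add: proj_quadratic U V UF)
        have "x \<bullet> blinfun_apply (proj (U n)) x \<le> x \<bullet> blinfun_apply T x" for n
          using T(2) positive_opD[of "T - proj (U n)" x]
          by (auto simp: op_le_def blinfun.diff_left inner_diff_right)
        then show "\<exists>N. \<forall>n\<ge>N. x \<bullet> blinfun_apply (proj (U n)) x \<le> x \<bullet> blinfun_apply T x" by blast
      qed
      then show "op_le (proj (\<Union>n. F n)) T"
        unfolding op_le_def using T V
        by (intro positive_opI sym_op_diff sym_op_proj M_bounded_ops M_diff proj_in_M)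
          (auto simp: blinfun.diff_left inner_diff_right selfadjoint_op_iff)
    qed
  qed auto
  then have sup: "trace (proj (\<Union>n. F n)) = (SUP n. trace (proj (U n)))"
    by (simp add: trace_def image_image)
  have "(\<lambda>n. trace (proj (U n))) \<longlonglongrightarrow> (SUP n. trace (proj (U n)))"
  proof (rule LIMSEQ_incseq_SUP)
    have tm: "trace (proj S) \<le> trace (proj T)" if "S \<in> sets borel" "T \<in> sets borel" "S \<subseteq> T" for S T
      using that by (intro trace_mono proj_in_M sym_op_proj mono)
    show "bdd_above (range (\<lambda>n. trace (proj (U n))))"
      by (intro bdd_aboveI2[where M="trace (proj (\<Union>n. F n))"] tm U V) (use UF in blast)
    show "incseq (\<lambda>n. trace (proj (U n)))"
      by (auto simp: incseq_def intro!: tm U inc)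
  qed
  moreover have "trace (proj (U n)) = (\<Sum>i<n. trace (proj (F i)))" for n
  proof -
    have "proj (U n) = calc (\<lambda>t. \<Sum>i<n. indicator (F i) t)"
      unfolding U_def by (rule arg_cong[where f=calc], rule ext, rule indicator_UN_disjoint)
        (use disj in \<open>auto simp: disjoint_family_on_def\<close>)
    also have "\<dots> = (\<Sum>i<n. proj (F i))"
      by (intro calc_sum bdd_borel_indicator F')
    finally show ?thesis
      by (simp add: trace_sum proj_in_M F')
  qed
  ultimately show ?thesis
    by (simp add: sums_def sup)
qed

abbreviation \<nu> :: "real measure" where "\<nu> \<equiv> spectral_distribution E A"

lemma sets_nu [simp]: "sets \<nu> = sets borel"
  by (simp add: spectral_distribution_def sets_measure_of_conv) (metis sets.sigma_sets_eq space_borel)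

lemma space_nu [simp]: "space \<nu> = UNIV"
  using sets_eq_imp_space_eq[OF sets_nu] by simp

lemma emeasure_nu:
  assumes S: "S \<in> sets borel"
  shows "emeasure \<nu> S = ennreal (trace (proj S))"
proof -
  have "emeasure \<nu> S = ennreal (Re (E (fun_calc (indicator S) A)))"
    unfolding spectral_distribution_def
  proof (rule emeasure_measure_of_sigma)
    have fc: "Re (E (fun_calc (indicator S) A)) = trace (proj S)" if "S \<in> sets borel" for S
      using that by (simp add: fun_calc_eq bdd_borel_indicator trace_def)
    show "sigma_algebra UNIV (sets (borel :: real measure))"
      using sets.sigma_algebra_axioms[of "borel :: real measure"] by simp
    have "trace 0 = 0" using trace_scaleR[OF M_id, of 0] by simp
    then show "positive (sets borel) (\<lambda>S. ennreal (Re (E (fun_calc (indicator S) A))))"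
      unfolding positive_def using fc[of "{}"] by (simp add: proj_empty)
    show "countably_additive (sets borel) (\<lambda>S. ennreal (Re (E (fun_calc (indicator S) A))))"
    proof (rule countably_additiveI)
      fix F :: "nat \<Rightarrow> real set"
      assume F: "range F \<subseteq> sets borel" "disjoint_family F"
      then have F': "F i \<in> sets borel" for i by auto
      then have V: "(\<Union>i. F i) \<in> sets borel" by auto
      show "(\<Sum>i. ennreal (Re (E (fun_calc (indicator (F i)) A)))) = ennreal (Re (E (fun_calc (indicator (\<Union> (range F))) A)))"
        unfolding fc[OF F'] fc[OF V] by (intro suminf_ennreal_eq trace_proj_nonneg F' trace_proj_sums F)
    qed
  qed fact
  then show ?thesis
    using S by (simp add: fun_calc_eq bdd_borel_indicator trace_def)
qed

lemma prob_space_nu: "prob_space \<nu>"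
  by (rule prob_spaceI) (simp add: emeasure_nu calc_one trace_id)

lemma measure_nu: "S \<in> sets borel \<Longrightarrow> measure \<nu> S = trace (proj S)"
  by (simp add: measure_def emeasure_nu trace_proj_nonneg)

lemma proj_null:
  assumes "S \<in> sets borel" "\<And>x. AE t in vector_measure P x. t \<notin> S"
  shows "proj S = 0"
proof (rule sym_op_eqI)
  show "sym_op (0 :: 'h \<Rightarrow>\<^sub>L 'h)" by (simp add: sym_op_def)
  fix x
  interpret finite_measure "vector_measure P x" by (rule finite_mu)
  have "measure (vector_measure P x) S = measure (vector_measure P x) {}"
    by (rule measure_eq_AE) (use assms in \<open>auto simp: sets_mu\<close>)
  then show "x \<bullet> blinfun_apply (proj S) x = x \<bullet> blinfun_apply 0 x"
    by (simp add: proj_quadratic assms(1))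
qed (simp add: sym_op_proj assms)

lemma AE_nu_null: "S \<in> sets borel \<Longrightarrow> proj S = 0 \<Longrightarrow> AE t in \<nu>. t \<notin> S"
  using trace_scaleR[OF M_id, of 0] by (intro AE_I[of _ _ S]) (auto simp: emeasure_nu)

lemma AE_nu: "AE t in \<nu>. t \<in> {-K..K}"
proof -
  have "proj (- {-K..K}) = 0"
    using AE_mu by (intro proj_null) auto
  from AE_nu_null[OF _ this] show ?thesis by simp
qed

text \<open>A vector y in the range of the spectral projection of \<open>{..<a}\<close> satisfies c
  (y \<bullet> y) \<le> y \<bullet> A y \<le> a (y \<bullet> y), hence vanishes since
  \<open>a < c\<close>.\<close>

lemma AE_nu_ge:
  assumes c: "\<And>x. c * (x \<bullet> x) \<le> x \<bullet> blinfun_apply A x" and "a < c"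
  shows "AE t in \<nu>. a \<le> t"
proof -
  define S where "S = {..<a}"
  have S: "S \<in> sets borel" by (simp add: S_def)
  have "proj S = 0"
  proof (rule blinfun_eqI)
    fix x
    interpret finite_measure "vector_measure P x" by (rule finite_mu)
    define y where "y = blinfun_apply (proj S) x"
    have b: "bdd_borel K (\<lambda>t. t * indicator S t)" "bdd_borel K (\<lambda>t. a * indicator S t)"
      by (intro bdd_borel_mult bdd_borel_id bdd_borel_const bdd_borel_indicator S)+
    have ny: "y \<bullet> y = measure (vector_measure P x) S"
      by (simp add: y_def proj_norm_square S flip: power2_norm_eq_inner)
    have "c * (y \<bullet> y) \<le> y \<bullet> blinfun_apply A y" by (rule c)
    also have "\<dots> = x \<bullet> blinfun_apply (proj S o\<^sub>L (A o\<^sub>L proj S)) x"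
      by (simp add: y_def sym_opD[OF sym_op_proj[OF S]])
    also have "proj S o\<^sub>L (A o\<^sub>L proj S) = calc (\<lambda>t. indicator S t * (t * indicator S t))"
      by (simp add: calc_mult bdd_borel_mult bdd_borel_id bdd_borel_indicator S calc_id)
    also have "(\<lambda>t. indicator S t * (t * indicator S t)) = (\<lambda>t. t * indicator S t)"
      by (auto simp: indicator_def)
    also have "x \<bullet> blinfun_apply (calc (\<lambda>t. t * indicator S t)) x = (\<integral>t. t * indicator S t \<partial>vector_measure P x)"
      by (simp add: calc_quadratic b)
    also have "\<dots> \<le> (\<integral>t. a * indicator S t \<partial>vector_measure P x)"
      using b by (intro integral_mono integrable_mu) (auto simp: S_def indicator_def)
    also have "\<dots> = a * (y \<bullet> y)"
      using S by (simp add: ny sets_mu)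
    finally have "(c - a) * (y \<bullet> y) \<le> 0" by (simp add: algebra_simps)
    then have "y \<bullet> y \<le> 0"
      using \<open>a < c\<close> by (simp add: mult_le_0_iff)
    then have "y = 0"
      by (metis inner_eq_zero_iff inner_ge_zero order_antisym)
    then show "blinfun_apply (proj S) x = blinfun_apply 0 x"
      by (simp add: y_def)
  qed
  from AE_nu_null[OF S this] show ?thesis by (simp add: S_def not_less)
qed

lemma integrable_nu:
  assumes f: "bdd_borel K f"
  shows "integrable \<nu> f"
proof -
  interpret prob_space \<nu> by (rule prob_space_nu)
  obtain C where "\<And>t. t \<in> {-K..K} \<Longrightarrow> \<bar>f t\<bar> \<le> C" using bdd_borelE[OF f] by metis
  moreover have "f \<in> borel_measurable \<nu>"
    using bdd_borel_measurable[OF f] measurable_cong_sets[OF sets_nu refl] by blast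
  ultimately show ?thesis
    by (intro integrable_const_bound[where B=C]) (auto intro!: eventually_mono[OF AE_nu])
qed

text \<open>For step functions this is the definition of \<nu> together with linearity. Uniform
  approximation on the interval suffices, since \<open>trace_bound\<close> and the total mass 1 of
  \<nu> control both sides by the same error.\<close>

lemma trace_calc:
  assumes f: "bdd_borel K f"
  shows "trace (calc f) = (\<integral>t. f t \<partial>\<nu>)"
proof -
  interpret prob_space \<nu> by (rule prob_space_nu)
  have "\<bar>trace (calc f) - (\<integral>t. f t \<partial>\<nu>)\<bar> \<le> 0 + e" if "0 < e" for e
  proof -
    have "0 < e / 2" using that by simp
    obtain I :: "int set" and S c where I: "finite I" "disjoint_family_on S I" and S: "\<And>i. S i \<in> sets borel"
      and close: "\<And>t. t \<in> {-K..K} \<Longrightarrow> \<bar>f t - (\<Sum>i\<in>I. c i * indicator (S i) t)\<bar> \<le> e / 2"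
      using bdd_borel_step[OF f \<open>0 < e / 2\<close>] by metis
    define g where "g t = (\<Sum>i\<in>I. c i * indicator (S i) t)" for t
    have g: "bdd_borel K g"
      unfolding g_def by (intro bdd_borel_sum bdd_borel_cmult bdd_borel_indicator S)
    have fg: "bdd_borel K (\<lambda>t. f t + (-1) * g t)"
      by (intro bdd_borel_add bdd_borel_cmult f g)
    have "calc g = (\<Sum>i\<in>I. c i *\<^sub>R proj (S i))"
      unfolding g_def using S by (simp add: calc_sum calc_cmult bdd_borel_cmult bdd_borel_indicator)
    then have "trace (calc g) = (\<Sum>i\<in>I. c i * measure \<nu> (S i))"
      using S by (simp add: trace_sum trace_scaleR proj_in_M M_scaleR measure_nu)
    also have "\<dots> = (\<integral>t. g t \<partial>\<nu>)"
      unfolding g_def by (subst Bochner_Integration.integral_sum) (auto simp: S less_top[symmetric])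
    finally have tg: "trace (calc g) = (\<integral>t. g t \<partial>\<nu>)" .
    have "calc f - calc g = calc (\<lambda>t. f t + (-1) * g t)"
      using calc_add[OF f bdd_borel_cmult[OF g, of "-1"]] calc_cmult[OF g, of "-1"] by simp
    then have "trace (calc f) - trace (calc g) = trace (calc (\<lambda>t. f t + (-1) * g t))"
      by (simp add: trace_diff[symmetric] calc_in_M f g)
    moreover have "\<bar>trace (calc (\<lambda>t. f t + (-1) * g t))\<bar> \<le> e / 2"
      using close unfolding g_def[symmetric]
      by (intro trace_bound calc_in_M sym_op_calc fg) (simp only: calc_quadratic[OF fg], intro integral_mu_bound fg, simp)
    moreover have "\<bar>(\<integral>t. f t \<partial>\<nu>) - (\<integral>t. g t \<partial>\<nu>)\<bar> \<le> e / 2"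
    proof -
      have "\<bar>(\<integral>t. f t \<partial>\<nu>) - (\<integral>t. g t \<partial>\<nu>)\<bar> = \<bar>\<integral>t. f t - g t \<partial>\<nu>\<bar>"
        by (simp add: integrable_nu f g)
      also have "\<dots> \<le> (\<integral>t. \<bar>f t - g t\<bar> \<partial>\<nu>)" by (rule integral_abs_bound)
      also have "\<dots> \<le> (\<integral>t. e / 2 \<partial>\<nu>)"
        using close unfolding g_def[symmetric]
        by (intro integral_mono_AE integrable_abs Bochner_Integration.integrable_diff integrable_nu f g integrable_const
            eventually_mono[OF AE_nu]) auto
      finally show ?thesis by (simp add: prob_space[unfolded space_nu])
    qed
    ultimately show ?thesis using tg by linarith
  qed
  then show ?thesis
    using field_le_epsilon[of "\<bar>trace (calc f) - (\<integral>t. f t \<partial>\<nu>)\<bar>" 0] by simp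
qed

end

subsection \<open>The S-transform of a distribution bounded away from zero and infinity\<close>

locale positive_compact_distribution = prob_space \<nu> for \<nu> :: "real measure" +
  fixes a b :: real
  assumes sets_\<nu>: "sets \<nu> = sets borel"
    and a: "0 < a"
    and ab: "AE x in \<nu>. x \<in> {a..b}"
begin

lemma a_le_b: "a \<le> b"
proof (rule ccontr)
  assume "\<not> a \<le> b"
  then have "AE x in \<nu>. False" using ab by (auto elim: eventually_mono)
  then show False by simp
qed

lemma b: "0 < b" using a a_le_b by simp

lemma measurable_\<nu>: "f \<in> borel_measurable borel \<Longrightarrow> f \<in> borel_measurable \<nu>"
  using measurable_cong_sets[OF sets_\<nu> refl] by blast

lemma integrable_\<nu>:
  assumes "f \<in> borel_measurable borel" "\<And>x. x \<in> {a..b} \<Longrightarrow> \<bar>f x\<bar> \<le> C"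
  shows "integrable \<nu> (f :: real \<Rightarrow> real)"
  by (rule integrable_const_bound[where B=C]) (use assms in \<open>auto intro!: eventually_mono[OF ab] measurable_\<nu>\<close>)

lemma integral_mono_\<nu>:
  fixes f h :: "real \<Rightarrow> real"
  assumes "integrable \<nu> f" "integrable \<nu> h" "\<And>x. x \<in> {a..b} \<Longrightarrow> f x \<le> h x"
  shows "(\<integral>x. f x \<partial>\<nu>) \<le> (\<integral>x. h x \<partial>\<nu>)"
  by (intro integral_mono_AE assms eventually_mono[OF ab])

definition g :: "real \<Rightarrow> real" where "g s = (\<integral>x. s * x / (1 + s * x) \<partial>\<nu>)"

definition L :: "real \<Rightarrow> real" where "L s = (\<integral>x. ln (1 + s * x) \<partial>\<nu>)"

lemma integrable_g:
  assumes "0 < s"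
  shows "integrable \<nu> (\<lambda>x. s * x / (1 + s * x))"
proof (rule integrable_\<nu>)
  show "\<bar>s * x / (1 + s * x)\<bar> \<le> 1" if "x \<in> {a..b}" for x
  proof -
    have "0 < s * x" using that a assms by simp
    then show ?thesis by simp
  qed
qed measurable

lemma integrable_L:
  assumes "0 < s"
  shows "integrable \<nu> (\<lambda>x. ln (1 + s * x))"
proof (rule integrable_\<nu>)
  show "\<bar>ln (1 + s * x)\<bar> \<le> s * b" if "x \<in> {a..b}" for x
  proof -
    have "0 < s * x" "s * x \<le> s * b" using that a assms by auto
    then show ?thesis using ln_add_one_self_le_self[of "s * x"] by simp
  qed
qed measurable

lemma integrable_ln: "integrable \<nu> ln"
proof (rule integrable_\<nu>)
  show "\<bar>ln x\<bar> \<le> \<bar>ln a\<bar> + \<bar>ln b\<bar>" if "x \<in> {a..b}" for x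
  proof -
    have "ln a \<le> ln x" "ln x \<le> ln b" using that a by auto
    then show ?thesis by linarith
  qed
qed measurable

lemma frac_mono: "0 \<le> u \<Longrightarrow> u \<le> v \<Longrightarrow> u / (1 + u) \<le> v / (1 + (v::real))"
  by (simp add: field_simps)

lemma g_lower:
  assumes "0 < s"
  shows "s * a / (1 + s * a) \<le> g s"
proof -
  have "(\<integral>x. s * a / (1 + s * a) \<partial>\<nu>) \<le> g s"
    unfolding g_def using a assms
    by (intro integral_mono_\<nu> integrable_g integrable_const frac_mono) auto
  then show ?thesis by (simp add: prob_space)
qed

lemma g_upper:
  assumes "0 < s"
  shows "g s \<le> s * b / (1 + s * b)"
proof -
  have "g s \<le> (\<integral>x. s * b / (1 + s * b) \<partial>\<nu>)"
    unfolding g_def using a assms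
    by (intro integral_mono_\<nu> integrable_g integrable_const frac_mono) auto
  then show ?thesis by (simp add: prob_space)
qed

lemma g_diff:
  assumes "0 < s" "s \<le> s'"
  shows "g s' - g s = (\<integral>x. (s' - s) * x / ((1 + s * x) * (1 + s' * x)) \<partial>\<nu>)"
    and "integrable \<nu> (\<lambda>x. (s' - s) * x / ((1 + s * x) * (1 + s' * x)))"
proof -
  have AE: "AE x in \<nu>. s' * x / (1 + s' * x) - s * x / (1 + s * x) = (s' - s) * x / ((1 + s * x) * (1 + s' * x))"
  proof (rule eventually_mono[OF ab])
    fix x assume "x \<in> {a..b}"
    then have "0 < s * x" "0 < s' * x" using a assms by auto
    then have "1 + s * x \<noteq> 0" "1 + s' * x \<noteq> 0" by linarith+
    then show "s' * x / (1 + s' * x) - s * x / (1 + s * x) = (s' - s) * x / ((1 + s * x) * (1 + s' * x))"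
      by (simp add: field_simps)
  qed
  have i: "integrable \<nu> (\<lambda>x. s' * x / (1 + s' * x) - s * x / (1 + s * x))"
    using assms by (intro Bochner_Integration.integrable_diff integrable_g) auto
  show "integrable \<nu> (\<lambda>x. (s' - s) * x / ((1 + s * x) * (1 + s' * x)))"
    by (rule integrable_cong_AE_imp[OF i]) (use AE in \<open>auto intro: measurable_\<nu>\<close>)
  have "g s' - g s = (\<integral>x. s' * x / (1 + s' * x) - s * x / (1 + s * x) \<partial>\<nu>)"
    unfolding g_def using assms by (intro Bochner_Integration.integral_diff[symmetric] integrable_g) auto
  also have "\<dots> = (\<integral>x. (s' - s) * x / ((1 + s * x) * (1 + s' * x)) \<partial>\<nu>)"
    by (rule integral_cong_AE) (use AE in \<open>auto intro: measurable_\<nu>\<close>)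
  finally show "g s' - g s = (\<integral>x. (s' - s) * x / ((1 + s * x) * (1 + s' * x)) \<partial>\<nu>)" .
qed

text \<open>The quantitative form of strict monotonicity: it makes the inverse of \<open>g\<close>
  locally Lipschitz, whereas \<open>g_diff_le\<close> does so for \<open>g\<close> itself.\<close>

lemma g_diff_ge:
  assumes "0 < s" "s \<le> s'"
  shows "(s' - s) * a / ((1 + s * b) * (1 + s' * b)) \<le> g s' - g s"
proof -
  have "(\<integral>x. (s' - s) * a / ((1 + s * b) * (1 + s' * b)) \<partial>\<nu>) \<le> g s' - g s"
    unfolding g_diff(1)[OF assms]
  proof (intro integral_mono_\<nu> g_diff assms integrable_const)
    fix x assume x: "x \<in> {a..b}"
    have "0 < 1 + s * x" "0 < 1 + s' * x"
      using x a assms by (auto intro: add_pos_pos)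
    then show "(s' - s) * a / ((1 + s * b) * (1 + s' * b)) \<le> (s' - s) * x / ((1 + s * x) * (1 + s' * x))"
      using x a assms by (intro frac_le mult_mono mult_nonneg_nonneg mult_pos_pos) auto
  qed
  then show ?thesis by (simp add: prob_space)
qed

lemma g_diff_le:
  assumes "0 < s" "s \<le> s'"
  shows "g s' - g s \<le> (s' - s) * b"
proof -
  have "g s' - g s \<le> (\<integral>x. (s' - s) * b \<partial>\<nu>)"
    unfolding g_diff(1)[OF assms]
  proof (intro integral_mono_\<nu> g_diff assms integrable_const)
    fix x assume x: "x \<in> {a..b}"
    have "1 \<le> (1 + s * x) * (1 + s' * x)"
      using mult_mono[of 1 "1 + s * x" 1 "1 + s' * x"] x a assms by simp
    then have "(s' - s) * x / ((1 + s * x) * (1 + s' * x)) \<le> (s' - s) * x / 1"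
      using x a assms by (intro divide_left_mono) auto
    also have "\<dots> \<le> (s' - s) * b" using x assms by (auto intro: mult_left_mono)
    finally show "(s' - s) * x / ((1 + s * x) * (1 + s' * x)) \<le> (s' - s) * b" .
  qed
  then show ?thesis by (simp add: prob_space)
qed

lemma g_strict_mono:
  assumes "0 < s" "s < s'"
  shows "g s < g s'"
proof -
  have "0 < 1 + s * b" "0 < 1 + s' * b"
    using b assms by (auto intro: add_pos_pos)
  then have "0 < (s' - s) * a / ((1 + s * b) * (1 + s' * b))"
    using a assms by simp
  then show ?thesis using g_diff_ge[of s s'] assms by simp
qed

lemma g_inj: "0 < s \<Longrightarrow> 0 < s' \<Longrightarrow> g s = g s' \<Longrightarrow> s = s'"
  using g_strict_mono[of s s'] g_strict_mono[of s' s] by (cases s s' rule: linorder_cases) auto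

lemma g_continuous: "continuous_on {0<..} g"
proof -
  have "\<bar>g s' - g s\<bar> \<le> b * \<bar>s' - s\<bar>" if "0 < s" "0 < s'" for s s'
  proof (cases "s \<le> s'")
    case True
    then show ?thesis
      using g_diff_le[of s s'] g_strict_mono[of s s'] that by (cases "s = s'") (auto simp: mult.commute)
  next
    case False
    then show ?thesis
      using g_diff_le[of s' s] g_strict_mono[of s' s] that by (auto simp: mult.commute)
  qed
  then have "b-lipschitz_on {0<..} g"
    using b by (intro lipschitz_onI) (auto simp: dist_real_def)
  then show ?thesis by (rule lipschitz_on_continuous_on)
qed

text \<open>The end points solve s b / (1 + s b) = t and s a / (1 + s a) = t, where the upper and
  lower estimates of \<open>g\<close> reach \<open>t\<close>. Keeping them in the conclusion later
  bounds the S-transform.\<close>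

lemma g_ex:
  assumes "0 < t" "t < 1"
  shows "\<exists>s. t / ((1 - t) * b) \<le> s \<and> s \<le> t / ((1 - t) * a) \<and> g s = t"
proof (rule IVT')
  define u where "u = t / (1 - t)"
  have u: "0 < u" "u / (1 + u) = t"
    using assms by (auto simp: u_def field_simps)
  have e: "t / ((1 - t) * c) = u / c" for c by (simp add: u_def)
  show "g (t / ((1 - t) * b)) \<le> t"
    using g_upper[of "u / b"] u b unfolding e by simp
  show "t \<le> g (t / ((1 - t) * a))"
    using g_lower[of "u / a"] u a unfolding e by simp
  show "t / ((1 - t) * b) \<le> t / ((1 - t) * a)"
    unfolding e using u a a_le_b by (intro divide_left_mono) auto
  show "continuous_on {t / ((1 - t) * b)..t / ((1 - t) * a)} g"
  proof (rule continuous_on_subset[OF g_continuous])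
    have "0 < u / b" using u b by simp
    then show "{t / ((1 - t) * b)..t / ((1 - t) * a)} \<subseteq> {0<..}"
      unfolding e by auto
  qed
qed

definition \<psi> :: "real \<Rightarrow> real" where "\<psi> z = (\<integral>x. z * x / (1 - z * x) \<partial>\<nu>)"

lemma \<psi>_eq: "\<psi> z = - g (- z)"
  by (simp add: \<psi>_def g_def)

lemma inj_\<psi>: "inj_on \<psi> {..<0}"
proof (rule inj_onI)
  fix x y assume "x \<in> {..<0}" "y \<in> {..<0}" "\<psi> x = \<psi> y"
  then show "x = y" using g_inj[of "- x" "- y"] by (simp add: \<psi>_eq)
qed

definition \<sigma> :: "real \<Rightarrow> real" where "\<sigma> t = - the_inv_into {..<0} \<psi> (- t)"

lemma \<sigma>:
  assumes "0 < t" "t < 1"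
  shows "t / ((1 - t) * b) \<le> \<sigma> t" "\<sigma> t \<le> t / ((1 - t) * a)" "0 < \<sigma> t" "g (\<sigma> t) = t"
proof -
  obtain s where s: "t / ((1 - t) * b) \<le> s" "s \<le> t / ((1 - t) * a)" "g s = t"
    using g_ex[OF assms] by blast
  have "0 < t / ((1 - t) * b)" using assms b by simp
  then have "0 < s" using s by simp
  then have "the_inv_into {..<0} \<psi> (- t) = - s"
    using s by (intro the_inv_into_f_eq inj_\<psi>) (auto simp: \<psi>_eq)
  then have "\<sigma> t = s" by (simp add: \<sigma>_def)
  then show "t / ((1 - t) * b) \<le> \<sigma> t" "\<sigma> t \<le> t / ((1 - t) * a)" "0 < \<sigma> t" "g (\<sigma> t) = t"
    using s \<open>0 < s\<close> by auto
qed

text \<open>The estimate contains the explicit upper bound for \<open>\<sigma> t'\<close> instead of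
  \<open>\<sigma> t'\<close> itself, so that its limit for t' tending to t can be computed before
  \<sigma> is known to be continuous.\<close>

lemma \<sigma>_dist:
  assumes t: "0 < t" "t < 1" and t': "0 < t'" "t' < 1"
  shows "\<bar>\<sigma> t' - \<sigma> t\<bar> \<le> \<bar>t' - t\<bar> * ((1 + \<sigma> t * b) * (1 + t' / ((1 - t') * a) * b)) / a"
proof -
  have le: "\<bar>s' - s\<bar> * a \<le> \<bar>g s' - g s\<bar> * ((1 + s * b) * (1 + s' * b))" if "0 < s" "0 < s'" for s s'
  proof -
    have *: "(s' - s) * a \<le> (g s' - g s) * ((1 + s * b) * (1 + s' * b))" if "0 < s" "s \<le> s'" for s s'
    proof -
      have "0 < 1 + s * b" "0 < 1 + s' * b"
        using b that by (auto intro: add_pos_pos)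
      then have "0 < (1 + s * b) * (1 + s' * b)" by simp
      then show ?thesis using g_diff_ge[OF that] by (simp only: pos_divide_le_eq)
    qed
    have nn: "0 \<le> (1 + s * b) * (1 + s' * b)"
      using b that by (auto intro!: mult_nonneg_nonneg add_nonneg_nonneg)
    show ?thesis
    proof (cases "s \<le> s'")
      case True
      then have "(s' - s) * a \<le> (g s' - g s) * ((1 + s * b) * (1 + s' * b))" using * that by blast
      also have "\<dots> \<le> \<bar>g s' - g s\<bar> * ((1 + s * b) * (1 + s' * b))" using nn by (intro mult_right_mono) auto
      finally show ?thesis using True by simp
    next
      case False
      then have "(s - s') * a \<le> (g s - g s') * ((1 + s' * b) * (1 + s * b))" using * that by auto
      also have "\<dots> \<le> \<bar>g s' - g s\<bar> * ((1 + s' * b) * (1 + s * b))"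
        using nn by (intro mult_right_mono) (auto simp: mult.commute)
      finally show ?thesis using False by (simp add: mult.commute)
    qed
  qed
  have "\<bar>\<sigma> t' - \<sigma> t\<bar> * a \<le> \<bar>t' - t\<bar> * ((1 + \<sigma> t * b) * (1 + \<sigma> t' * b))"
    using le[OF \<sigma>(3)[OF t] \<sigma>(3)[OF t']] \<sigma>(4)[OF t] \<sigma>(4)[OF t'] by simp
  also have "\<dots> \<le> \<bar>t' - t\<bar> * ((1 + \<sigma> t * b) * (1 + t' / ((1 - t') * a) * b))"
    using \<sigma>[OF t] \<sigma>[OF t'] b
    by (intro mult_left_mono add_left_mono mult_right_mono add_nonneg_nonneg mult_nonneg_nonneg) auto
  finally show ?thesis using a by (simp add: pos_le_divide_eq)
qed

lemma \<sigma>_isCont: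
  assumes t: "0 < t" "t < 1"
  shows "isCont \<sigma> t"
proof -
  have ev: "\<forall>\<^sub>F t' in at t. 0 < t' \<and> t' < 1"
    using t eventually_at_in_open[of "{0<..<1}" t] by (auto elim: eventually_mono)
  have "((\<lambda>t'. \<sigma> t' - \<sigma> t) \<longlongrightarrow> 0) (at t)"
  proof (rule Lim_null_comparison)
    show "\<forall>\<^sub>F t' in at t. norm (\<sigma> t' - \<sigma> t) \<le> \<bar>t' - t\<bar> * ((1 + \<sigma> t * b) * (1 + t' / ((1 - t') * a) * b)) / a"
      using ev by eventually_elim (use \<sigma>_dist t in auto)
    show "((\<lambda>t'. \<bar>t' - t\<bar> * ((1 + \<sigma> t * b) * (1 + t' / ((1 - t') * a) * b)) / a) \<longlongrightarrow> 0) (at t)"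
      using a t by (auto intro!: tendsto_eq_intros)
  qed
  then show ?thesis
    unfolding isCont_def by (rule LIM_zero_cancel)
qed

section \<open>The logarithm of the S-transform and its primitive\<close>

text \<open>This is ln S(-t): the prefactor 1 + 1/z at z = -t is -(1 - t)/t, and its sign cancels
  against that of the inverse, which is \<open>- \<sigma> t\<close>.\<close>

definition h :: "real \<Rightarrow> real" where "h t = ln (\<sigma> t * (1 - t) / t)"

lemma h_eq: "0 < t \<Longrightarrow> t < 1 \<Longrightarrow> h t = ln (\<sigma> t) + ln (1 - t) - ln t"
  using \<sigma>(3)[of t] by (simp add: h_def ln_mult ln_div)

lemma h_isCont: "0 < t \<Longrightarrow> t < 1 \<Longrightarrow> isCont h t"
  unfolding h_def using \<sigma>(3)[of t] by (intro continuous_intros \<sigma>_isCont) auto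

text \<open>The S-transform stays between 1/b and 1/a, by the bounds that accompany \<sigma>. This
  yields integrability and annihilates \<open>t * h t\<close> at 0 and \<open>(1 - t) * h t\<close>
  at 1.\<close>

lemma h_bound:
  assumes t: "0 < t" "t < 1"
  shows "\<bar>h t\<bar> \<le> \<bar>ln a\<bar> + \<bar>ln b\<bar>"
proof -
  have "1 / b \<le> \<sigma> t * (1 - t) / t"
    using \<sigma>(1)[OF t] b t by (simp add: field_simps)
  moreover have "\<sigma> t * (1 - t) / t \<le> 1 / a"
    using \<sigma>(2)[OF t] a t by (simp add: field_simps)
  moreover have "0 < 1 / b" using b by simp
  ultimately have "ln (1 / b) \<le> h t" "h t \<le> ln (1 / a)"
    unfolding h_def by (intro ln_mono; linarith)+
  then show ?thesis using a b by (simp add: ln_div)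
qed

lemma h_integrable: "set_integrable lborel {0<..<1} h"
proof -
  have "continuous_on {0<..<1} h"
    by (intro continuous_at_imp_continuous_on ballI h_isCont) auto
  then have meas: "(\<lambda>x. indicator {0<..<1} x *\<^sub>R h x) \<in> borel_measurable borel"
    by (intro borel_measurable_continuous_on_indicator) auto
  have int: "integrable lborel (\<lambda>x::real. indicator {0<..<1} x *\<^sub>R (\<bar>ln a\<bar> + \<bar>ln b\<bar>))"
    by (intro integrable_real_indicator integrable_scaleR_left) auto
  show ?thesis
    unfolding set_integrable_def
    by (rule Bochner_Integration.integrable_bound[OF int]) (use meas in \<open>auto simp: h_bound split: split_indicator\<close>)
qed

text \<open>Convexity of \<open>v \<mapsto> L (exp v)\<close>, whose derivative is \<open>g (exp v)\<close>.\<close>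

lemma L_convex:
  assumes s: "0 < s" and s': "0 < s'"
  shows "L s' + (ln s - ln s') * g s' \<le> L s"
proof -
  have int: "integrable \<nu> (\<lambda>x. ln (1 + s' * x) + (ln s - ln s') * (s' * x / (1 + s' * x)))"
    by (intro Bochner_Integration.integrable_add integrable_mult_right integrable_L integrable_g s s')
  have "L s' + (ln s - ln s') * g s' = (\<integral>x. ln (1 + s' * x) + (ln s - ln s') * (s' * x / (1 + s' * x)) \<partial>\<nu>)"
    unfolding L_def g_def
    by (subst Bochner_Integration.integral_add)
      (auto intro!: integrable_mult_right integrable_L integrable_g s s' simp del: times_divide_eq_right)
  also have "\<dots> \<le> L s"
    unfolding L_def
  proof (intro integral_mono_\<nu> int integrable_L s)
    fix x assume x: "x \<in> {a..b}"
    define p where "p = s' * x / (1 + s' * x)"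
    have pos: "0 < s * x" "0 < s' * x" using x a s s' by auto
    then have p: "0 \<le> p" "p \<le> 1" by (auto simp: p_def)
    have "(1 - p) * ln 1 + p * ln (s / s') \<le> ln ((1 - p) *\<^sub>R 1 + p *\<^sub>R (s / s'))"
      using concave_onD[OF ln_concave p, of 1 "s / s'"] s s' by simp
    also have "(1 - p) *\<^sub>R 1 + p *\<^sub>R (s / s') = (1 + s * x) / (1 + s' * x)"
    proof -
      have "1 + s' * x \<noteq> 0" using pos by linarith
      then show ?thesis using s' by (simp add: p_def field_simps)
    qed
    also have "ln \<dots> = ln (1 + s * x) - ln (1 + s' * x)"
      using pos by (intro ln_divide_pos) auto
    finally show "ln (1 + s' * x) + (ln s - ln s') * (s' * x / (1 + s' * x)) \<le> ln (1 + s * x)"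
      using s s' unfolding p_def[symmetric] by (simp add: ln_div mult.commute)
  qed
  finally show ?thesis .
qed

text \<open>\<open>t * ln (\<sigma> t) - L (\<sigma> t)\<close> is the Legendre transform of \<open>v \<mapsto> L (exp v)\<close>; by the envelope
  theorem its derivative is the maximising \<open>v\<close>, so no differentiation under the integral is needed.\<close>

lemma legendre_deriv:
  assumes t: "0 < t" "t < 1"
  shows "((\<lambda>t. t * ln (\<sigma> t) - L (\<sigma> t)) has_real_derivative ln (\<sigma> t)) (at t)"
proof -
  define k where "k t = t * ln (\<sigma> t) - L (\<sigma> t)" for t
  have k_ge: "ln (\<sigma> u) * (w - u) \<le> k w - k u" if "0 < u" "u < 1" "0 < w" "w < 1" for u w
    using L_convex[OF \<sigma>(3)[OF that(1,2)] \<sigma>(3)[OF that(3,4)]] \<sigma>(4)[OF that(3,4)]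
    by (simp add: k_def algebra_simps)
  have ev: "\<forall>\<^sub>F y in at t. 0 < y \<and> y < 1 \<and> y \<noteq> t"
    using t eventually_at_in_open[of "{0<..<1}" t] by (auto elim: eventually_mono)
  have "((\<lambda>y. (k y - k t) / (y - t) - ln (\<sigma> t)) \<longlongrightarrow> 0) (at t)"
  proof (rule Lim_null_comparison)
    show "\<forall>\<^sub>F y in at t. norm ((k y - k t) / (y - t) - ln (\<sigma> t)) \<le> \<bar>ln (\<sigma> y) - ln (\<sigma> t)\<bar>"
      using ev
    proof eventually_elim
      case (elim y)
      have lo: "ln (\<sigma> t) * (y - t) \<le> k y - k t" using k_ge[of t y] t elim by simp
      have up: "k y - k t \<le> ln (\<sigma> y) * (y - t)" using k_ge[of y t] t elim by (simp add: algebra_simps)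
      have "0 \<le> k y - k t - ln (\<sigma> t) * (y - t)" using lo by simp
      moreover have "k y - k t - ln (\<sigma> t) * (y - t) \<le> (ln (\<sigma> y) - ln (\<sigma> t)) * (y - t)"
        using up by (simp add: algebra_simps)
      ultimately have "\<bar>k y - k t - ln (\<sigma> t) * (y - t)\<bar> \<le> \<bar>ln (\<sigma> y) - ln (\<sigma> t)\<bar> * \<bar>y - t\<bar>"
        by (simp flip: abs_mult)
      moreover have "(k y - k t) / (y - t) - ln (\<sigma> t) = (k y - k t - ln (\<sigma> t) * (y - t)) / (y - t)"
        using elim by (simp add: diff_divide_distrib)
      ultimately show ?case
        using elim by (simp add: abs_divide divide_le_eq)
    qed
    have "isCont (\<lambda>y. \<bar>ln (\<sigma> y) - ln (\<sigma> t)\<bar>) t"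
      using \<sigma>(3)[OF t] by (intro continuous_intros \<sigma>_isCont t) auto
    then show "((\<lambda>y. \<bar>ln (\<sigma> y) - ln (\<sigma> t)\<bar>) \<longlongrightarrow> 0) (at t)"
      by (simp add: isCont_def)
  qed
  then have "((\<lambda>y. (k y - k t) / (y - t)) \<longlongrightarrow> ln (\<sigma> t)) (at t)"
    by (rule LIM_zero_cancel)
  then show ?thesis
    unfolding has_field_derivative_iff k_def .
qed

text \<open>The primitive with all terms carrying the factor t collected into
  \<open>t * h t\<close>; in this form each summand tends to 0 as t tends to 0.\<close>

definition G :: "real \<Rightarrow> real" where "G t = t * h t - ln (1 - t) - L (\<sigma> t)"

lemma G_deriv:
  assumes t: "0 < t" "t < 1"
  shows "(G has_real_derivative h t) (at t)"
proof (rule has_field_derivative_transform_within_open)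
  have "((\<lambda>t. (1 - t) * ln (1 - t)) has_real_derivative - ln (1 - t) - 1) (at t)"
    "((\<lambda>t. t * ln t) has_real_derivative ln t + 1) (at t)"
    using t by (auto intro!: derivative_eq_intros)
  moreover have "h t = ln (\<sigma> t) - (- ln (1 - t) - 1) - (ln t + 1)"
    using t by (simp add: h_eq)
  ultimately show "((\<lambda>t. (t * ln (\<sigma> t) - L (\<sigma> t)) - (1 - t) * ln (1 - t) - t * ln t) has_real_derivative h t) (at t)"
    using DERIV_diff[OF DERIV_diff[OF legendre_deriv[OF t]]] by (simp only:)
  show "(u * ln (\<sigma> u) - L (\<sigma> u)) - (1 - u) * ln (1 - u) - u * ln u = G u" if "u \<in> {0<..<1}" for u
    using that by (simp add: G_def h_eq algebra_simps)
qed (use t in auto)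

text \<open>The first pair serves s tending to 0, the second s tending to infinity, where ln (1 + s
  x) = ln s + ln x + ln (1 + 1/(s x)) and the last summand is at most 1/(s a).\<close>

lemma L_bounds:
  assumes s: "0 < s"
  shows "0 \<le> L s" "L s \<le> s * b"
    "ln s + (\<integral>x. ln x \<partial>\<nu>) \<le> L s" "L s \<le> ln s + (\<integral>x. ln x \<partial>\<nu>) + 1 / (s * a)"
proof -
  have pos: "0 < s * x" "s * x \<le> s * b" if "x \<in> {a..b}" for x using that a s by auto
  have "(\<integral>x. 0 \<partial>\<nu>) \<le> L s"
    unfolding L_def using pos by (intro integral_mono_\<nu> integrable_const integrable_L s ln_ge_zero) (auto intro: less_imp_le)
  then show "0 \<le> L s" by simp
  have "L s \<le> (\<integral>x. s * b \<partial>\<nu>)"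
    unfolding L_def
  proof (intro integral_mono_\<nu> integrable_const integrable_L s)
    show "ln (1 + s * x) \<le> s * b" if "x \<in> {a..b}" for x
      using pos[OF that] ln_add_one_self_le_self[of "s * x"] by simp
  qed
  then show "L s \<le> s * b" by (simp add: prob_space)
  have i: "(\<integral>x. ln s + ln x \<partial>\<nu>) = ln s + (\<integral>x. ln x \<partial>\<nu>)"
    by (subst Bochner_Integration.integral_add) (auto simp: prob_space integrable_ln)
  have "(\<integral>x. ln s + ln x \<partial>\<nu>) \<le> L s"
    unfolding L_def
  proof (intro integral_mono_\<nu> Bochner_Integration.integrable_add integrable_const integrable_ln integrable_L s)
    show "ln s + ln x \<le> ln (1 + s * x)" if "x \<in> {a..b}" for x
    proof -
      have "ln s + ln x = ln (s * x)" using that a s by (simp add: ln_mult_pos)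
      also have "\<dots> \<le> ln (1 + s * x)" using pos[OF that] by (intro ln_mono) auto
      finally show ?thesis .
    qed
  qed
  then show "ln s + (\<integral>x. ln x \<partial>\<nu>) \<le> L s" by (simp add: i)
  have "L s \<le> (\<integral>x. (ln s + ln x) + 1 / (s * a) \<partial>\<nu>)"
    unfolding L_def
  proof (intro integral_mono_\<nu> Bochner_Integration.integrable_add integrable_const integrable_ln integrable_L s)
    fix x assume x: "x \<in> {a..b}"
    have "ln (1 + s * x) = ln (s * x * (1 + 1 / (s * x)))"
      using pos[OF x] by (simp add: field_simps)
    also have "\<dots> = ln (s * x) + ln (1 + 1 / (s * x))"
      using pos[OF x] by (intro ln_mult_pos) (auto intro: add_pos_pos)
    also have "\<dots> \<le> ln s + ln x + 1 / (s * x)"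
      using pos[OF x] x a s ln_add_one_self_le_self[of "1 / (s * x)"] by (simp add: ln_mult_pos)
    also have "1 / (s * x) \<le> 1 / (s * a)"
      using x a s by (intro divide_left_mono) auto
    finally show "ln (1 + s * x) \<le> (ln s + ln x) + 1 / (s * a)" by simp
  qed
  also have "\<dots> = ln s + (\<integral>x. ln x \<partial>\<nu>) + 1 / (s * a)"
    by (subst Bochner_Integration.integral_add) (auto simp: prob_space integrable_ln i)
  finally show "L s \<le> ln s + (\<integral>x. ln x \<partial>\<nu>) + 1 / (s * a)" .
qed

lemma ev01: "\<forall>\<^sub>F t in at_right 0. 0 < t \<and> t < (1::real)" "\<forall>\<^sub>F t in at_left 1. 0 < t \<and> t < (1::real)"
  using eventually_at_right_real[of 0 1] eventually_at_left_real[of 0 1] by auto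

lemma G_at_0: "(G \<longlongrightarrow> 0) (at_right 0)"
proof (rule Lim_null_comparison)
  let ?C = "\<bar>ln a\<bar> + \<bar>ln b\<bar>"
  show "\<forall>\<^sub>F t in at_right 0. norm (G t) \<le> t * ?C + \<bar>ln (1 - t)\<bar> + t / ((1 - t) * a) * b"
    using ev01(1)
  proof eventually_elim
    case (elim t)
    have "\<bar>t * h t\<bar> \<le> t * ?C"
      using h_bound[of t] elim by (simp add: abs_mult)
    moreover have "0 \<le> L (\<sigma> t)" "L (\<sigma> t) \<le> \<sigma> t * b"
      using L_bounds[of "\<sigma> t"] \<sigma>(3)[of t] elim by auto
    moreover have "\<sigma> t * b \<le> t / ((1 - t) * a) * b"
      using \<sigma>(2)[of t] elim b by (intro mult_right_mono) auto
    ultimately show ?case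
      unfolding G_def real_norm_def by linarith
  qed
  show "((\<lambda>t. t * ?C + \<bar>ln (1 - t)\<bar> + t / ((1 - t) * a) * b) \<longlongrightarrow> 0) (at_right 0)"
    using a by (auto intro!: tendsto_eq_intros)
qed

lemma G_at_1: "(G \<longlongrightarrow> - (\<integral>x. ln x \<partial>\<nu>)) (at_left 1)"
proof (rule LIM_zero_cancel, rule Lim_null_comparison)
  let ?C = "\<bar>ln a\<bar> + \<bar>ln b\<bar>"
  show "\<forall>\<^sub>F t in at_left 1. norm (G t - - (\<integral>x. ln x \<partial>\<nu>)) \<le> (1 - t) * ?C + \<bar>ln t\<bar> + (1 - t) * b / (t * a)"
    using ev01(2)
  proof eventually_elim
    case (elim t)
    have "\<bar>(1 - t) * h t\<bar> \<le> (1 - t) * ?C"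
      using h_bound[of t] elim by (simp add: abs_mult)
    \<comment> \<open>Trading \<open>t * h t\<close> for \<open>(1 - t) * h t\<close> cancels the
      divergent ln (1 - t) and leaves ln \<sigma> - L(\<sigma>), which \<open>L_bounds\<close>
      compares with the integral of ln.\<close>
    moreover have "G t = - ((1 - t) * h t) + ln (\<sigma> t) - ln t - L (\<sigma> t)"
      using elim by (simp add: G_def h_eq algebra_simps)
    moreover have "ln (\<sigma> t) + (\<integral>x. ln x \<partial>\<nu>) \<le> L (\<sigma> t)" "L (\<sigma> t) \<le> ln (\<sigma> t) + (\<integral>x. ln x \<partial>\<nu>) + 1 / (\<sigma> t * a)"
      using L_bounds[of "\<sigma> t"] \<sigma>(3)[of t] elim by auto
    moreover have "1 / (\<sigma> t * a) \<le> (1 - t) * b / (t * a)"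
    proof -
      have "0 < t / ((1 - t) * b) * a" using elim a b by simp
      then have "1 / (\<sigma> t * a) \<le> 1 / (t / ((1 - t) * b) * a)"
        using \<sigma>(1)[of t] elim a by (intro frac_le mult_right_mono) auto
      then show ?thesis by simp
    qed
    ultimately show ?case
      unfolding real_norm_def by linarith
  qed
  show "((\<lambda>t. (1 - t) * ?C + \<bar>ln t\<bar> + (1 - t) * b / (t * a)) \<longlongrightarrow> 0) (at_left 1)"
    using a by (auto intro!: tendsto_eq_intros)
qed

theorem integral_ln_S:
  assumes S: "\<And>z. S z = (1 + inverse z) * the_inv_into {..<0} \<psi> z"
  shows "interval_lebesgue_integrable lborel 0 1 (\<lambda>t. ln (S (- t)))"
    and "(LBINT t=0..1. ln (S (- t))) = - (\<integral>x. ln x \<partial>\<nu>)"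
proof -
  have eq: "ln (S (- t)) = h t" if "0 < t" "t < 1" for t
    using that by (simp add: S h_def \<sigma>_def field_simps)
  have e01: "einterval 0 1 = {0<..<1::real}"
    by (auto simp: einterval_def)
  have "set_integrable lborel (einterval 0 1) (\<lambda>t. ln (S (- t))) = set_integrable lborel (einterval 0 1) h"
    by (rule set_integrable_cong) (auto simp: e01 eq)
  then show "interval_lebesgue_integrable lborel 0 1 (\<lambda>t. ln (S (- t)))"
    using h_integrable by (simp add: interval_lebesgue_integrable_def e01)
  have "(LBINT t=0..1. ln (S (- t))) = (LBINT t=0..1. h t)"
    by (rule interval_integral_cong) (auto simp: e01 eq)
  \<comment> \<open>This form of the fundamental theorem works on the open interval with one-sided
    limits of \<open>G\<close>, so values at 0 and 1 do not matter.\<close>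
  also have "\<dots> = - (\<integral>x. ln x \<partial>\<nu>) - 0"
  proof (rule interval_integral_FTC_integrable)
    show "(G has_vector_derivative h t) (at t)" if "0 < ereal t" "ereal t < 1" for t
      using G_deriv[of t] that by (simp add: has_real_derivative_iff_has_vector_derivative)
    show "isCont h t" if "0 < ereal t" "ereal t < 1" for t
      using h_isCont[of t] that by simp
    show "set_integrable lborel (einterval 0 1) h"
      using h_integrable by (simp add: e01)
    show "((G \<circ> real_of_ereal) \<longlongrightarrow> 0) (at_right 0)"
      using G_at_0 unfolding zero_ereal_def ereal_tendsto_simps1 .
    show "((G \<circ> real_of_ereal) \<longlongrightarrow> - (\<integral>x. ln x \<partial>\<nu>)) (at_left 1)"
      using G_at_1 unfolding one_ereal_def ereal_tendsto_simps1 .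
  qed simp
  finally show "(LBINT t=0..1. ln (S (- t))) = - (\<integral>x. ln x \<partial>\<nu>)" by simp
qed

end

subsection \<open>The determinant formula\<close>

lemma bdd_borel_log_plus:
  assumes "0 < l"
  shows "bdd_borel K (log_plus l)"
proof (rule bdd_borelI)
  show "log_plus l \<in> borel_measurable borel"
    unfolding log_plus_def[abs_def] by measurable
  show "\<bar>log_plus l t\<bar> \<le> \<bar>ln l\<bar> + \<bar>ln K\<bar>" if "t \<in> {-K..K}" for t
  proof (cases "l < t")
    case True
    then have "ln l \<le> ln t" "ln t \<le> ln K" using that assms by auto
    then show ?thesis using True by (simp add: log_plus_def abs_le_iff) linarith
  qed (simp add: log_plus_def)
qed

text \<open>A left inverse \<open>Y\<close> gives |x| \<le> |Y| |X x|; the summand 1 in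
  \<open>k\<close> secures a positive divisor.\<close>

lemma boundedly_invertible_lower_bound:
  assumes "boundedly_invertible X"
  obtains c where "0 < c" "\<And>x. c * (x \<bullet> x) \<le> blinfun_apply X x \<bullet> blinfun_apply X x"
proof -
  obtain Y where Y: "Y o\<^sub>L X = id_blinfun"
    using assms by (auto simp: boundedly_invertible_def)
  define k where "k = norm Y + 1"
  have k: "0 < k" by (simp add: k_def add_nonneg_pos)
  have "(1 / k\<^sup>2) * (x \<bullet> x) \<le> blinfun_apply X x \<bullet> blinfun_apply X x" for x
  proof -
    have "blinfun_apply (Y o\<^sub>L X) x = x" by (simp add: Y)
    then have "norm x \<le> norm Y * norm (blinfun_apply X x)"
      using norm_blinfun[of Y "blinfun_apply X x"] by simp
    also have "\<dots> \<le> k * norm (blinfun_apply X x)"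
      by (simp add: k_def mult_right_mono)
    finally have "(norm x)\<^sup>2 \<le> (k * norm (blinfun_apply X x))\<^sup>2"
      by (rule power_mono) simp
    then show ?thesis
      using k by (simp add: power_mult_distrib power2_norm_eq_inner field_simps)
  qed
  then show thesis using k by (intro that[of "1 / k\<^sup>2"]) auto
qed

text \<open>Integrability is asserted along with the formula, since the integral of a non-integrable
  function would have the default value 0.\<close>

theorem corollary5:
  fixes M :: "('h::complex_hilbert \<Rightarrow>\<^sub>L 'h) set"
    and E :: "('h \<Rightarrow>\<^sub>L 'h) \<Rightarrow> complex"
    and X :: "'h \<Rightarrow>\<^sub>L 'h"
  assumes "tracial_Wstar_probability_space M E"
    and "X \<in> M"
    and "boundedly_invertible X"
  shows "interval_lebesgue_integrable lborel 0 1 (\<lambda>t. ln (S_transform E (adj X o\<^sub>L X) (-t))) \<and>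
    fk_det E X = exp (- (1/2) * (LBINT t=0..1. ln (S_transform E (adj X o\<^sub>L X) (-t))))"
proof -
  interpret tracial_Wstar_probability_space M E by fact
  define A where "A = adj X o\<^sub>L X"
  have X: "X \<in> bounded_ops" using assms(2) by (rule M_bounded_ops)
  have XX: "x \<bullet> blinfun_apply A y = blinfun_apply X x \<bullet> blinfun_apply X y" for x y
    by (simp add: A_def adj_inner[OF X])
  have "sym_op A"
    unfolding sym_op_def by (metis XX inner_commute)
  interpret positive_element M E A
  proof
    show "A \<in> M" unfolding A_def by (intro M_compose vN(2) assms(2))
  qed (use \<open>sym_op A\<close> in \<open>auto simp: XX\<close>)
  obtain c where c: "0 < c" "\<And>x. c * (x \<bullet> x) \<le> x \<bullet> blinfun_apply A x"
    using boundedly_invertible_lower_bound[OF assms(3)] unfolding XX by metis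
  \<comment> \<open>\<open>AE_nu_ge\<close> yields a lower bound for the support only strictly below
    \<open>c\<close>, so half of it is taken.\<close>
  have "c / 2 < c" using c(1) by simp
  interpret nu: positive_compact_distribution \<nu> "c / 2" K
  proof (intro positive_compact_distribution.intro positive_compact_distribution_axioms.intro prob_space_nu sets_nu)
    show "AE x in \<nu>. x \<in> {c / 2..K}"
      using AE_nu AE_nu_ge[OF c(2) \<open>c / 2 < c\<close>] by eventually_elim auto
  qed (use c(1) in simp)
  have "psi_fun E A = nu.\<psi>"
    by (simp add: psi_fun_def nu.\<psi>_def fun_eq_iff)
  then have S: "S_transform E A z = (1 + inverse z) * the_inv_into {..<0} nu.\<psi> z" for z
    by (simp add: S_transform_def psi_inv_def)
  \<comment> \<open>Once \<open>l\<close> is below the support of \<nu>, the truncation has no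
    effect almost everywhere. The family defining the determinant is then eventually constant, and
    its limit is finite.\<close>
  have "Re (E (fun_calc (log_plus l) A)) = (\<integral>x. ln x \<partial>\<nu>)" if "0 < l" "l < c / 2" for l
  proof -
    have b: "bdd_borel K (log_plus l)" using that(1) by (rule bdd_borel_log_plus)
    have "Re (E (fun_calc (log_plus l) A)) = (\<integral>x. log_plus l x \<partial>\<nu>)"
      using trace_calc[OF b] by (simp add: fun_calc_eq[OF b] trace_def)
    also have "\<dots> = (\<integral>x. ln x \<partial>\<nu>)"
    proof (rule integral_cong_AE)
      show "AE x in \<nu>. log_plus l x = ln x"
        using nu.ab by eventually_elim (use that in \<open>simp add: log_plus_def\<close>)
    qed (auto intro!: nu.measurable_\<nu> bdd_borel_measurable[OF b])
    finally show ?thesis .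
  qed
  then have "\<forall>\<^sub>F l in at_right 0. ereal (Re (E (fun_calc (log_plus l) A))) = ereal (\<integral>x. ln x \<partial>\<nu>)"
    using eventually_at_right_real[of 0 "c / 2"] c(1) by (auto elim: eventually_mono)
  then have "fk_log_limit E X = ereal (\<integral>x. ln x \<partial>\<nu>)"
    unfolding fk_log_limit_def A_def[symmetric]
    by (intro tendsto_Lim tendsto_eventually) auto
  then have "fk_det E X = exp (1/2 * (\<integral>x. ln x \<partial>\<nu>))"
    by (simp add: fk_det_def)
  then show ?thesis
    using nu.integral_ln_S[OF S] unfolding A_def[symmetric] by simp
qed

end
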